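(* Let $n\ge 1$ and $m$ be integers. If $m\geq n+1$, then there is no map $f\in C^{0,\frac{n+1}{n+2}+}(\mathbb{B}^m,\mathbb{H}^n)$ such that $f|_{\mathbb{S}^{m-1}}$ is a topological embedding.
   Context: $\mathbb{B}^m\subset\mathbb{R}^m$ is the (closed) unit ball centered at the origin and $\mathbb{S}^{m-1}$ is its boundary, the unit sphere. Heisenberg group: $\mathbb{H}^n$ is the set $\mathbb{R}^{2n+1}$ with coordinates $(x,y,t)\in\mathbb{R}^n\times\mathbb{R}^n\times\mathbb{R}$ and the Lie group law $$(x,y,t)*(x',y',t')=\Big(x+x',\,y+y',\,t+t'+2\sum_{j=1}^n(y_jx_j'-x_jy_j')\Big).$$ It is equipped with the Carnot-Carathéodory metric $d_c$: $d_c(p,q)$ is the infimum of lengths (computed with respect to a left-invariant Riemannian metric) of horizontal curves connecting $p$ and $q$, i.e. curves tangent to the distribution $\ker\alpha$, where $\alpha=dt+2\sum_{j=1}^n(x_j\,dy_j-y_j\,dx_j)$. This metric is bi-Lipschitz equivalent to the Korányi metric $d_K(p,q)=\|q^{-1}*p\|_K$, $\|(x,y,t)\|_K=(|(x,y)|^4+t^2)^{1/4}$, and $\mathbb{H}^n$ is regarded as a metric space with the metric $d_K$ (the function class below does not depend on whether $d_c$ or $d_K$ is used). For a metric space $(X,d)$ and $\alpha\in(0,1]$, a map $f:\mathbb{B}^m\to X$ belongs to $C^{0,\alpha+}(\mathbb{B}^m,X)$ if $$\lim_{t\to0^+}\ \sup\left\{\frac{d(f(x),f(y))}{|x-y|^\alpha}:\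 x,y\in\mathbb{B}^m,\ 0<|x-y|\le t\right\}=0.$$ In the notation $C^{0,\frac{n+1}{n+2}+}$ the exponent is $\alpha=\frac{n+1}{n+2}$. A topological embedding is a homeomorphism onto its image. *)

theory Defs
  imports "HOL-Analysis.Analysis"
begin

text \<open>
  The Heisenberg group over \<open>\<real>\<^sup>n \<times> \<real>\<^sup>n \<times> \<real>\<close>, where \<open>n = CARD('n)\<close>.  It is a type of its own so that
  the library's metric and topological notions refer to the Koranyi metric on it, and not to the
  Euclidean metric of the underlying product.
\<close>

datatype ('n::finite) heis = Heis (xcoord: "real ^ 'n") (ycoord: "real ^ 'n") (tcoord: real)

definition heis_mult :: "'n::finite heis \<Rightarrow> 'n heis \<Rightarrow> 'n heis" where
  "heis_mult p q =
     Heis (xcoord p + xcoord q) (ycoord p + ycoord q)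
       (tcoord p + tcoord q
          + 2 * (\<Sum>j\<in>UNIV. ycoord p $ j * xcoord q $ j - xcoord p $ j * ycoord q $ j))"

definition heis_one :: "'n::finite heis" where
  "heis_one = Heis 0 0 0"

definition heis_inv :: "'n::finite heis \<Rightarrow> 'n heis" where
  "heis_inv p = Heis (- xcoord p) (- ycoord p) (- tcoord p)"

definition koranyi_norm :: "'n::finite heis \<Rightarrow> real" where
  "koranyi_norm p = root 4 (norm (xcoord p, ycoord p) ^ 4 + tcoord p ^ 2)"

lemma heis_mult_inner:
  "heis_mult p q =
     Heis (xcoord p + xcoord q) (ycoord p + ycoord q)
       (tcoord p + tcoord q + 2 * (ycoord p \<bullet> xcoord q - xcoord p \<bullet> ycoord q))"
  by (simp add: heis_mult_def inner_vec_def sum_subtractf)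

interpretation heis: group heis_mult heis_one heis_inv
  by standard
    (auto simp: heis_mult_inner heis_one_def heis_inv_def heis.expand inner_add_left inner_add_right
      inner_commute)

lemma koranyi_norm_nonneg: "koranyi_norm p \<ge> 0"
  by (simp add: koranyi_norm_def)

lemma koranyi_norm_eq_0_iff: "koranyi_norm p = 0 \<longleftrightarrow> p = heis_one"
proof -
  have "norm (xcoord p, ycoord p) ^ 4 + tcoord p ^ 2 = 0 \<longleftrightarrow>
      norm (xcoord p, ycoord p) ^ 4 = 0 \<and> tcoord p ^ 2 = 0"
    by (intro add_nonneg_eq_0_iff) auto
  then show ?thesis
    by (cases p) (auto simp: koranyi_norm_def heis_one_def zero_prod_def)
qed

lemma koranyi_norm_inv: "koranyi_norm (heis_inv p) = koranyi_norm p"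
  by (simp add: koranyi_norm_def heis_inv_def norm_prod_def)

lemma koranyi_norm_sq:
  "koranyi_norm p ^ 2 = cmod (Complex (norm (xcoord p, ycoord p) ^ 2) (tcoord p))"
proof -
  let ?a = "norm (xcoord p, ycoord p) ^ 4 + tcoord p ^ 2"
  have "(koranyi_norm p ^ 2) ^ 2 = ?a"
    by (simp add: koranyi_norm_def flip: power_mult)
  then have "koranyi_norm p ^ 2 = sqrt ?a"
    by (metis real_sqrt_unique zero_le_power2)
  then show ?thesis
    by (simp add: cmod_def flip: power_mult)
qed

lemma hermitian_cauchy_schwarz:
  fixes x y x' y' :: "'a::real_inner"
  shows "cmod (Complex (x \<bullet> x' + y \<bullet> y') (y \<bullet> x' - x \<bullet> y')) \<le> norm (x, y) * norm (x', y')"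
proof -
  define a where "a = x \<bullet> x' + y \<bullet> y'"
  define b where "b = y \<bullet> x' - x \<bullet> y'"
  define c where "c = a\<^sup>2 + b\<^sup>2"
  define N where "N = norm (x, y)"
  define N' where "N' = norm (x', y')"
  define v where "v = a *\<^sub>R (x, y) + b *\<^sub>R (y, - x)"
  have "c = v \<bullet> (x', y')"
    by (simp add: v_def c_def inner_add_left power2_eq_square)
      (simp add: a_def b_def algebra_simps)
  then have "c \<le> norm v * N'"
    unfolding N'_def by (metis norm_cauchy_schwarz)
  moreover have "v \<bullet> v = c * ((x, y) \<bullet> (x, y))"
    by (simp add: v_def c_def inner_add_left inner_add_right power2_eq_square inner_commute
        algebra_simps)
  then have "norm v = sqrt c * N"
    by (simp add: norm_eq_sqrt_inner N_def real_sqrt_mult)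
  ultimately have le: "c \<le> sqrt c * (N * N')"
    by (simp add: mult.assoc)
  have "c \<ge> 0" "N \<ge> 0" "N' \<ge> 0"
    by (auto simp: c_def N_def N'_def)
  have "sqrt c \<le> N * N'"
  proof (cases "c = 0")
    case True
    then show ?thesis using \<open>N \<ge> 0\<close> \<open>N' \<ge> 0\<close> by simp
  next
    case False
    then have "sqrt c > 0" using \<open>c \<ge> 0\<close> by simp
    moreover have "sqrt c * sqrt c \<le> sqrt c * (N * N')"
      using le \<open>c \<ge> 0\<close> by simp
    ultimately show ?thesis by (metis mult_le_cancel_left_pos)
  qed
  then show ?thesis
    by (simp add: cmod_def a_def b_def c_def N_def N'_def)
qed

lemma koranyi_norm_mult_le: "koranyi_norm (heis_mult p q) \<le> koranyi_norm p + koranyi_norm q"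
proof -
  define W :: "'a heis \<Rightarrow> complex"
    where "W p = Complex (norm (xcoord p, ycoord p) ^ 2) (tcoord p)" for p
  define h where
    "h = Complex (xcoord p \<bullet> xcoord q + ycoord p \<bullet> ycoord q)
           (ycoord p \<bullet> xcoord q - xcoord p \<bullet> ycoord q)"
  have sq: "koranyi_norm p ^ 2 = cmod (W p)" for p :: "'a heis"
    by (simp add: W_def koranyi_norm_sq)
  have le: "norm (xcoord p, ycoord p) \<le> koranyi_norm p" for p :: "'a heis"
  proof (rule power2_le_imp_le[OF _ koranyi_norm_nonneg])
    show "(norm (xcoord p, ycoord p))\<^sup>2 \<le> (koranyi_norm p)\<^sup>2"
      using complex_Re_le_cmod[of "W p"] by (simp add: sq) (simp add: W_def)
  qed
  have "W (heis_mult p q) = W p + W q + 2 * h"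
    by (simp add: W_def h_def heis_mult_inner complex_eq_iff power2_norm_eq_inner
        inner_add_left inner_add_right inner_commute)
  then have "koranyi_norm (heis_mult p q) ^ 2 \<le> cmod (W p) + cmod (W q) + cmod (2 * h)"
    by (metis (no_types, lifting) sq norm_triangle_le norm_triangle_ineq add_right_mono)
  also have "\<dots> \<le> koranyi_norm p ^ 2 + koranyi_norm q ^ 2
      + 2 * (norm (xcoord p, ycoord p) * norm (xcoord q, ycoord q))"
    using hermitian_cauchy_schwarz[of "xcoord p" "xcoord q" "ycoord p" "ycoord q"]
    by (simp add: sq h_def norm_mult)
  also have "\<dots> \<le> koranyi_norm p ^ 2 + koranyi_norm q ^ 2 + 2 * (koranyi_norm p * koranyi_norm q)"
    by (intro add_left_mono mult_left_mono mult_mono le koranyi_norm_nonneg) auto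
  also have "\<dots> = (koranyi_norm p + koranyi_norm q) ^ 2"
    by (simp add: power2_sum)
  finally show ?thesis
    by (rule power2_le_imp_le) (simp add: koranyi_norm_nonneg)
qed

instantiation heis :: (finite) metric_space
begin

definition dist_heis :: "'a heis \<Rightarrow> 'a heis \<Rightarrow> real" where
  "dist_heis p q = koranyi_norm (heis_mult (heis_inv q) p)"

definition uniformity_heis :: "('a heis \<times> 'a heis) filter" where
  "uniformity_heis = (INF e\<in>{0<..}. principal {(p, q). dist p q < e})"

definition open_heis :: "'a heis set \<Rightarrow> bool" where
  "open_heis U \<longleftrightarrow> (\<forall>p\<in>U. eventually (\<lambda>(p', q). p' = p \<longrightarrow> q \<in> U) uniformity)"

instance
proof
  fix p q r :: "'a heis"
  show "dist p q = 0 \<longleftrightarrow> p = q"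
    unfolding dist_heis_def koranyi_norm_eq_0_iff
    by (metis heis.group_left_neutral heis.left_inverse heis.assoc heis.right_inverse
        heis.right_neutral)
  have inv: "heis_inv (heis_mult a b) = heis_mult (heis_inv b) (heis_inv a)" for a b :: "'a heis"
    by (rule heis.inverse_distrib_swap)
  have sym: "dist a b = dist b a" for a b :: "'a heis"
    unfolding dist_heis_def
    by (metis inv heis.inverse_inverse koranyi_norm_inv)
  have "heis_mult (heis_inv q) p = heis_mult (heis_mult (heis_inv q) r) (heis_mult (heis_inv r) p)"
    by (metis heis.assoc heis.right_inverse heis.right_neutral)
  then have "dist p q \<le> dist r q + dist p r"
    unfolding dist_heis_def using koranyi_norm_mult_le by metis
  then show "dist p q \<le> dist p r + dist q r"
    by (simp add: sym[of r q])
qed (simp_all add: uniformity_heis_def open_heis_def)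

end

text \<open>
  The class \<open>C\<^sup>0\<^sup>,\<^sup>\<alpha>\<^sup>+(S, X)\<close>.  The supremum is taken in the extended nonnegative reals, so that it is
  \<open>\<infinity>\<close> when the quotients are unbounded.
\<close>

definition holder_plus_on :: "real \<Rightarrow> 'a::real_normed_vector set \<Rightarrow> ('a \<Rightarrow> 'b::metric_space) set"
  where
  "holder_plus_on \<alpha> S =
     {f. ((\<lambda>t. SUP (x, y) \<in> {(x, y). x \<in> S \<and> y \<in> S \<and> 0 < norm (x - y) \<and> norm (x - y) \<le> t}.
             ennreal (dist (f x) (f y) / norm (x - y) powr \<alpha>)) \<longlongrightarrow> 0) (at_right 0)}"

end

theory Submission
  imports Defs
begin

text \<open>
  Restricting to a coordinate subspace reduces the statement to a ball of dimension \<open>N = n + 1\<close>.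
  Suppose that \<open>f\<close> is such a map of this ball and is injective on the sphere.  Two computations of
  the same integral contradict each other.

  The inverse of \<open>f\<close> on the image of the sphere is continuous on a compact subset of
  \<open>\<real>\<^sup>2\<^sup>n\<^sup>+\<^sup>1\<close>, so some polynomial map \<open>g\<close> into \<open>\<real>\<^sup>N\<close> satisfies \<open>g (f x) \<approx> x\<close> on the sphere.  Let \<open>\<phi>\<close> be
  a bump function near \<open>0\<close> and let \<open>\<omega> = \<phi>(g) dg\<^sub>1 \<and> \<dots> \<and> dg\<^sub>N\<close>.  Extend \<open>f\<close> to the whole space by
  composing with the nearest point projection to the ball, and let \<open>u\<close> be a mollification of the
  result.  Then \<open>g \<circ> u\<close> is close to \<open>x / |x|\<close> for \<open>|x| \<ge> 1\<close>; so it has degree one over a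
  neighbourhood of \<open>0\<close>, and \<open>\<integral> u\<^sup>*\<omega> = \<integral> \<phi> > 0\<close> (\<open>integral_degree_one_near_sphere\<close>).  This uses only
  that the integral of a determinant of gradients vanishes if one of the functions has compact
  support (\<open>integral_det_gradients_eq_0\<close>), a form of the theorem of Stokes.

  On the other hand \<open>\<integral> u\<^sup>*\<omega>\<close> tends to \<open>0\<close> along suitable scales \<open>\<epsilon>\<close> of the mollification
  (\<open>pullback_tends_0\<close>).  Let \<open>\<kappa>\<close> be the oscillation of \<open>f\<close> at scale \<open>\<epsilon>\<close>, measured in the Koranyi
  metric.  The differentials of the coordinates of \<open>u\<close> are \<open>O(\<kappa> / \<epsilon>)\<close>, but the pulled back contact form
  \<open>\<theta> = u\<^sup>*\<alpha>\<close> is \<open>O(\<kappa>\<^sup>2 / \<epsilon>)\<close>, because the Koranyi metric controls the vertical displacement to second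
  order.  Hence the product of \<open>\<theta>\<close> with \<open>n\<close> differentials is \<open>O(\<kappa>\<^sup>n\<^sup>+\<^sup>2 / \<epsilon>\<^sup>n\<^sup>+\<^sup>1)\<close>, which tends to \<open>0\<close>
  exactly when \<open>\<kappa> = o(\<epsilon>\<^sup>a)\<close> with \<open>a = (n + 1) / (n + 2)\<close>.  So the pullbacks of all forms
  \<open>\<alpha> \<and> \<beta>\<close> of degree \<open>n + 1\<close> are negligible, and after an integration by parts those of all forms
  \<open>d\<alpha> \<and> \<gamma>\<close> as well (\<open>symplectic_contraction_tends_0\<close>).  Every form of degree \<open>n + 1\<close> on the Heisenberg
  group is a sum of two such forms, because the Lefschetz map from forms of degree \<open>n - 1\<close> to forms of
  degree \<open>n + 1\<close> on a symplectic vector space of dimension \<open>2n\<close> is surjective (\<open>lefschetz_limit\<close>).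

  Differential forms appear throughout as determinants whose rows are gradients.
\<close>

section \<open>Determinants as functions of their rows\<close>

text \<open>
  With the rows as a family, a wedge product of \<open>1\<close>-forms is the determinant of their coefficient
  vectors, and exchanging one factor is a function update.
\<close>

definition rdet :: "('k::finite \<Rightarrow> real ^ 'k) \<Rightarrow> real" where
  "rdet r = det (\<chi> i. r i)"

lemma fun_upd_vec: "(\<chi> i. (r(k := a)) i) = (\<chi> i. if i = k then a else r i)"
  by (simp add: fun_upd_def)

lemma rdet_upd_add: "rdet (r(k := a + b)) = rdet (r(k := a)) + rdet (r(k := b))"
  using det_row_add[of k "\<lambda>_. a" "\<lambda>_. b" r] by (simp only: rdet_def fun_upd_vec)

lemma rdet_upd_scaleR: "rdet (r(k := s *\<^sub>R a)) = s * rdet (r(k := a))"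
  using det_row_mul[of k s "\<lambda>_. a" r]
  by (simp only: rdet_def fun_upd_vec vector_scalar_mult_def scaleR_vec_def real_scaleR_def)

lemma rdet_upd_0: "rdet (r(k := 0)) = 0"
  using rdet_upd_scaleR[of r k 0 0] by simp

lemma rdet_upd_diff: "rdet (r(k := a - b)) = rdet (r(k := a)) - rdet (r(k := b))"
  using rdet_upd_add[of r k a "(-1) *\<^sub>R b"] unfolding rdet_upd_scaleR by simp

lemma rdet_upd_sum:
  "finite S \<Longrightarrow> rdet (r(k := sum a S)) = (\<Sum>s\<in>S. rdet (r(k := a s)))"
  by (induction rule: finite_induct)
    (simp_all only: sum.empty sum.insert rdet_upd_0 rdet_upd_add not_False_eq_True)

lemma rdet_equal_rows: "i \<noteq> j \<Longrightarrow> r i = r j \<Longrightarrow> rdet r = 0"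
  unfolding rdet_def by (rule det_identical_rows[of i j]) (simp_all add: row_def)

lemma rdet_permute_rows:
  assumes "p permutes UNIV"
  shows "rdet (\<lambda>i. r (p i)) = of_int (sign p) * rdet r"
  using det_permute_rows[OF assms, of "\<chi> i. r i"] by (simp add: rdet_def)

lemma rdet_axis: "rdet (\<lambda>i::'k::finite. axis i 1) = 1"
proof -
  have "(\<chi> i. axis i 1) = (mat 1 :: real ^ 'k ^ 'k)"
    by (simp add: mat_def vec_eq_iff axis_def)
  then show ?thesis by (simp add: rdet_def)
qed

lemma rdet_zero_row: "r k = 0 \<Longrightarrow> rdet r = 0"
  by (metis fun_upd_triv rdet_upd_0)

lemma rdet_swap:
  assumes "i \<noteq> j"
  shows "rdet (r(i := b, j := a)) = - rdet (r(i := a, j := b))"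
proof -
  have "(\<lambda>l. (r(i := a, j := b)) (Transposition.transpose i j l)) = r(i := b, j := a)"
    using assms by (auto simp: fun_eq_iff Transposition.transpose_def)
  with rdet_permute_rows[of "Transposition.transpose i j" "r(i := a, j := b)"] show ?thesis
    using assms by (simp add: permutes_swap_id sign_swap_id)
qed

lemma rdet_two_rows:
  assumes "i1 \<noteq> i2"
  shows "rdet (r(i1 := a + a', i2 := b)) = rdet (r(i1 := a, i2 := b)) + rdet (r(i1 := a', i2 := b))"
    and "rdet (r(i1 := s *\<^sub>R a, i2 := b)) = s * rdet (r(i1 := a, i2 := b))"
  using rdet_upd_add[of "r(i2 := b)" i1 a a'] rdet_upd_scaleR[of "r(i2 := b)" i1 s a] assms
  by (simp_all only: fun_upd_twist[OF assms])

text \<open>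
  Multiplying out row by row, over all choices \<open>f\<close> of one summand per row.  For the chain rule this
  expresses \<open>dg\<^sub>1 \<and> \<dots> \<and> dg\<^sub>N\<close> through wedge products of coordinate differentials.
\<close>

lemma rdet_expand:
  fixes r :: "'c::finite \<Rightarrow> real ^ 'k::finite"
  shows "rdet (\<lambda>i. \<Sum>c\<in>UNIV. a i c *\<^sub>R r c)
           = (\<Sum>f\<in>UNIV. (\<Prod>i\<in>UNIV. a i (f i)) * rdet (\<lambda>i. r (f i)))"
proof -
  let ?P = "{p. p permutes (UNIV :: 'k set)}"
  have "(\<Prod>i\<in>UNIV. \<Sum>c\<in>UNIV. a i c * r c $ p i)
      = (\<Sum>f\<in>UNIV. \<Prod>i\<in>UNIV. a i (f i) * r (f i) $ p i)" for p :: "'k \<Rightarrow> 'k"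
    using prod_sum_PiE[of "UNIV :: 'k set" "\<lambda>_. UNIV :: 'c set" "\<lambda>i c. a i c * r c $ p i"] by simp
  then have "rdet (\<lambda>i. \<Sum>c\<in>UNIV. a i c *\<^sub>R r c)
      = (\<Sum>p\<in>?P. of_int (sign p) * (\<Sum>f\<in>UNIV. (\<Prod>i\<in>UNIV. a i (f i)) * (\<Prod>i\<in>UNIV. r (f i) $ p i)))"
    by (simp add: rdet_def det_def prod.distrib)
  also have "\<dots> = (\<Sum>f\<in>UNIV. \<Sum>p\<in>?P. of_int (sign p) * ((\<Prod>i\<in>UNIV. a i (f i)) * (\<Prod>i\<in>UNIV. r (f i) $ p i)))"
    unfolding sum_distrib_left by (rule sum.swap)
  also have "\<dots> = (\<Sum>f\<in>UNIV. (\<Prod>i\<in>UNIV. a i (f i)) * rdet (\<lambda>i. r (f i)))"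
    by (simp add: rdet_def det_def sum_distrib_left mult.left_commute)
  finally show ?thesis .
qed

lemma rdet_bound:
  fixes r :: "'k::finite \<Rightarrow> real ^ 'k"
  assumes "\<And>i. norm (r i) \<le> b i"
  shows "\<bar>rdet r\<bar> \<le> fact CARD('k) * (\<Prod>i\<in>UNIV. b i)"
proof -
  let ?P = "{p. p permutes (UNIV :: 'k set)}"
  have "\<bar>rdet r\<bar> \<le> (\<Sum>p\<in>?P. \<bar>of_int (sign p) * (\<Prod>i\<in>UNIV. r i $ p i)\<bar>)"
    unfolding rdet_def det_def by simp
  also have "\<dots> \<le> (\<Sum>p\<in>?P. \<Prod>i\<in>UNIV. b i)"
  proof (rule sum_mono)
    fix p
    have "\<bar>of_int (sign p) * (\<Prod>i\<in>UNIV. r i $ p i)\<bar> = (\<Prod>i\<in>UNIV. \<bar>r i $ p i\<bar>)"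
      by (simp add: abs_mult abs_prod sign_def)
    also have "\<dots> \<le> (\<Prod>i\<in>UNIV. b i)"
      by (rule prod_mono) (meson abs_ge_zero assms component_le_norm_cart order_trans)
    finally show "\<bar>of_int (sign p) * (\<Prod>i\<in>UNIV. r i $ p i)\<bar> \<le> (\<Prod>i\<in>UNIV. b i)" .
  qed
  also have "\<dots> = fact CARD('k) * (\<Prod>i\<in>UNIV. b i)"
    by (simp add: card_permutations)
  finally show ?thesis .
qed

lemma continuous_on_rdet:
  assumes "\<And>i. continuous_on S (\<lambda>x. r x i)"
  shows "continuous_on S (\<lambda>x. rdet (r x))"
  unfolding rdet_def det_def using assms by (auto intro!: continuous_intros)

section \<open>Continuously differentiable functions and gradients\<close>

text \<open>
  The gradient is an explicit argument because gradients are the rows of the determinants below, and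
  the domain is the whole space because compact supports take the place of boundary conditions.
\<close>

definition C1_grad :: "('a::euclidean_space \<Rightarrow> real) \<Rightarrow> ('a \<Rightarrow> 'a) \<Rightarrow> bool" where
  "C1_grad v G \<longleftrightarrow> (\<forall>x. GDERIV v x :> G x) \<and> continuous_on UNIV G"

lemma C1_grad_continuous: "C1_grad v G \<Longrightarrow> continuous_on S v"
  unfolding C1_grad_def gderiv_def
  by (meson has_derivative_continuous continuous_at_imp_continuous_on)

lemma C1_grad_continuous_grad: "C1_grad v G \<Longrightarrow> continuous_on S G"
  unfolding C1_grad_def by (meson continuous_on_subset subset_UNIV)

lemma C1_grad_const: "C1_grad (\<lambda>x. c) (\<lambda>x. 0)"
  by (simp add: C1_grad_def GDERIV_const)

lemma C1_grad_nth: "C1_grad (\<lambda>x. x $ i) (\<lambda>x. axis i 1)"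
  unfolding C1_grad_def gderiv_def
  by (auto intro!: bounded_linear_imp_has_derivative bounded_linear_vec_nth simp: inner_axis)

lemma C1_grad_inner_self: "C1_grad (\<lambda>x. x \<bullet> x) (\<lambda>x. 2 *\<^sub>R x)"
  unfolding C1_grad_def gderiv_def
  by (auto intro!: derivative_eq_intros continuous_intros simp: inner_commute)

lemma C1_grad_add:
  "C1_grad v G \<Longrightarrow> C1_grad w H \<Longrightarrow> C1_grad (\<lambda>x. v x + w x) (\<lambda>x. G x + H x)"
  by (auto simp: C1_grad_def intro!: GDERIV_add continuous_intros)

lemma C1_grad_diff:
  "C1_grad v G \<Longrightarrow> C1_grad w H \<Longrightarrow> C1_grad (\<lambda>x. v x - w x) (\<lambda>x. G x - H x)"
  by (auto simp: C1_grad_def intro!: GDERIV_diff continuous_intros)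

lemma C1_grad_mult:
  assumes "C1_grad v G" "C1_grad w H"
  shows "C1_grad (\<lambda>x. v x * w x) (\<lambda>x. v x *\<^sub>R H x + w x *\<^sub>R G x)"
  using assms C1_grad_continuous[OF assms(1)] C1_grad_continuous[OF assms(2)]
  by (auto simp: C1_grad_def intro!: GDERIV_mult continuous_intros)

lemma C1_grad_compose_real:
  assumes v: "C1_grad v G" and g: "\<And>t. (g has_real_derivative g' t) (at t)"
    and g': "continuous_on UNIV g'"
  shows "C1_grad (\<lambda>x. g (v x)) (\<lambda>x. g' (v x) *\<^sub>R G x)"
proof -
  have "continuous_on UNIV (\<lambda>x. g' (v x))"
    by (rule continuous_on_compose2[OF g' C1_grad_continuous[OF v]]) auto
  then show ?thesis
    using v g by (auto simp: C1_grad_def intro!: GDERIV_DERIV_compose[of v] continuous_intros)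
qed

lemma C1_grad_prod:
  assumes "finite I" "\<And>i. i \<in> I \<Longrightarrow> \<exists>G. C1_grad (v i) G"
  shows "\<exists>G. C1_grad (\<lambda>x. \<Prod>i\<in>I. v i x) G"
  using assms
proof (induction rule: finite_induct)
  case empty
  then show ?case using C1_grad_const by fastforce
next
  case (insert i I)
  then obtain G H where "C1_grad (v i) G" "C1_grad (\<lambda>x. \<Prod>i\<in>I. v i x) H"
    by blast
  from C1_grad_mult[OF this] insert.hyps show ?case by auto
qed

lemma has_derivative_vec_componentwise:
  fixes u :: "'a::real_normed_vector \<Rightarrow> real ^ 'c::finite"
  assumes "\<And>c. ((\<lambda>x. u x $ c) has_derivative (\<lambda>y. u' y $ c)) (at x)"
  shows "(u has_derivative u') (at x)"
  unfolding has_derivative_componentwise_within[of u]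
  using assms by (auto simp: Basis_vec_def inner_axis)

lemma C1_grad_compose:
  fixes h :: "real ^ 'c::finite \<Rightarrow> real" and u :: "'a::euclidean_space \<Rightarrow> real ^ 'c"
  assumes h: "C1_grad h H" and u: "\<And>c. C1_grad (\<lambda>x. u x $ c) (U c)"
  shows "C1_grad (\<lambda>x. h (u x)) (\<lambda>x. \<Sum>c\<in>UNIV. (H (u x) $ c) *\<^sub>R U c x)"
proof -
  have "continuous_on UNIV u"
    using continuous_on_vec_lambda[of UNIV "\<lambda>c x. u x $ c"] C1_grad_continuous[OF u] by simp
  then have 1: "continuous_on UNIV (\<lambda>x. H (u x))"
    using C1_grad_continuous_grad[OF h] continuous_on_compose2 by blast
  have "GDERIV (\<lambda>x. h (u x)) x :> (\<Sum>c\<in>UNIV. (H (u x) $ c) *\<^sub>R U c x)" for x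
  proof -
    have "(u has_derivative (\<lambda>y. \<chi> c. y \<bullet> U c x)) (at x)"
      using u unfolding C1_grad_def gderiv_def by (intro has_derivative_vec_componentwise) auto
    moreover have "(h has_derivative (\<lambda>y. y \<bullet> H (u x))) (at (u x))"
      using h by (simp add: C1_grad_def gderiv_def)
    ultimately have "((\<lambda>x. h (u x)) has_derivative (\<lambda>y. (\<chi> c. y \<bullet> U c x) \<bullet> H (u x))) (at x)"
      using has_derivative_compose by blast
    moreover have "(\<lambda>y. (\<chi> c. y \<bullet> U c x) \<bullet> H (u x)) = (\<lambda>y. y \<bullet> (\<Sum>c\<in>UNIV. (H (u x) $ c) *\<^sub>R U c x))"
      by (auto simp: inner_vec_def[of "vec_lambda _"] inner_sum_right mult.commute)
    ultimately show ?thesis by (simp add: gderiv_def)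
  qed
  moreover have "continuous_on UNIV (\<lambda>x. \<Sum>c\<in>UNIV. (H (u x) $ c) *\<^sub>R U c x)"
    using 1 by (intro continuous_intros) (auto intro: C1_grad_continuous_grad[OF u])
  ultimately show ?thesis by (simp add: C1_grad_def)
qed

text \<open>
  Gradients are local.  This discards a cutoff function where it is constant.
\<close>

lemma C1_grad_eq_on_open:
  assumes v: "C1_grad v G" and w: "C1_grad w H" and "open S" "x \<in> S"
    and eq: "\<And>y. y \<in> S \<Longrightarrow> v y = w y"
  shows "G x = H x"
proof -
  have "(v has_derivative (\<lambda>h. h \<bullet> G x)) (at x)" "(w has_derivative (\<lambda>h. h \<bullet> H x)) (at x)"
    using v w by (simp_all add: C1_grad_def gderiv_def)
  moreover from this(1) have "(w has_derivative (\<lambda>h. h \<bullet> G x)) (at x)"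
    by (rule has_derivative_transform_within_open) (use assms in auto)
  ultimately have "(\<lambda>h. h \<bullet> G x) = (\<lambda>h. h \<bullet> H x)"
    using has_derivative_unique by blast
  then show "G x = H x" by (metis vector_eq_ldot)
qed

text \<open>
  That the partial derivatives are again polynomials matters because they become factors of test
  functions, which have to be differentiable.
\<close>

lemma polynomial_C1_grad:
  fixes p :: "real ^ 'c::finite \<Rightarrow> real"
  assumes "real_polynomial_function p"
  shows "\<exists>P. C1_grad p P \<and> (\<forall>c. real_polynomial_function (\<lambda>y. P y $ c))"
  using assms
proof (induction rule: real_polynomial_function.induct)
  case (linear f)
  have "f y = y \<bullet> (\<chi> c. f (axis c 1))" for y
  proof -
    have "f y = f (\<Sum>c\<in>UNIV. y $ c *\<^sub>R axis c 1)"
      using basis_expansion[of y] by (simp add: scalar_mult_eq_scaleR)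
    also have "\<dots> = (\<Sum>c\<in>UNIV. y $ c * f (axis c 1))"
      using bounded_linear.linear[OF linear]
      by (simp add: linear_sum linear_scale)
    finally show ?thesis by (simp add: inner_vec_def)
  qed
  then have "f = (\<lambda>y. y \<bullet> (\<chi> c. f (axis c 1)))" by blast
  moreover have "C1_grad (\<lambda>y. y \<bullet> (\<chi> c. f (axis c 1))) (\<lambda>_. \<chi> c. f (axis c 1))"
    unfolding C1_grad_def gderiv_def by (auto intro!: derivative_eq_intros)
  ultimately have "C1_grad f (\<lambda>_. \<chi> c. f (axis c 1))" by simp
  then show ?case by (intro exI[of _ "\<lambda>_. \<chi> c. f (axis c 1)"]) (simp add: real_polynomial_function.intros)
next
  case (const c)
  then show ?case using C1_grad_const[of c] by (auto intro!: exI[of _ "\<lambda>_. 0"])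
next
  case (add f g)
  then obtain P Q where "C1_grad f P" "\<forall>c. real_polynomial_function (\<lambda>y. P y $ c)"
    "C1_grad g Q" "\<forall>c. real_polynomial_function (\<lambda>y. Q y $ c)" by blast
  then show ?case
    by (intro exI[of _ "\<lambda>y. P y + Q y"]) (auto intro!: C1_grad_add)
next
  case (mult f g)
  then obtain P Q where "C1_grad f P" "\<forall>c. real_polynomial_function (\<lambda>y. P y $ c)"
    "C1_grad g Q" "\<forall>c. real_polynomial_function (\<lambda>y. Q y $ c)" by blast
  with mult show ?case
    by (intro exI[of _ "\<lambda>y. f y *\<^sub>R Q y + g y *\<^sub>R P y"] conjI allI C1_grad_mult)
      (simp_all add: real_polynomial_function.intros(3,4))
qed

section \<open>Cubes and cutoff functions\<close>

definition cube :: "real \<Rightarrow> (real ^ 'k::finite) set" where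
  "cube \<rho> = cbox (vec (- \<rho>)) (vec \<rho>)"

lemma cball_subset_cube: "cball 0 \<rho> \<subseteq> cube \<rho>"
proof
  fix x :: "real ^ 'k" assume "x \<in> cball 0 \<rho>"
  then have "\<bar>x $ i\<bar> \<le> \<rho>" for i
    using component_le_norm_cart[of x i] by simp
  then show "x \<in> cube \<rho>"
    by (auto simp: cube_def mem_box_cart abs_le_iff minus_le_iff)
qed

lemma integrable_on_cube: "continuous_on UNIV f \<Longrightarrow> f integrable_on cube \<rho>"
  for f :: "real ^ 'k::finite \<Rightarrow> real"
  unfolding cube_def by (meson continuous_on_subset integrable_continuous subset_UNIV)

lemma DERIV_max_0_square: "((\<lambda>t::real. (max 0 t)\<^sup>2) has_real_derivative 2 * max 0 t) (at t)"
proof -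
  consider "t > 0" | "t < 0" | "t = 0" by linarith
  then show ?thesis
  proof cases
    case 1
    have "((\<lambda>t. t\<^sup>2) has_real_derivative 2 * max 0 t) (at t)"
      using 1 by (auto intro!: derivative_eq_intros)
    then show ?thesis
      by (rule has_field_derivative_transform_within_open[of _ _ _ "{0<..}"]) (use 1 in auto)
  next
    case 2
    have "((\<lambda>t. 0) has_real_derivative 2 * max 0 t) (at t)"
      using 2 by (auto intro!: derivative_eq_intros)
    then show ?thesis
      by (rule has_field_derivative_transform_within_open[of _ _ _ "{..<0}"]) (use 2 in auto)
  next
    case 3
    have "((\<lambda>h::real. max 0 h) \<longlongrightarrow> max 0 0) (at 0)"
      by (intro tendsto_intros)
    then have "((\<lambda>h::real. max 0 h) \<longlongrightarrow> 0) (at 0)" by simp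
    then have "((\<lambda>h::real. ((max 0 h)\<^sup>2 - 0) / h) \<longlongrightarrow> 0) (at 0)"
      by (rule Lim_transform_eventually)
        (auto simp: eventually_at_filter max_def power2_eq_square)
    then show ?thesis
      using 3 by (simp add: DERIV_def)
  qed
qed

text \<open>
  The cutoff is \<open>a / (a + b)\<close>, where \<open>a\<close> is the squared positive part of \<open>R\<^sup>2 - |x|\<^sup>2\<close> and \<open>b\<close> that of
  \<open>|x|\<^sup>2 - r\<^sup>2\<close>.  They do not vanish simultaneously since \<open>r < R\<close>.
\<close>

lemma C1_cutoff:
  assumes "0 \<le> r" "r < R"
  obtains \<psi> :: "'a::euclidean_space \<Rightarrow> real" and G
  where "C1_grad \<psi> G" "\<And>x. norm x \<le> r \<Longrightarrow> \<psi> x = 1" "\<And>x. norm x \<ge> R \<Longrightarrow> \<psi> x = 0"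
    "\<And>x. 0 \<le> \<psi> x" "\<And>x. \<psi> x \<le> 1"
proof -
  define a where "a t = (max 0 (R\<^sup>2 - t))\<^sup>2" for t :: real
  define b where "b t = (max 0 (t - r\<^sup>2))\<^sup>2" for t :: real
  define a' where "a' t = - (2 * max 0 (R\<^sup>2 - t))" for t :: real
  define b' where "b' t = 2 * max 0 (t - r\<^sup>2)" for t :: real
  have rR: "r\<^sup>2 < R\<^sup>2" using assms by (simp add: power_strict_mono)
  have pos: "a t + b t > 0" for t
  proof (cases "t < R\<^sup>2")
    case True
    then have "a t > 0" "b t \<ge> 0" by (auto simp: a_def b_def)
    then show ?thesis by simp
  next
    case False
    with rR have "a t \<ge> 0" "b t > 0" by (auto simp: a_def b_def)
    then show ?thesis by simp
  qed
  have "((\<lambda>t. (max 0 (R\<^sup>2 - t))\<^sup>2) has_real_derivative 2 * max 0 (R\<^sup>2 - t) * (- 1)) (at t)" for t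
    by (rule DERIV_chain2[of "\<lambda>t. (max 0 t)\<^sup>2", OF DERIV_max_0_square])
      (auto intro!: derivative_eq_intros)
  then have da: "(a has_real_derivative a' t) (at t)" for t
    by (simp add: a_def[abs_def] a'_def)
  have "((\<lambda>t. (max 0 (t - r\<^sup>2))\<^sup>2) has_real_derivative 2 * max 0 (t - r\<^sup>2) * 1) (at t)" for t
    by (rule DERIV_chain2[of "\<lambda>t. (max 0 t)\<^sup>2", OF DERIV_max_0_square])
      (auto intro!: derivative_eq_intros)
  then have db: "(b has_real_derivative b' t) (at t)" for t
    by (simp add: b_def[abs_def] b'_def)
  have ca: "continuous_on UNIV a" "continuous_on UNIV b" "continuous_on UNIV a'" "continuous_on UNIV b'"
    by (auto simp: a_def[abs_def] b_def[abs_def] a'_def[abs_def] b'_def[abs_def] intro!: continuous_intros)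
  define \<sigma> where "\<sigma> t = a t / (a t + b t)" for t
  define \<sigma>' where "\<sigma>' t = (a' t * (a t + b t) - a t * (a' t + b' t)) / ((a t + b t) * (a t + b t))" for t
  have d\<sigma>: "(\<sigma> has_real_derivative \<sigma>' t) (at t)" for t
    unfolding \<sigma>_def[abs_def] \<sigma>'_def using pos[of t]
    by (intro DERIV_divide[OF da DERIV_add[OF da db]]) simp
  have c\<sigma>: "continuous_on UNIV \<sigma>'"
    unfolding \<sigma>'_def[abs_def]
    by (intro continuous_on_divide continuous_on_diff continuous_on_mult continuous_on_add ca) (metis pos less_irrefl mult_eq_0_iff)
  show ?thesis
  proof
    show "C1_grad (\<lambda>x. \<sigma> (x \<bullet> x)) (\<lambda>x::'a. \<sigma>' (x \<bullet> x) *\<^sub>R (2 *\<^sub>R x))"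
      by (rule C1_grad_compose_real[OF C1_grad_inner_self d\<sigma> c\<sigma>])
    fix x :: 'a
    show "\<sigma> (x \<bullet> x) = 1" if "norm x \<le> r"
    proof -
      have "x \<bullet> x \<le> r\<^sup>2" using that power_mono[OF that, of 2] by (simp add: power2_norm_eq_inner)
      then show ?thesis using pos[of "x \<bullet> x"] by (simp add: \<sigma>_def b_def)
    qed
    show "\<sigma> (x \<bullet> x) = 0" if "norm x \<ge> R"
    proof -
      have "x \<bullet> x \<ge> R\<^sup>2" using that power_mono[OF that, of 2] assms by (simp add: power2_norm_eq_inner)
      then show ?thesis by (simp add: \<sigma>_def a_def)
    qed
    show "0 \<le> \<sigma> (x \<bullet> x)" "\<sigma> (x \<bullet> x) \<le> 1"
      using pos[of "x \<bullet> x"] by (auto simp: \<sigma>_def a_def b_def)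
  qed
qed

section \<open>Determinants of gradients are null Lagrangians\<close>

text \<open>
  The coefficients depend continuously on the parameter \<open>x\<close>, so a product of affine functions of \<open>s\<close> can
  be integrated over \<open>x\<close> coefficientwise.
\<close>

lemma prod_affine_eq_polynomial:
  fixes \<alpha> \<beta> :: "'i \<Rightarrow> 'x::topological_space \<Rightarrow> real"
  assumes "finite I" "\<And>i. continuous_on S (\<alpha> i)" "\<And>i. continuous_on S (\<beta> i)"
  shows "\<exists>c. (\<forall>k. continuous_on S (c k)) \<and>
           (\<forall>x s. (\<Prod>i\<in>I. \<alpha> i x + s * \<beta> i x) = (\<Sum>k\<le>card I. c k x * s ^ k)) \<and>
           (\<forall>x. c (card I) x = (\<Prod>i\<in>I. \<beta> i x))"
  using assms(1)
proof (induction rule: finite_induct)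
  case empty
  show ?case by (rule exI[of _ "\<lambda>_ _. 1"]) auto
next
  case (insert j I)
  then obtain c where c: "\<And>k. continuous_on S (c k)"
    "\<And>x s. (\<Prod>i\<in>I. \<alpha> i x + s * \<beta> i x) = (\<Sum>k\<le>card I. c k x * s ^ k)"
    "\<And>x. c (card I) x = (\<Prod>i\<in>I. \<beta> i x)" by blast
  let ?n = "card I"
  define d where "d k x = (if k \<le> ?n then \<alpha> j x * c k x else 0)
      + (if k = 0 then 0 else \<beta> j x * c (k - 1) x)" for k x
  have "continuous_on S (d k)" for k
  proof -
    have "continuous_on S (\<lambda>x. if k \<le> ?n then \<alpha> j x * c k x else 0)"
      by (cases "k \<le> ?n") (simp_all add: continuous_on_mult assms c(1))
    moreover have "continuous_on S (\<lambda>x. if k = 0 then 0 else \<beta> j x * c (k - 1) x)"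
      by (cases "k = 0") (simp_all add: continuous_on_mult assms c(1))
    ultimately show ?thesis
      unfolding d_def[abs_def] by (rule continuous_on_add)
  qed
  moreover have "(\<Prod>i\<in>insert j I. \<alpha> i x + s * \<beta> i x) = (\<Sum>k\<le>card (insert j I). d k x * s ^ k)" for x s
  proof -
    have "(\<Sum>k\<le>Suc ?n. d k x * s ^ k) = (\<Sum>k\<le>Suc ?n. (if k \<le> ?n then \<alpha> j x * c k x else 0) * s ^ k)
        + (\<Sum>k\<le>Suc ?n. (if k = 0 then 0 else \<beta> j x * c (k - 1) x) * s ^ k)"
      by (simp only: d_def distrib_right sum.distrib)
    also have "(\<Sum>k\<le>Suc ?n. (if k \<le> ?n then \<alpha> j x * c k x else 0) * s ^ k)
        = \<alpha> j x * (\<Sum>k\<le>?n. c k x * s ^ k)"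
      by (simp add: sum_distrib_left mult.assoc)
    also have "(\<Sum>k\<le>Suc ?n. (if k = 0 then 0 else \<beta> j x * c (k - 1) x) * s ^ k)
        = s * \<beta> j x * (\<Sum>k\<le>?n. c k x * s ^ k)"
      by (simp add: sum.atMost_Suc_shift sum_distrib_left algebra_simps del: sum.atMost_Suc)
    finally show ?thesis
      using insert.hyps by (simp add: c(2) distrib_right del: sum.atMost_Suc)
  qed
  moreover have "d (card (insert j I)) x = (\<Prod>i\<in>insert j I. \<beta> i x)" for x
    using insert.hyps by (simp add: d_def c(3))
  ultimately show ?case by blast
qed

lemma rdet_affine_eq_polynomial:
  fixes \<alpha> \<beta> :: "'k::finite \<Rightarrow> 'x::topological_space \<Rightarrow> real ^ 'k"
  assumes "\<And>i. continuous_on S (\<alpha> i)" "\<And>i. continuous_on S (\<beta> i)"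
  shows "\<exists>c. (\<forall>k. continuous_on S (c k)) \<and>
           (\<forall>x s. rdet (\<lambda>i. \<alpha> i x + s *\<^sub>R \<beta> i x) = (\<Sum>k\<le>CARD('k). c k x * s ^ k)) \<and>
           (\<forall>x. c CARD('k) x = rdet (\<lambda>i. \<beta> i x))"
proof -
  let ?P = "{p. p permutes (UNIV :: 'k set)}"
  have "\<exists>c. (\<forall>k. continuous_on S (c k)) \<and>
      (\<forall>x s. (\<Prod>i\<in>UNIV. \<alpha> i x $ p i + s * \<beta> i x $ p i) = (\<Sum>k\<le>CARD('k). c k x * s ^ k)) \<and>
      (\<forall>x. c CARD('k) x = (\<Prod>i\<in>UNIV. \<beta> i x $ p i))" for p :: "'k \<Rightarrow> 'k"
    by (rule prod_affine_eq_polynomial) (auto intro!: continuous_intros assms)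
  then obtain c where c: "\<And>p k. continuous_on S (c p k)"
    "\<And>p x s. (\<Prod>i\<in>UNIV. \<alpha> i x $ p i + s * \<beta> i x $ p i) = (\<Sum>k\<le>CARD('k). c p k x * s ^ k)"
    "\<And>p x. c p CARD('k) x = (\<Prod>i\<in>UNIV. \<beta> i x $ p i)"
    by metis
  define d where "d k x = (\<Sum>p\<in>?P. of_int (sign p) * c p k x)" for k x
  have "continuous_on S (d k)" for k
    unfolding d_def[abs_def] by (intro continuous_intros c(1))
  moreover have "rdet (\<lambda>i. \<alpha> i x + s *\<^sub>R \<beta> i x) = (\<Sum>k\<le>CARD('k). d k x * s ^ k)" for x s
  proof -
    have "rdet (\<lambda>i. \<alpha> i x + s *\<^sub>R \<beta> i x) = (\<Sum>p\<in>?P. of_int (sign p) * (\<Sum>k\<le>CARD('k). c p k x * s ^ k))"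
      by (simp add: rdet_def det_def c(2)[symmetric])
    also have "\<dots> = (\<Sum>p\<in>?P. \<Sum>k\<le>CARD('k). of_int (sign p) * c p k x * s ^ k)"
      by (simp add: sum_distrib_left mult.assoc)
    also have "\<dots> = (\<Sum>k\<le>CARD('k). \<Sum>p\<in>?P. of_int (sign p) * c p k x * s ^ k)"
      by (rule sum.swap)
    also have "\<dots> = (\<Sum>k\<le>CARD('k). d k x * s ^ k)"
      by (simp add: d_def sum_distrib_right)
    finally show ?thesis .
  qed
  moreover have "d CARD('k) x = rdet (\<lambda>i. \<beta> i x)" for x
    by (simp add: d_def c(3) rdet_def det_def)
  ultimately show ?thesis by blast
qed

text \<open>
  The perturbation \<open>V\<close> is a strict contraction, so \<open>x + V x = x' + V x'\<close> forces \<open>x = x'\<close>, and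
  \<open>x \<mapsto> y - V x\<close> has a fixed point for each \<open>y\<close>.  The cube is preserved because it contains the ball off
  which the map is the identity.
\<close>

lemma perturbed_identity_on_cube:
  fixes V :: "real ^ 'k::finite \<Rightarrow> real ^ 'k"
  assumes lip: "\<And>x y. norm (V x - V y) \<le> c * norm (x - y)" and c: "0 \<le> c" "c < 1"
    and 0: "\<And>x. norm x \<ge> \<rho> \<Longrightarrow> V x = 0"
  shows "inj (\<lambda>x. x + V x)" "(\<lambda>x. x + V x) ` cube \<rho> = cube \<rho>"
proof -
  have *: "x = y" if "x + V x = y + V y" for x y
  proof -
    have "x - y = V y - V x"
      using that by (simp add: algebra_simps)
    then have "norm (x - y) = norm (V x - V y)"
      by (simp add: norm_minus_commute)
    also have "\<dots> \<le> c * norm (x - y)" by (rule lip)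
    finally have "(1 - c) * norm (x - y) \<le> 0" by (simp add: algebra_simps)
    then show "x = y" using c by (simp add: mult_le_0_iff)
  qed
  then show "inj (\<lambda>x. x + V x)" by (rule injI)
  have surj: "\<exists>x. x + V x = y" for y
  proof -
    have "\<exists>!x. (\<lambda>x. y - V x) x = x"
      by (rule banach_fix_type[OF c]) (simp add: dist_norm lip norm_minus_commute)
    then show ?thesis by (metis diff_add_cancel)
  qed
  have fix0: "x + V x = x" if "x \<notin> cball 0 \<rho>" for x
    using that 0 by simp
  show "(\<lambda>x. x + V x) ` cube \<rho> = cube \<rho>"
  proof (intro equalityI subsetI)
    fix y assume "y \<in> (\<lambda>x. x + V x) ` cube \<rho>"
    then obtain x where x: "x \<in> cube \<rho>" "y = x + V x" by blast
    show "y \<in> cube \<rho>"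
    proof (cases "y \<in> cball 0 \<rho>")
      case True
      then show ?thesis using cball_subset_cube by blast
    next
      case False
      then have "y + V y = x + V x" using fix0 x by metis
      then show ?thesis using * x by metis
    qed
  next
    fix y :: "real ^ 'k" assume y: "y \<in> cube \<rho>"
    obtain x where x: "x + V x = y" using surj by blast
    have "x \<in> cube \<rho>"
    proof (cases "x \<in> cball 0 \<rho>")
      case True
      then show ?thesis using cball_subset_cube by blast
    next
      case False
      then show ?thesis using fix0 x y by metis
    qed
    with x show "y \<in> (\<lambda>x. x + V x) ` cube \<rho>" by blast
  qed
qed

lemma compactly_supported_field_lipschitz:
  fixes V :: "real ^ 'k::finite \<Rightarrow> real ^ 'k"
  assumes V: "\<And>i. C1_grad (\<lambda>x. V x $ i) (G i)" and 0: "\<And>x. norm x \<ge> \<rho> \<Longrightarrow> V x = 0"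
  obtains L where "L > 0" "\<And>x y. norm (V x - V y) \<le> L * norm (x - y)"
proof -
  have "\<exists>B. \<forall>x. norm (G i x) \<le> B" for i
  proof -
    have "compact (G i ` cball 0 \<rho>)"
      by (intro compact_continuous_image C1_grad_continuous_grad[OF V] compact_cball)
    then obtain B where B: "\<And>x. x \<in> cball 0 \<rho> \<Longrightarrow> norm (G i x) \<le> B"
      using compact_imp_bounded bounded_iff by (metis imageI)
    have "norm (G i x) \<le> max B 0" for x
    proof (cases "norm x \<le> \<rho>")
      case True
      then show ?thesis using B[of x] by simp
    next
      case False
      have "open {x :: real ^ 'k. \<rho> < norm x}" by (intro open_Collect_less continuous_intros)
      then have "G i x = 0"
        by (rule C1_grad_eq_on_open[OF V C1_grad_const[of 0]]) (use False 0 in auto)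
      then show ?thesis by simp
    qed
    then show ?thesis by blast
  qed
  then obtain B where B: "\<And>i x. norm (G i x) \<le> B i" by metis
  define L where "L = (\<Sum>i\<in>UNIV. B i) + 1"
  have B0: "B i \<ge> 0" for i using B norm_ge_zero order_trans by blast
  then have "L > 0" unfolding L_def by (simp add: add_nonneg_pos sum_nonneg)
  have "norm (V x - V y) \<le> L * norm (x - y)" for x y
  proof (rule differentiable_bound[of UNIV V "\<lambda>x h. \<chi> i. h \<bullet> G i x"])
    fix x :: "real ^ 'k"
    show "(V has_derivative (\<lambda>h. \<chi> i. h \<bullet> G i x)) (at x within UNIV)"
      using V unfolding C1_grad_def gderiv_def by (intro has_derivative_vec_componentwise) auto
    show "onorm (\<lambda>h. \<chi> i. h \<bullet> G i x) \<le> L"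
    proof (rule onorm_le)
      fix h
      have "norm (\<chi> i. h \<bullet> G i x) \<le> (\<Sum>i\<in>UNIV. \<bar>h \<bullet> G i x\<bar>)"
        using norm_le_l1_cart[of "\<chi> i. h \<bullet> G i x"] by simp
      also have "\<dots> \<le> (\<Sum>i\<in>UNIV. norm h * B i)"
        by (rule sum_mono) (meson B Cauchy_Schwarz_ineq2 mult_left_mono norm_ge_zero order_trans)
      also have "\<dots> = norm h * (\<Sum>i\<in>UNIV. B i)"
        by (simp only: sum_distrib_left)
      also have "\<dots> \<le> L * norm h"
        by (simp add: L_def algebra_simps)
      finally show "norm (\<chi> i. h \<bullet> G i x) \<le> L * norm h" .
    qed
  qed auto
  with \<open>L > 0\<close> that show ?thesis by blast
qed

text \<open>
  The argument of Milnor and Rogers.  For small \<open>s > 0\<close> the map \<open>x \<mapsto> x + s V x\<close> is a bijection of the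
  cube with positive Jacobian, so the integral of its Jacobian is the volume of the cube.  This integral
  is a polynomial in \<open>s\<close>, hence constant, and its coefficient of degree \<open>N \<ge> 1\<close> is the integral of the
  Jacobian of \<open>V\<close>.
\<close>

lemma integral_det_compactly_supported_field:
  fixes V :: "real ^ 'k::{finite,wellorder} \<Rightarrow> real ^ 'k::_"
  assumes V: "\<And>i. C1_grad (\<lambda>x. V x $ i) (G i)" and 0: "\<And>x. norm x \<ge> \<rho> \<Longrightarrow> V x = 0"
  shows "integral (cube \<rho>) (\<lambda>x. rdet (\<lambda>i. G i x)) = 0"
proof -
  obtain L where L: "L > 0" "\<And>x y. norm (V x - V y) \<le> L * norm (x - y)"
    using compactly_supported_field_lipschitz[OF V 0] by blast
  obtain c where c: "\<And>k. continuous_on UNIV (c k)"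
    "\<And>x s. rdet (\<lambda>i. axis i 1 + s *\<^sub>R G i x) = (\<Sum>k\<le>CARD('k). c k x * s ^ k)"
    "\<And>x. c CARD('k) x = rdet (\<lambda>i. G i x)"
    using rdet_affine_eq_polynomial[of UNIV "\<lambda>i _. axis i 1" G] C1_grad_continuous_grad[OF V]
    by (auto intro: continuous_on_const)
  define J where "J s x = rdet (\<lambda>i. axis i 1 + s *\<^sub>R G i x)" for s x
  have J_cont: "continuous_on UNIV (J s)" for s
    unfolding J_def[abs_def]
    by (intro continuous_on_rdet continuous_intros C1_grad_continuous_grad[OF V])
  have J0: "J 0 x = 1" for x
    by (simp add: J_def rdet_axis)
  obtain s0 where s0: "s0 > 0" "s0 \<le> 1" "\<And>s x. \<bar>s\<bar> < s0 \<Longrightarrow> x \<in> cube \<rho> \<Longrightarrow> J s x > 0"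
  proof -
    have "continuous_on ({-1..1} \<times> cube \<rho>) (\<lambda>(s, x). J s x)"
      unfolding J_def split_beta
      by (intro continuous_on_rdet continuous_intros
          continuous_on_compose2[OF C1_grad_continuous_grad[OF V, where S = UNIV]]) auto
    then have "uniformly_continuous_on ({-1..1} \<times> cube \<rho>) (\<lambda>(s, x). J s x)"
      by (rule compact_uniformly_continuous) (simp add: compact_Times cube_def)
    then obtain \<delta> where \<delta>: "\<delta> > 0" "\<And>p q. p \<in> {-1..1} \<times> cube \<rho> \<Longrightarrow> q \<in> {-1..1} \<times> cube \<rho> \<Longrightarrow>
        dist q p < \<delta> \<Longrightarrow> dist (case q of (s, x) \<Rightarrow> J s x) (case p of (s, x) \<Rightarrow> J s x) < 1"
      unfolding uniformly_continuous_on_def by (metis zero_less_one)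
    show ?thesis
    proof
      show "min \<delta> 1 > 0" "min \<delta> 1 \<le> 1" using \<delta> by auto
      fix s :: real and x :: "(real, 'k) vec" assume s: "\<bar>s\<bar> < min \<delta> 1" and x: "x \<in> cube \<rho>"
      have "dist (s, x) (0, x) < \<delta>" using s by (simp add: dist_Pair_Pair)
      with \<delta>(2)[of "(0, x)" "(s, x)"] s x have "dist (J s x) (J 0 x) < 1" by (auto simp: abs_less_iff)
      then show "J s x > 0" by (simp add: J0 dist_real_def abs_less_iff)
    qed
  qed
  let ?m = "measure lebesgue (cube \<rho> :: (real, 'k) vec set)"
  have vol: "integral (cube \<rho>) (J s) = ?m" if s: "0 < s" "s < s0" "s * L < 1" for s
  proof -
    let ?P = "\<lambda>x. x + s *\<^sub>R V x"
    have lip: "norm (s *\<^sub>R V x - s *\<^sub>R V y) \<le> (s * L) * norm (x - y)" for x y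
    proof -
      have "norm (s *\<^sub>R V x - s *\<^sub>R V y) = s * norm (V x - V y)"
        using s by (simp add: scaleR_diff_right[symmetric])
      then show ?thesis using mult_left_mono[OF L(2)[of x y], of s] s by (simp add: mult.assoc)
    qed
    have inj: "inj ?P" and im: "?P ` cube \<rho> = cube \<rho>"
      using perturbed_identity_on_cube[where V = "\<lambda>x. s *\<^sub>R V x" and c = "s * L" and \<rho> = \<rho>] lip s L 0 by auto
    let ?P' = "\<lambda>x h. \<chi> i. h \<bullet> (axis i 1 + s *\<^sub>R G i x)"
    have der: "(?P has_derivative ?P' x) (at x within cube \<rho>)" for x
    proof -
      have "((\<lambda>x. x $ i + s * V x $ i) has_derivative (\<lambda>h. h $ i + s * (h \<bullet> G i x))) (at x)" for i
        using V[of i] unfolding C1_grad_def gderiv_def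
        by (auto intro!: derivative_eq_intros bounded_linear_imp_has_derivative bounded_linear_vec_nth)
      then have "(?P has_derivative ?P' x) (at x)"
        by (intro has_derivative_vec_componentwise) (simp add: inner_axis inner_add_right)
      then show ?thesis by (rule has_derivative_at_withinI)
    qed
    have "matrix (?P' x) = (\<chi> i. axis i 1 + s *\<^sub>R G i x)" for x
      by (simp add: matrix_def vec_eq_iff inner_axis')
    then have "det (matrix (?P' x)) = J s x" for x
      by (simp add: J_def rdet_def)
    then have det: "\<bar>det (matrix (?P' x))\<bar> = J s x" if "x \<in> cube \<rho>" for x
      using s0(3)[of s x] that s by simp
    have "((\<lambda>x. \<bar>det (matrix (?P' x))\<bar>) has_integral ?m) (cube \<rho>)"
      using has_measure_differentiable_image[where S = "cube \<rho>" and f = ?P and f' = ?P' and m = ?m] der im inj_on_subset[OF inj]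
      by (simp add: cube_def)
    then have "(J s has_integral ?m) (cube \<rho>)"
      by (rule has_integral_cong[THEN iffD1, rotated]) (simp add: det)
    then show ?thesis by (rule integral_unique)
  qed
  define e where "e k = integral (cube \<rho>) (c k) - (if k = 0 then ?m else 0)" for k
  have poly: "(\<Sum>k\<le>CARD('k). e k * s ^ k) = integral (cube \<rho>) (J s) - ?m" for s
  proof -
    have "integral (cube \<rho>) (J s) = (\<Sum>k\<le>CARD('k). integral (cube \<rho>) (\<lambda>x. c k x * s ^ k))"
      unfolding J_def c(2)
      by (rule integral_sum) (auto intro!: integrable_on_cube continuous_intros c(1))
    also have "\<dots> = (\<Sum>k\<le>CARD('k). integral (cube \<rho>) (c k) * s ^ k)"
      by simp
    finally show ?thesis
      by (simp add: e_def left_diff_distrib sum_subtractf if_distrib[of "\<lambda>y. y * _"] cong: if_cong)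
  qed
  \<comment> \<open>A polynomial with infinitely many zeros has no nonzero coefficient.\<close>
  have "infinite {0<..<min s0 (1 / L)}"
    using s0 L by (simp add: infinite_Ioo)
  moreover have "{0<..<min s0 (1 / L)} \<subseteq> {s. (\<Sum>k\<le>CARD('k). e k * s ^ k) = 0}"
    using vol L by (auto simp: poly field_simps)
  ultimately have "infinite {s. (\<Sum>k\<le>CARD('k). e k * s ^ k) = 0}"
    using finite_subset by blast
  then have "e CARD('k) = 0"
    using polyfun_rootbound_finite[of "CARD('k)" e] by blast
  then show ?thesis
    by (simp add: e_def flip: c(3))
qed

lemma open_norm_gt: "open {x :: 'a::real_normed_vector. R < norm x}"
  by (intro open_Collect_less continuous_intros)

text \<open>
  In terms of forms: \<open>dv\<^sub>1 \<and> \<dots> \<and> dv\<^sub>N\<close> is the differential of a form with factor \<open>v\<^sub>k\<close>.  The other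
  functions may be cut off beyond the support of \<open>v\<^sub>k\<close>, which leaves the determinant unchanged and makes
  the whole vector field compactly supported.
\<close>

lemma integral_det_gradients_eq_0:
  fixes v :: "'k::{finite,wellorder} \<Rightarrow> real ^ 'k::_ \<Rightarrow> real"
  assumes v: "\<And>i. C1_grad (v i) (G i)" and 0: "\<And>x. norm x \<ge> R \<Longrightarrow> v k x = 0"
    and R: "0 \<le> R" "R < \<rho>"
  shows "integral (cube \<rho>) (\<lambda>x. rdet (\<lambda>i. G i x)) = 0"
proof -
  \<comment> \<open>The cutoff is constant on a ball slightly larger than the support of \<open>v k\<close>, so every point has a
    neighbourhood on which either \<open>\<psi>\<close> is \<open>1\<close> or \<open>v k\<close> is \<open>0\<close>.\<close>
  define r where "r = (R + \<rho>) / 2"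
  have r: "0 \<le> r" "R < r" "r < \<rho>" using R by (auto simp: r_def)
  obtain \<psi> :: "(real, 'k) vec \<Rightarrow> real" and D where \<psi>: "C1_grad \<psi> D"
    "\<And>x. norm x \<le> r \<Longrightarrow> \<psi> x = 1" "\<And>x. norm x \<ge> \<rho> \<Longrightarrow> \<psi> x = 0"
    "\<And>x. 0 \<le> \<psi> x" "\<And>x. \<psi> x \<le> 1"
    by (rule C1_cutoff[OF r(1,3)]) (rule that)
  define V where "V x = (\<chi> i. \<psi> x * v i x)" for x
  define H where "H i x = \<psi> x *\<^sub>R G i x + v i x *\<^sub>R D x" for i x
  have V: "C1_grad (\<lambda>x. V x $ i) (H i)" for i
    using C1_grad_mult[OF \<psi>(1) v[of i]] by (simp add: V_def H_def[abs_def])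
  have eq: "rdet (\<lambda>i. H i x) = rdet (\<lambda>i. G i x)" for x
  proof (cases "norm x < r")
    case True
    have "H i x = G i x" for i
      by (rule C1_grad_eq_on_open[OF V v, of "ball 0 r"]) (use True \<psi>(2) in \<open>auto simp: V_def\<close>)
    then show ?thesis by simp
  next
    case False
    then have x: "R < norm x" using r by simp
    have "G k x = 0"
      by (rule C1_grad_eq_on_open[OF v C1_grad_const[of 0] open_norm_gt[of R]]) (use x 0 in auto)
    moreover have "H k x = 0"
      by (rule C1_grad_eq_on_open[OF V C1_grad_const[of 0] open_norm_gt[of R]])
        (use x 0 in \<open>auto simp: V_def\<close>)
    ultimately show ?thesis by (metis rdet_zero_row)
  qed
  have "integral (cube \<rho>) (\<lambda>x. rdet (\<lambda>i. H i x)) = 0"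
    by (rule integral_det_compactly_supported_field[OF V]) (simp add: V_def \<psi>(3) vec_eq_iff)
  then show ?thesis by (simp add: eq)
qed

text \<open>
  Exchange the functions one at a time; each exchange changes the integral by a determinant in which one
  row is the gradient of a compactly supported difference.
\<close>

lemma integral_det_gradients_cong:
  fixes v w :: "'k::{finite,wellorder} \<Rightarrow> real ^ 'k::_ \<Rightarrow> real"
  assumes v: "\<And>i. C1_grad (v i) (G i)" and w: "\<And>i. C1_grad (w i) (H i)"
    and eq: "\<And>i x. norm x \<ge> R \<Longrightarrow> v i x = w i x" and R: "0 \<le> R" "R < \<rho>"
  shows "integral (cube \<rho>) (\<lambda>x. rdet (\<lambda>i. G i x)) = integral (cube \<rho>) (\<lambda>x. rdet (\<lambda>i. H i x))"
proof -
  define X where "X S i = (if i \<in> S then H i else G i)" for S i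
  have X: "C1_grad (if i \<in> S then w i else v i) (X S i)" for S i
    using v w by (simp add: X_def)
  have int: "(\<lambda>x. rdet (\<lambda>i. X S i x)) integrable_on cube \<rho>" for S
    by (intro integrable_on_cube continuous_on_rdet C1_grad_continuous_grad[OF X])
  have "integral (cube \<rho>) (\<lambda>x. rdet (\<lambda>i. X S i x)) = integral (cube \<rho>) (\<lambda>x. rdet (\<lambda>i. G i x))"
    if "finite S" for S
    using that
  proof (induction rule: finite_induct)
    case empty
    then show ?case by (simp add: X_def)
  next
    case (insert j S)
    define u where "u i = (if i = j then (\<lambda>x. w j x - v j x) else if i \<in> S then w i else v i)" for i
    define U where "U i = (if i = j then (\<lambda>x. H j x - G j x) else X S i)" for i
    have "C1_grad (u i) (U i)" for i
      using C1_grad_diff[OF w[of j] v[of j]] X[of i S] by (simp add: u_def U_def)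
    then have "integral (cube \<rho>) (\<lambda>x. rdet (\<lambda>i. U i x)) = 0"
      by (rule integral_det_gradients_eq_0[where k = j and R = R]) (use R eq in \<open>auto simp: u_def\<close>)
    moreover have "rdet (\<lambda>i. U i x) = rdet (\<lambda>i. X (insert j S) i x) - rdet (\<lambda>i. X S i x)" for x
    proof -
      have 1: "(\<lambda>i. U i x) = (\<lambda>i. X S i x)(j := H j x - G j x)"
        and 2: "(\<lambda>i. X (insert j S) i x) = (\<lambda>i. X S i x)(j := H j x)"
        and 3: "(\<lambda>i. X S i x)(j := G j x) = (\<lambda>i. X S i x)"
        using insert.hyps by (auto simp: U_def X_def fun_eq_iff)
      show ?thesis unfolding 1 2 rdet_upd_diff 3 ..
    qed
    ultimately show ?case
      using insert.IH int by (simp add: integral_diff)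
  qed
  from this[of UNIV] show ?thesis by (simp add: X_def)
qed

section \<open>The degree formula\<close>

text \<open>
  The form \<open>(D\<^sub>k \<Psi>) dy\<^sub>1 \<and> \<dots> \<and> dy\<^sub>N\<close> is obtained from \<open>dy\<^sub>1 \<and> \<dots> \<and> dy\<^sub>N\<close> by replacing \<open>dy\<^sub>k\<close> by \<open>d\<Psi>\<close>.  So both
  sides are integrals of determinants of gradients, of functions that agree near infinity.
\<close>

lemma integral_degree_one:
  fixes P :: "real ^ 'k::{finite,wellorder} \<Rightarrow> real ^ 'k::_"
  assumes P: "\<And>i. C1_grad (\<lambda>x. P x $ i) (Q i)" and id: "\<And>x. norm x \<ge> R \<Longrightarrow> P x = x"
    and \<Psi>: "C1_grad \<Psi> D" and R: "0 \<le> R" "R < \<rho>"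
  shows "integral (cube \<rho>) (\<lambda>x. D (P x) $ k * rdet (\<lambda>i. Q i x)) = integral (cube \<rho>) (\<lambda>x. D x $ k)"
proof -
  have *: "rdet (\<lambda>i. if i = k then \<Sum>j\<in>UNIV. a $ j *\<^sub>R r j else r i) = a $ k * rdet r"
    for a :: "(real, 'k) vec" and r
  proof -
    have "rdet (r(k := \<Sum>j\<in>UNIV. a $ j *\<^sub>R r j)) = (\<Sum>j\<in>UNIV. a $ j * rdet (r(k := r j)))"
      by (simp only: rdet_upd_sum[OF finite] rdet_upd_scaleR)
    also have "\<dots> = (\<Sum>j\<in>UNIV. if j = k then a $ k * rdet r else 0)"
      by (intro sum.cong refl) (auto intro: rdet_equal_rows[of _ k])
    finally show ?thesis by (simp add: fun_upd_def)
  qed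
  have idg: "C1_grad (\<lambda>x. x $ i) (\<lambda>x. axis i 1)" for i :: 'k
    by (rule C1_grad_nth)
  have "integral (cube \<rho>) (\<lambda>x. rdet (\<lambda>i. (if i = k then (\<lambda>x. \<Sum>j\<in>UNIV. D (P x) $ j *\<^sub>R Q j x) else Q i) x))
      = integral (cube \<rho>) (\<lambda>x. rdet (\<lambda>i. (if i = k then (\<lambda>x. \<Sum>j\<in>UNIV. D x $ j *\<^sub>R axis j 1) else (\<lambda>x. axis i 1)) x))"
    by (rule integral_det_gradients_cong[where R = R and v = "\<lambda>i. if i = k then (\<lambda>x. \<Psi> (P x)) else (\<lambda>x. P x $ i)"
        and w = "\<lambda>i. if i = k then (\<lambda>x. \<Psi> x) else (\<lambda>x. x $ i)"])
      (use R id C1_grad_compose[OF \<Psi> P] C1_grad_compose[OF \<Psi> idg] P idg in auto)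
  then show ?thesis
    by (simp add: if_distribR * rdet_axis cong: if_cong)
qed

lemma exists_antiderivative:
  fixes a :: "real \<Rightarrow> real"
  assumes a: "continuous_on UNIV a" and 0: "\<And>t. t < - s \<Longrightarrow> a t = 0"
  shows "\<exists>A. \<forall>t. (A has_real_derivative a t) (at t)"
proof -
  define A where "A t = integral {- s - 1..t} a" for t
  have "(A has_real_derivative a t) (at t)" for t
  proof (cases "t < - s")
    case True
    have "((\<lambda>_. 0) has_real_derivative a t) (at t)" using 0[OF True] by simp
    then show ?thesis
    proof (rule has_field_derivative_transform_within_open[of _ _ _ "{..< - s}"])
      fix x assume "x \<in> {..< - s}"
      then have "integral {- s - 1..x} a = integral {- s - 1..x} (\<lambda>_. 0)"
        by (intro integral_cong 0) auto
      then show "0 = A x" by (simp add: A_def)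
    qed (use True in auto)
  next
    case False
    have "(A has_real_derivative a t) (at t within {- s - 1..t + 1})"
      unfolding A_def[abs_def]
      by (rule integral_has_real_derivative[OF continuous_on_subset[OF a]]) (use False in auto)
    moreover have "at t within {- s - 1..t + 1} = at t"
      using False by (intro at_within_interior) (simp add: interior_atLeastAtMost_real)
    ultimately show ?thesis by simp
  qed
  then show ?thesis by blast
qed

text \<open>
  The bump is a product of one-dimensional bumps, so a potential in the direction \<open>k\<close> arises by
  integrating the factor that depends on \<open>y\<^sub>k\<close>.
\<close>

lemma potential_of_bump:
  obtains \<Psi> :: "real ^ 'k::finite \<Rightarrow> real" and D :: "real ^ 'k \<Rightarrow> real ^ 'k" and D' and k :: 'k
  where "C1_grad \<Psi> D" "C1_grad (\<lambda>y. D y $ k) D'" "\<And>y. norm y \<ge> 1/2 \<Longrightarrow> D y $ k = 0"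
    "integral (cube 2) (\<lambda>y. D y $ k) > 0"
proof -
  \<comment> \<open>A vector of norm at least \<open>1/2\<close> has a coordinate of absolute value at least \<open>s\<close>.\<close>
  define s where "s = 1 / (2 * real CARD('k))"
  have s: "s > 0" by (simp add: s_def)
  define a where "a t = (max 0 (s\<^sup>2 - t\<^sup>2))\<^sup>2" for t :: real
  define a' where "a' t = 2 * max 0 (s\<^sup>2 - t\<^sup>2) * (- (2 * t))" for t :: real
  have a_out: "a t = 0" if "\<bar>t\<bar> \<ge> s" for t
    using that s power_mono[OF that, of 2] by (simp add: a_def)
  have a_nonneg: "a t \<ge> 0" for t by (simp add: a_def)
  have a0: "a 0 > 0" using s by (simp add: a_def max_def)
  have "((\<lambda>t. (max 0 (s\<^sup>2 - t\<^sup>2))\<^sup>2) has_real_derivative a' t) (at t)" for t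
    unfolding a'_def
    by (rule DERIV_chain2[of "\<lambda>t. (max 0 t)\<^sup>2", OF DERIV_max_0_square]) (auto intro!: derivative_eq_intros)
  then have da: "(a has_real_derivative a' t) (at t)" for t by (simp add: a_def[abs_def])
  have ca: "continuous_on UNIV a" "continuous_on UNIV a'"
    by (auto simp: a_def[abs_def] a'_def[abs_def] intro!: continuous_intros)
  obtain A where dA: "\<And>t. (A has_real_derivative a t) (at t)"
    using exists_antiderivative[OF ca(1), of s] a_out s by auto
  have comp: "C1_grad (\<lambda>y. a (y $ i)) (\<lambda>y. a' (y $ i) *\<^sub>R axis i 1)" for i :: 'k
    by (rule C1_grad_compose_real[OF C1_grad_nth da ca(2)])
  obtain k :: 'k where True by simp
  have prod: "\<exists>G. C1_grad (\<lambda>y. \<Prod>i\<in>I. a (y $ i)) G \<and> (\<forall>y. G y $ k = 0)" if "k \<notin> I" for I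
    using finite[of I] that
  proof (induction rule: finite_induct)
    case empty
    then show ?case using C1_grad_const[of 1] by (auto intro!: exI[of _ "\<lambda>_. 0"])
  next
    case (insert i I)
    then obtain G where G: "C1_grad (\<lambda>y. \<Prod>i\<in>I. a (y $ i)) G" "\<forall>y. G y $ k = 0" by auto
    from C1_grad_mult[OF comp[of i] G(1)] G(2) insert show ?case
      by (intro exI[of _ "\<lambda>y. a (y $ i) *\<^sub>R G y + (\<Prod>i\<in>I. a (y $ i)) *\<^sub>R a' (y $ i) *\<^sub>R axis i 1"])
        (auto simp: axis_def)
  qed
  obtain G where G: "C1_grad (\<lambda>y. \<Prod>i\<in>-{k}. a (y $ i)) G" "\<forall>y. G y $ k = 0"
    using prod[of "-{k}"] by auto
  define \<Psi> where "\<Psi> y = A (y $ k) * (\<Prod>i\<in>-{k}. a (y $ i))" for y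
  define D where "D y = A (y $ k) *\<^sub>R G y + (\<Prod>i\<in>-{k}. a (y $ i)) *\<^sub>R a (y $ k) *\<^sub>R axis k 1" for y
  have \<Psi>: "C1_grad \<Psi> D"
    unfolding \<Psi>_def[abs_def] D_def[abs_def]
    by (rule C1_grad_mult[OF C1_grad_compose_real[OF C1_grad_nth dA ca(1)] G(1)])
  have D: "D y $ k = (\<Prod>i\<in>UNIV. a (y $ i))" for y
  proof -
    have "(\<Prod>i\<in>UNIV. a (y $ i)) = a (y $ k) * (\<Prod>i\<in>UNIV - {k}. a (y $ i))"
      by (rule prod.remove) auto
    then show ?thesis using G(2) by (simp add: D_def axis_def Compl_eq_Diff_UNIV)
  qed
  obtain D' where D': "C1_grad (\<lambda>y. D y $ k) D'"
    using C1_grad_prod[of UNIV "\<lambda>i y. a (y $ i)"] comp unfolding D by auto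
  show ?thesis
  proof (rule that[OF \<Psi> D'])
    fix y :: "(real, 'k) vec" assume y: "norm y \<ge> 1/2"
    have "\<exists>i. \<bar>y $ i\<bar> \<ge> s"
    proof (rule ccontr)
      assume "\<not> ?thesis"
      then have "(\<Sum>i\<in>UNIV. \<bar>y $ i\<bar>) < (\<Sum>i\<in>(UNIV :: 'k set). s)"
        by (intro sum_strict_mono) (auto simp: not_le)
      also have "\<dots> = 1/2" by (simp add: s_def)
      finally show False using norm_le_l1_cart[of y] y by linarith
    qed
    then show "D y $ k = 0" unfolding D using a_out by (simp add: prod_zero_iff) blast
  next
    let ?\<phi> = "\<lambda>y. D y $ k"
    have c: "continuous_on (cube 2) ?\<phi>" by (rule C1_grad_continuous[OF D'])
    have nn: "?\<phi> y \<ge> 0" for y unfolding D by (intro prod_nonneg a_nonneg)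
    have int: "?\<phi> integrable_on cube 2" by (rule integrable_on_cube[OF C1_grad_continuous[OF D']])
    have "integral (cube 2) ?\<phi> \<noteq> 0"
    proof
      assume "integral (cube 2) ?\<phi> = 0"
      then have "(?\<phi> has_integral 0) (cube 2)" using integrable_integral[OF int] by simp
      then have "?\<phi> 0 = 0"
        using has_integral_0_cbox_imp_0[of "vec (-2)" "vec 2" ?\<phi> 0] c nn
        by (auto simp: cube_def mem_box_cart interval_ne_empty_cart)
      then show False using a0 unfolding D by simp
    qed
    moreover have "integral (cube 2) ?\<phi> \<ge> 0" by (rule integral_nonneg[OF int nn])
    ultimately show "integral (cube 2) ?\<phi> > 0" by simp
  qed
qed

text \<open>
  Interpolating between \<open>F\<close> on the ball and the identity near infinity keeps the values outside the ball
  in the half space \<open>y \<bullet> x / |x| \<ge> 1/2\<close>, where the density \<open>D\<^sub>k \<Psi>\<close> vanishes.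
\<close>

lemma integral_degree_one_near_sphere:
  fixes F :: "real ^ 'k::{finite,wellorder} \<Rightarrow> real ^ 'k::_"
  assumes F: "\<And>i. C1_grad (\<lambda>x. F x $ i) (Q i)"
    and near: "\<And>x. norm x \<ge> 1 \<Longrightarrow> norm (F x - x /\<^sub>R norm x) \<le> 1/4"
    and \<Psi>: "C1_grad \<Psi> D" and D0: "\<And>y. norm y \<ge> 1/2 \<Longrightarrow> D y $ k = 0"
  shows "integral (cube 2) (\<lambda>x. D (F x) $ k * rdet (\<lambda>i. Q i x)) = integral (cube 2) (\<lambda>x. D x $ k)"
proof -
  obtain \<psi> :: "(real, 'k) vec \<Rightarrow> real" and S where \<psi>: "C1_grad \<psi> S"
    "\<And>x. norm x \<le> 1 \<Longrightarrow> \<psi> x = 1" "\<And>x. norm x \<ge> 3/2 \<Longrightarrow> \<psi> x = 0"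
    "\<And>x. 0 \<le> \<psi> x" "\<And>x. \<psi> x \<le> 1"
    by (rule C1_cutoff[of 1 "3/2"]) (auto intro: that)
  define P where "P x = \<psi> x *\<^sub>R F x + (1 - \<psi> x) *\<^sub>R x" for x
  define R where "R i x = (\<psi> x *\<^sub>R Q i x + F x $ i *\<^sub>R S x)
    + ((1 - \<psi> x) *\<^sub>R axis i 1 + x $ i *\<^sub>R (0 - S x))" for i x
  have P: "C1_grad (\<lambda>x. P x $ i) (R i)" for i
    using C1_grad_add[OF C1_grad_mult[OF \<psi>(1) F[of i]]
        C1_grad_mult[OF C1_grad_diff[OF C1_grad_const[of 1] \<psi>(1)] C1_grad_nth[of i]]]
    by (simp add: P_def R_def[abs_def])
  have big: "norm (t *\<^sub>R F x + (1 - t) *\<^sub>R x) \<ge> 1/2" if x: "norm x \<ge> 1" and t: "0 \<le> t" "t \<le> 1" for x t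
  proof -
    define e where "e = x /\<^sub>R norm x"
    have "x \<noteq> 0" using x by auto
    then have e: "norm e = 1" "x \<bullet> e = norm x"
      using x by (auto simp: e_def dot_square_norm power2_eq_square)
    have "(e - F x) \<bullet> e \<le> norm (e - F x) * norm e" by (rule norm_cauchy_schwarz)
    also have "\<dots> \<le> 1/4" using near[OF x] by (simp add: e norm_minus_commute e_def[symmetric])
    finally have "F x \<bullet> e \<ge> 3/4" using e(1) by (simp add: inner_diff_left dot_square_norm)
    then have "t * (F x \<bullet> e) \<ge> t * (1/2)" using t by (intro mult_left_mono) auto
    moreover have "(1 - t) * norm x \<ge> (1 - t) * (1/2)" using t x by (intro mult_left_mono) auto
    ultimately have "(t *\<^sub>R F x + (1 - t) *\<^sub>R x) \<bullet> e \<ge> t * (1/2) + (1 - t) * (1/2)"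
      by (simp only: inner_add_left inner_scaleR_left e)
    then have "(t *\<^sub>R F x + (1 - t) *\<^sub>R x) \<bullet> e \<ge> 1/2" by (simp add: field_simps)
    then show ?thesis
      using norm_cauchy_schwarz[of "t *\<^sub>R F x + (1 - t) *\<^sub>R x" e] e(1) by simp
  qed
  have "D (F x) $ k * rdet (\<lambda>i. Q i x) = D (P x) $ k * rdet (\<lambda>i. R i x)" for x
  proof (cases "norm x \<ge> 1")
    case True
    have "D (F x) $ k = 0" using D0 big[OF True, of 1] by simp
    moreover have "D (P x) $ k = 0" using D0 big[OF True \<psi>(4,5)] by (simp add: P_def)
    ultimately show ?thesis by simp
  next
    case False
    have "R i x = Q i x" for i
      by (rule C1_grad_eq_on_open[OF P F, of "ball 0 1"]) (use False \<psi>(2) in \<open>auto simp: P_def\<close>)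
    moreover have "P x = F x" using False \<psi>(2) by (simp add: P_def)
    ultimately show ?thesis by simp
  qed
  then have "integral (cube 2) (\<lambda>x. D (F x) $ k * rdet (\<lambda>i. Q i x))
      = integral (cube 2) (\<lambda>x. D (P x) $ k * rdet (\<lambda>i. R i x))" by simp
  also have "\<dots> = integral (cube 2) (\<lambda>x. D x $ k)"
    by (rule integral_degree_one[OF P _ \<Psi>, of "3/2"]) (auto simp: P_def \<psi>(3))
  finally show ?thesis .
qed

section \<open>Mollification\<close>

definition bump :: "'a::euclidean_space \<Rightarrow> real" where
  "bump z = (max 0 (1 - z \<bullet> z))\<^sup>2"

definition bump_grad :: "'a::euclidean_space \<Rightarrow> 'a" where
  "bump_grad z = - (4 * max 0 (1 - z \<bullet> z)) *\<^sub>R z"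

lemma C1_grad_bump: "C1_grad bump bump_grad"
proof -
  have "((\<lambda>t. (max 0 (1 - t))\<^sup>2) has_real_derivative 2 * max 0 (1 - t) * (- 1)) (at t)" for t :: real
    by (rule DERIV_chain2[of "\<lambda>t. (max 0 t)\<^sup>2", OF DERIV_max_0_square])
      (auto intro!: derivative_eq_intros)
  then have "C1_grad (\<lambda>z::'a. (max 0 (1 - z \<bullet> z))\<^sup>2) (\<lambda>z. (2 * max 0 (1 - z \<bullet> z) * (- 1)) *\<^sub>R (2 *\<^sub>R z))"
    by (rule C1_grad_compose_real[OF C1_grad_inner_self]) (auto intro!: continuous_intros)
  then show ?thesis
    by (simp add: bump_def[abs_def] bump_grad_def[abs_def] mult.commute)
qed

lemma bump_nonneg: "0 \<le> bump z"
  by (simp add: bump_def)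

lemma bump_eq_0: "norm z \<ge> 1 \<Longrightarrow> bump z = 0" and bump_grad_eq_0: "norm z \<ge> 1 \<Longrightarrow> bump_grad z = 0"
  by (simp_all add: bump_def bump_grad_def dot_square_norm)

lemma norm_bump_grad_le: "norm (bump_grad z) \<le> 4"
proof (cases "norm z \<ge> 1")
  case True
  then show ?thesis by (simp add: bump_grad_eq_0)
next
  case False
  then have "max 0 (1 - z \<bullet> z) * norm z \<le> 1 * 1"
    by (intro mult_mono) auto
  then show ?thesis by (simp add: bump_grad_def abs_mult)
qed

abbreviation unit_box :: "'a::euclidean_space set" where
  "unit_box \<equiv> cbox (- One) One"

definition bump_mass :: "'a::euclidean_space itself \<Rightarrow> real" where
  "bump_mass _ = integral unit_box (bump :: 'a \<Rightarrow> real)"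

lemma bump_mass_pos: "bump_mass TYPE('a::euclidean_space) > 0"
proof -
  have c: "continuous_on unit_box (bump :: 'a \<Rightarrow> real)"
    by (rule C1_grad_continuous[OF C1_grad_bump])
  have "integral unit_box (bump :: 'a \<Rightarrow> real) \<noteq> 0"
  proof
    assume "integral unit_box (bump :: 'a \<Rightarrow> real) = 0"
    then have "(bump has_integral 0) (unit_box :: 'a set)"
      using integrable_integral[OF integrable_continuous[OF c]] by simp
    then have "bump (0::'a) = 0"
      by (rule has_integral_0_cbox_imp_0[OF c bump_nonneg]) (auto simp: mem_box box_ne_empty)
    then show False by (simp add: bump_def)
  qed
  moreover have "integral unit_box (bump :: 'a \<Rightarrow> real) \<ge> 0"
    by (rule integral_nonneg[OF integrable_continuous[OF c]]) (simp add: bump_nonneg)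
  ultimately show ?thesis by (simp add: bump_mass_def)
qed

text \<open>
  In this form the kernel does not move with \<open>x\<close>, which makes all estimates uniform in \<open>x\<close>.
\<close>

definition mollify :: "real \<Rightarrow> ('a::euclidean_space \<Rightarrow> real) \<Rightarrow> 'a \<Rightarrow> real" where
  "mollify \<epsilon> f x = integral unit_box (\<lambda>z. f (x + \<epsilon> *\<^sub>R z) *\<^sub>R bump z) / bump_mass TYPE('a)"

text \<open>
  The derivative falls on the kernel after the substitution \<open>y = x + \<epsilon> z\<close>, which accounts for the sign and
  the factor \<open>1 / \<epsilon>\<close>.
\<close>

definition mollify_grad :: "real \<Rightarrow> ('a::euclidean_space \<Rightarrow> real) \<Rightarrow> 'a \<Rightarrow> 'a" where
  "mollify_grad \<epsilon> f x =
     - (1 / (\<epsilon> * bump_mass TYPE('a))) *\<^sub>R integral unit_box (\<lambda>z. f (x + \<epsilon> *\<^sub>R z) *\<^sub>R bump_grad z)"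

text \<open>
  After the substitution the domain of integration can be any fixed box around the support, the same for
  all \<open>x\<close> in a neighbourhood, and only the kernel depends on \<open>x\<close>.
\<close>

lemma integral_rescale_kernel:
  fixes K :: "'a::euclidean_space \<Rightarrow> 'b::euclidean_space"
  assumes K: "continuous_on UNIV K" "\<And>z. norm z \<ge> 1 \<Longrightarrow> K z = 0"
    and q: "continuous_on UNIV q" and \<epsilon>: "\<epsilon> > 0"
    and sub: "cbox (x - \<epsilon> *\<^sub>R One) (x + \<epsilon> *\<^sub>R One) \<subseteq> cbox a b"
  shows "integral unit_box (\<lambda>z. q (x + \<epsilon> *\<^sub>R z) *\<^sub>R K z)
    = integral (cbox a b) (\<lambda>y. q y *\<^sub>R K ((y - x) /\<^sub>R \<epsilon>)) /\<^sub>R \<epsilon> ^ DIM('a)"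
proof -
  define F where "F y = q y *\<^sub>R K ((y - x) /\<^sub>R \<epsilon>)" for y
  let ?I = "integral (cbox (x - \<epsilon> *\<^sub>R One) (x + \<epsilon> *\<^sub>R One)) F"
  have "continuous_on S F" for S
    unfolding F_def[abs_def] using \<epsilon>
    by (intro continuous_intros continuous_on_compose2[OF K(1)] continuous_on_subset[OF q]) auto
  then have F: "(F has_integral ?I) (cbox (x - \<epsilon> *\<^sub>R One) (x + \<epsilon> *\<^sub>R One))"
    by (intro integrable_integral integrable_continuous)
  then have "((\<lambda>z. F (\<epsilon> *\<^sub>R z + x)) has_integral (?I /\<^sub>R \<epsilon> ^ DIM('a)))
      (cbox ((x - \<epsilon> *\<^sub>R One - x) /\<^sub>R \<epsilon>) ((x + \<epsilon> *\<^sub>R One - x) /\<^sub>R \<epsilon>))"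
    using has_integral_affinity_iff[OF \<epsilon>, of F x ?I] by blast
  then have "((\<lambda>z. q (x + \<epsilon> *\<^sub>R z) *\<^sub>R K z) has_integral (?I /\<^sub>R \<epsilon> ^ DIM('a))) unit_box"
    using \<epsilon> by (simp add: F_def add.commute)
  moreover have "(F has_integral ?I) (cbox a b)"
  proof (rule has_integral_on_superset[OF F _ sub])
    fix y assume y: "y \<notin> cbox (x - \<epsilon> *\<^sub>R One) (x + \<epsilon> *\<^sub>R One)"
    have "norm ((y - x) /\<^sub>R \<epsilon>) \<ge> 1"
    proof (rule ccontr)
      assume "\<not> norm ((y - x) /\<^sub>R \<epsilon>) \<ge> 1"
      moreover have "norm ((y - x) /\<^sub>R \<epsilon>) = norm (y - x) / \<epsilon>"
        using \<epsilon> by (simp only: norm_scaleR) (simp add: divide_inverse mult.commute)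
      ultimately have n: "norm (y - x) \<le> \<epsilon>" using \<epsilon> by simp
      have "\<bar>(y - x) \<bullet> i\<bar> \<le> \<epsilon>" if "i \<in> Basis" for i
        using Basis_le_norm[OF that, of "y - x"] n by simp
      then have "y \<in> cbox (x - \<epsilon> *\<^sub>R One) (x + \<epsilon> *\<^sub>R One)"
        by (fastforce simp: mem_box inner_diff_left inner_add_left abs_le_iff)
      with y show False by blast
    qed
    then show "F y = 0" by (simp add: F_def K(2))
  qed
  ultimately show ?thesis
    unfolding F_def[symmetric] by (simp add: integral_unique)
qed

text \<open>
  Near each point the mollification is an integral over a fixed box of \<open>f y\<close> times a differentiable kernel,
  so it can be differentiated under the integral although \<open>f\<close> is only continuous.
\<close>

lemma C1_grad_mollify:
  fixes f :: "'a::euclidean_space \<Rightarrow> real"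
  assumes f: "continuous_on UNIV f" and \<epsilon>: "\<epsilon> > 0"
  shows "C1_grad (mollify \<epsilon> f) (mollify_grad \<epsilon> f)"
proof -
  have bc: "continuous_on UNIV (bump :: 'a \<Rightarrow> real)" "continuous_on UNIV (bump_grad :: 'a \<Rightarrow> 'a)"
    using C1_grad_bump by (auto intro: C1_grad_continuous C1_grad_continuous_grad)
  have der: "GDERIV (mollify \<epsilon> f) x0 :> mollify_grad \<epsilon> f x0" for x0
  proof -
    let ?a = "x0 - (1 + \<epsilon>) *\<^sub>R One" and ?b = "x0 + (1 + \<epsilon>) *\<^sub>R One"
    let ?c = "bump_mass TYPE('a)" and ?n = "DIM('a)"
    have sub: "cbox (x - \<epsilon> *\<^sub>R One) (x + \<epsilon> *\<^sub>R One) \<subseteq> cbox ?a ?b" if x: "x \<in> ball x0 1" for x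
    proof -
      have 1: "\<bar>(x - x0) \<bullet> i\<bar> \<le> 1" if "i \<in> Basis" for i
        using Basis_le_norm[OF that, of "x - x0"] x by (simp add: dist_norm norm_minus_commute)
      show ?thesis
      proof
        fix y assume y: "y \<in> cbox (x - \<epsilon> *\<^sub>R One) (x + \<epsilon> *\<^sub>R One)"
        have "?a \<bullet> i \<le> y \<bullet> i \<and> y \<bullet> i \<le> ?b \<bullet> i" if "i \<in> Basis" for i
          using 1[OF that] y that by (auto simp: mem_box inner_diff_left inner_add_left abs_le_iff)
        then show "y \<in> cbox ?a ?b" by (simp add: mem_box)
      qed
    qed
    define F where "F x y = f y *\<^sub>R bump ((y - x) /\<^sub>R \<epsilon>)" for x y
    define g where "g x y = - (1 / \<epsilon>) *\<^sub>R (f y *\<^sub>R bump_grad ((y - x) /\<^sub>R \<epsilon>))" for x y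
    have g_cont: "continuous_on (ball x0 1 \<times> cbox ?a ?b) (\<lambda>(x, y). blinfun_inner_left (g x y))"
      unfolding g_def split_beta using \<epsilon>
      by (intro continuous_intros bounded_linear.continuous_on[OF bounded_linear_blinfun_inner_left]
          continuous_on_compose2[OF bc(2)] continuous_on_compose2[OF f]) auto
    have F_der: "((\<lambda>x. F x y) has_derivative blinfun_inner_left (g x y)) (at x within ball x0 1)" for x y
    proof -
      have "(bump has_derivative (\<lambda>h. h \<bullet> bump_grad ((y - x) /\<^sub>R \<epsilon>))) (at ((y - x) /\<^sub>R \<epsilon>))"
        using C1_grad_bump unfolding C1_grad_def gderiv_def by blast
      moreover have "((\<lambda>x. (y - x) /\<^sub>R \<epsilon>) has_derivative (\<lambda>h. (- h) /\<^sub>R \<epsilon>)) (at x)"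
        by (auto intro!: derivative_eq_intros)
      ultimately have "((\<lambda>x. bump ((y - x) /\<^sub>R \<epsilon>)) has_derivative
          (\<lambda>h. ((- h) /\<^sub>R \<epsilon>) \<bullet> bump_grad ((y - x) /\<^sub>R \<epsilon>))) (at x)"
        using has_derivative_compose by blast
      then have "((\<lambda>x. F x y) has_derivative
          (\<lambda>h. f y *\<^sub>R (((- h) /\<^sub>R \<epsilon>) \<bullet> bump_grad ((y - x) /\<^sub>R \<epsilon>)))) (at x)"
        unfolding F_def by (rule has_derivative_scaleR_right)
      moreover have "(\<lambda>h. f y *\<^sub>R (((- h) /\<^sub>R \<epsilon>) \<bullet> bump_grad ((y - x) /\<^sub>R \<epsilon>)))
          = blinfun_inner_left (g x y)"
        by (auto simp: g_def divide_inverse)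
      ultimately show ?thesis by (simp add: has_derivative_at_withinI)
    qed
    have F_cont: "continuous_on S (F x)" for S x
      unfolding F_def[abs_def] using \<epsilon>
      by (intro continuous_intros continuous_on_compose2[OF bc(1)] continuous_on_subset[OF f]) auto
    have g_cont': "continuous_on S (g x)" for S x
      unfolding g_def[abs_def] using \<epsilon>
      by (intro continuous_intros continuous_on_compose2[OF bc(2)] continuous_on_subset[OF f]) auto
    have "((\<lambda>x. integral (cbox ?a ?b) (F x)) has_derivative
        integral (cbox ?a ?b) (\<lambda>y. blinfun_inner_left (g x0 y))) (at x0 within ball x0 1)"
      by (rule leibniz_rule[OF F_der _ g_cont]) (auto intro: integrable_continuous F_cont)
    moreover have "integral (cbox ?a ?b) (\<lambda>y. blinfun_inner_left (g x0 y))
        = blinfun_inner_left (integral (cbox ?a ?b) (g x0))"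
      using integral_linear[OF integrable_continuous[OF g_cont'] bounded_linear_blinfun_inner_left]
      by (simp add: o_def)
    ultimately have "((\<lambda>x. integral (cbox ?a ?b) (F x)) has_derivative
        (\<lambda>h. h \<bullet> integral (cbox ?a ?b) (g x0))) (at x0)"
      by (simp add: at_within_open[of x0 "ball x0 1"] blinfun_inner_left.rep_eq[abs_def])
    then have "((\<lambda>x. (1 / (\<epsilon> ^ ?n * ?c)) *\<^sub>R integral (cbox ?a ?b) (F x)) has_derivative
        (\<lambda>h. (1 / (\<epsilon> ^ ?n * ?c)) *\<^sub>R (h \<bullet> integral (cbox ?a ?b) (g x0)))) (at x0)"
      by (rule has_derivative_scaleR_right)
    then have "((\<lambda>x. (1 / (\<epsilon> ^ ?n * ?c)) *\<^sub>R integral (cbox ?a ?b) (F x)) has_derivative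
        (\<lambda>h. h \<bullet> mollify_grad \<epsilon> f x0)) (at x0)"
    proof (rule has_derivative_eq_rhs)
      have resc: "integral unit_box (\<lambda>z. f (x0 + \<epsilon> *\<^sub>R z) *\<^sub>R bump_grad z)
          = integral (cbox ?a ?b) (\<lambda>y. f y *\<^sub>R bump_grad ((y - x0) /\<^sub>R \<epsilon>)) /\<^sub>R \<epsilon> ^ ?n"
        by (rule integral_rescale_kernel[OF bc(2) bump_grad_eq_0 f \<epsilon> sub]) simp_all
      have "integral (cbox ?a ?b) (g x0)
          = - (1 / \<epsilon>) *\<^sub>R integral (cbox ?a ?b) (\<lambda>y. f y *\<^sub>R bump_grad ((y - x0) /\<^sub>R \<epsilon>))"
        unfolding g_def[abs_def] by (rule integral_cmul)
      then have "(1 / (\<epsilon> ^ ?n * ?c)) *\<^sub>R integral (cbox ?a ?b) (g x0) = mollify_grad \<epsilon> f x0"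
        by (simp add: mollify_grad_def resc divide_inverse mult.commute mult.left_commute)
      then show "(\<lambda>h. (1 / (\<epsilon> ^ ?n * ?c)) *\<^sub>R (h \<bullet> integral (cbox ?a ?b) (g x0)))
          = (\<lambda>h. h \<bullet> mollify_grad \<epsilon> f x0)"
        by (auto simp flip: inner_scaleR_right)
    qed
    moreover have "(1 / (\<epsilon> ^ ?n * ?c)) *\<^sub>R integral (cbox ?a ?b) (F x) = mollify \<epsilon> f x"
      if "x \<in> ball x0 1" for x
    proof -
      have resc: "integral unit_box (\<lambda>z. f (x + \<epsilon> *\<^sub>R z) *\<^sub>R bump z)
          = integral (cbox ?a ?b) (\<lambda>y. f y *\<^sub>R bump ((y - x) /\<^sub>R \<epsilon>)) /\<^sub>R \<epsilon> ^ ?n"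
        by (rule integral_rescale_kernel[OF bc(1) bump_eq_0 f \<epsilon> sub[OF that]])
      show ?thesis
        unfolding mollify_def F_def[abs_def] resc
        by (simp add: divide_inverse mult.commute mult.left_commute)
    qed
    ultimately have "(mollify \<epsilon> f has_derivative (\<lambda>h. h \<bullet> mollify_grad \<epsilon> f x0)) (at x0)"
      by - (erule has_derivative_transform_within_open[where s = "ball x0 1"], auto)
    then show ?thesis by (simp add: gderiv_def)
  qed
  have "continuous_on UNIV (\<lambda>x. integral unit_box (\<lambda>z. f (x + \<epsilon> *\<^sub>R z) *\<^sub>R bump_grad z))"
    by (rule integral_continuous_on_param, unfold split_beta)
      (intro continuous_intros continuous_on_compose2[OF bc(2)] continuous_on_compose2[OF f]; auto)
  then have "continuous_on UNIV (mollify_grad \<epsilon> f)"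
    unfolding mollify_grad_def[abs_def] by (intro continuous_intros)
  with der show ?thesis by (simp add: C1_grad_def)
qed

lemma kernel_integrable:
  fixes f :: "'a::euclidean_space \<Rightarrow> real"
  assumes f: "continuous_on UNIV f"
  shows "(\<lambda>z. f (x + \<epsilon> *\<^sub>R z) *\<^sub>R bump z) integrable_on unit_box"
    and "(\<lambda>z. f (x + \<epsilon> *\<^sub>R z) *\<^sub>R bump_grad z) integrable_on unit_box"
  by (intro integrable_continuous continuous_intros continuous_on_compose2[OF f]
      C1_grad_continuous[OF C1_grad_bump] C1_grad_continuous_grad[OF C1_grad_bump]; simp)+

lemma mollify_const: "mollify \<epsilon> (\<lambda>_. b) x = b"
  for x :: "'a::euclidean_space"
  using bump_mass_pos[where 'a = 'a] by (simp add: mollify_def bump_mass_def)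

lemma mollify_grad_const: "\<epsilon> > 0 \<Longrightarrow> mollify_grad \<epsilon> (\<lambda>_. b) x = 0"
  by (rule C1_grad_eq_on_open[OF C1_grad_mollify C1_grad_const[of b] open_UNIV])
    (auto simp: mollify_const)

lemma mollify_grad_add:
  assumes "continuous_on UNIV f" "continuous_on UNIV g"
  shows "mollify_grad \<epsilon> (\<lambda>y. f y + g y) x = mollify_grad \<epsilon> f x + mollify_grad \<epsilon> g x"
  using kernel_integrable[OF assms(1)] kernel_integrable[OF assms(2)]
  by (simp add: mollify_grad_def scaleR_add_left integral_add scaleR_add_right)

lemma mollify_grad_cmult: "mollify_grad \<epsilon> (\<lambda>y. s * f y) x = s *\<^sub>R mollify_grad \<epsilon> f x"
  by (simp add: mollify_grad_def scaleR_scaleR[symmetric] del: scaleR_scaleR)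
    (simp add: scaleR_left_commute)

lemma mollify_grad_sum:
  assumes "finite S" "\<And>s. s \<in> S \<Longrightarrow> continuous_on UNIV (f s)" "\<epsilon> > 0"
  shows "mollify_grad \<epsilon> (\<lambda>y. \<Sum>s\<in>S. f s y) x = (\<Sum>s\<in>S. mollify_grad \<epsilon> (f s) x)"
  using assms(1,2)
proof (induction rule: finite_induct)
  case empty
  then show ?case using mollify_grad_const[OF assms(3)] by simp
next
  case (insert s S)
  then show ?case by (simp add: mollify_grad_add continuous_on_sum)
qed

lemma mollify_dist_le:
  fixes f :: "'a::euclidean_space \<Rightarrow> real"
  assumes f: "continuous_on UNIV f" and \<epsilon>: "\<epsilon> > 0"
    and \<kappa>: "\<And>y. norm (y - x) \<le> \<epsilon> \<Longrightarrow> \<bar>f y - b\<bar> \<le> \<kappa>"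
  shows "\<bar>mollify \<epsilon> f x - b\<bar> \<le> \<kappa>"
proof -
  let ?c = "bump_mass TYPE('a)"
  have bint: "(bump :: 'a \<Rightarrow> real) integrable_on unit_box"
    by (rule integrable_continuous[OF C1_grad_continuous[OF C1_grad_bump]])
  have "norm (integral unit_box (\<lambda>z. (f (x + \<epsilon> *\<^sub>R z) - b) *\<^sub>R bump z))
      \<le> integral unit_box (\<lambda>z::'a. \<kappa> * bump z)"
  proof (rule integral_norm_bound_integral)
    show "(\<lambda>z. (f (x + \<epsilon> *\<^sub>R z) - b) *\<^sub>R bump z) integrable_on unit_box"
      using kernel_integrable(1)[of "\<lambda>y. f y - b"] f by (simp add: continuous_on_diff)
    show "(\<lambda>z::'a. \<kappa> * bump z) integrable_on unit_box"
      using integrable_cmul[OF bint, of \<kappa>] by simp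
    fix z :: 'a
    show "norm ((f (x + \<epsilon> *\<^sub>R z) - b) *\<^sub>R bump z) \<le> \<kappa> * bump z"
    proof (cases "norm z \<ge> 1")
      case True
      then show ?thesis by (simp add: bump_eq_0)
    next
      case False
      then have "\<bar>f (x + \<epsilon> *\<^sub>R z) - b\<bar> \<le> \<kappa>" using \<epsilon> by (intro \<kappa>) simp
      then show ?thesis by (simp add: abs_mult bump_nonneg mult_right_mono)
    qed
  qed
  also have "\<dots> = \<kappa> * ?c" by (simp add: bump_mass_def)
  finally have *: "\<bar>integral unit_box (\<lambda>z. (f (x + \<epsilon> *\<^sub>R z) - b) *\<^sub>R bump z)\<bar> \<le> \<kappa> * ?c" by simp
  have "mollify \<epsilon> f x - b = integral unit_box (\<lambda>z. (f (x + \<epsilon> *\<^sub>R z) - b) *\<^sub>R bump z) / ?c"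
    using bump_mass_pos[where 'a = 'a] kernel_integrable(1)[OF f, of x \<epsilon>] integrable_cmul[OF bint, of b]
    by (simp add: mollify_def left_diff_distrib integral_diff bump_mass_def diff_divide_distrib)
  moreover have "\<bar>integral unit_box (\<lambda>z. (f (x + \<epsilon> *\<^sub>R z) - b) *\<^sub>R bump z)\<bar> / ?c \<le> \<kappa>"
    using * bump_mass_pos[where 'a = 'a] by (simp only: pos_divide_le_eq)
  ultimately show ?thesis
    using bump_mass_pos[where 'a = 'a] by (simp add: abs_divide)
qed

definition mollify_bound :: "'a::euclidean_space itself \<Rightarrow> real" where
  "mollify_bound _ = 4 * measure lborel (unit_box :: 'a set) / bump_mass TYPE('a)"

text \<open>
  The gradient does not change when a constant \<open>b\<close> is subtracted from \<open>f\<close>, so it is controlled by the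
  oscillation of \<open>f\<close> at scale \<open>\<epsilon>\<close>.
\<close>

lemma norm_mollify_grad_le:
  fixes f :: "'a::euclidean_space \<Rightarrow> real"
  assumes f: "continuous_on UNIV f" and \<epsilon>: "\<epsilon> > 0"
    and \<kappa>: "\<And>y. norm (y - x) \<le> \<epsilon> \<Longrightarrow> \<bar>f y - b\<bar> \<le> \<kappa>"
  shows "norm (mollify_grad \<epsilon> f x) \<le> mollify_bound TYPE('a) * \<kappa> / \<epsilon>"
proof -
  let ?I = "integral unit_box (\<lambda>z. (f (x + \<epsilon> *\<^sub>R z) - b) *\<^sub>R bump_grad z)"
  have fb: "continuous_on UNIV (\<lambda>y. f y - b)" using f by (intro continuous_intros)
  have "\<kappa> \<ge> 0" using \<kappa>[of x] \<epsilon> by simp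
  have "norm ?I \<le> (4 * \<kappa>) * measure lborel (unit_box :: 'a set)"
  proof (rule has_integral_bound[OF _ integrable_integral[OF kernel_integrable(2)[OF fb]]])
    fix z :: 'a
    show "norm ((f (x + \<epsilon> *\<^sub>R z) - b) *\<^sub>R bump_grad z) \<le> 4 * \<kappa>"
    proof (cases "norm z \<ge> 1")
      case True
      then show ?thesis using \<open>\<kappa> \<ge> 0\<close> by (simp add: bump_grad_eq_0)
    next
      case False
      then have "\<bar>f (x + \<epsilon> *\<^sub>R z) - b\<bar> \<le> \<kappa>" using \<epsilon> by (intro \<kappa>) simp
      then have "\<bar>f (x + \<epsilon> *\<^sub>R z) - b\<bar> * norm (bump_grad z) \<le> \<kappa> * 4"
        by (intro mult_mono norm_bump_grad_le \<open>\<kappa> \<ge> 0\<close>) auto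
      then show ?thesis by (simp add: mult.commute)
    qed
  qed (use \<open>\<kappa> \<ge> 0\<close> in auto)
  moreover have "mollify_grad \<epsilon> f x = - (1 / (\<epsilon> * bump_mass TYPE('a))) *\<^sub>R ?I"
    using mollify_grad_add[OF fb continuous_on_const, of \<epsilon> b x]
    by (simp add: mollify_grad_const[OF \<epsilon>]) (simp add: mollify_grad_def)
  ultimately show ?thesis
    using bump_mass_pos[where 'a = 'a] \<epsilon>
    by (simp add: mollify_bound_def field_simps)
qed

section \<open>Surjectivity of the Lefschetz map\<close>

lemma sum_split_coordinate:
  fixes a :: "('d::finite \<Rightarrow> 'd) \<Rightarrow> real"
  shows "(\<Sum>\<tau>\<in>{\<tau>. \<forall>e. \<tau> e \<in> (Q(d := X)) e}. a \<tau>)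
    = (\<Sum>\<tau>\<in>{\<tau>. \<forall>e. \<tau> e \<in> (Q(d := {d})) e}. \<Sum>j\<in>X. a (\<tau>(d := j)))"
proof -
  have "(\<Sum>\<tau>\<in>{\<tau>. \<forall>e. \<tau> e \<in> (Q(d := {d})) e}. \<Sum>j\<in>X. a (\<tau>(d := j)))
      = (\<Sum>(\<tau>, j)\<in>{\<tau>. \<forall>e. \<tau> e \<in> (Q(d := {d})) e} \<times> X. a (\<tau>(d := j)))"
    by (rule sum.cartesian_product)
  also have "\<dots> = (\<Sum>\<tau>\<in>{\<tau>. \<forall>e. \<tau> e \<in> (Q(d := X)) e}. a \<tau>)"
  proof (rule sum.reindex_bij_witness[where j = "\<lambda>(\<tau>, j). \<tau>(d := j)" and i = "\<lambda>\<tau>. (\<tau>(d := d), \<tau> d)"])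
    fix p assume p: "p \<in> {\<tau>. \<forall>e. \<tau> e \<in> (Q(d := {d})) e} \<times> X"
    obtain \<tau> j where pj: "p = (\<tau>, j)" by (cases p)
    with p have 1: "\<forall>e. \<tau> e \<in> (Q(d := {d})) e" and j: "j \<in> X" by auto
    from 1 have \<tau>: "\<tau> d = d" "\<And>e. e \<noteq> d \<Longrightarrow> \<tau> e \<in> Q e"
      by (metis fun_upd_same singletonD) (metis 1 fun_upd_other)
    show "((case p of (\<tau>, j) \<Rightarrow> \<tau>(d := j))(d := d), (case p of (\<tau>, j) \<Rightarrow> \<tau>(d := j)) d) = p"
      using \<tau>(1) by (simp add: pj fun_upd_idem)
    show "(case p of (\<tau>, j) \<Rightarrow> \<tau>(d := j)) \<in> {\<tau>. \<forall>e. \<tau> e \<in> (Q(d := X)) e}"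
      using \<tau>(2) j by (simp add: pj)
    show "a (case p of (\<tau>, j) \<Rightarrow> \<tau>(d := j)) = (case p of (\<tau>, j) \<Rightarrow> a (\<tau>(d := j)))"
      by (simp add: pj)
  next
    fix \<tau> assume "\<tau> \<in> {\<tau>. \<forall>e. \<tau> e \<in> (Q(d := X)) e}"
    then have \<tau>: "\<tau> e \<in> (Q(d := X)) e" for e by blast
    show "(case (\<tau>(d := d), \<tau> d) of (\<tau>, j) \<Rightarrow> \<tau>(d := j)) = \<tau>" by simp
    have "\<tau> e \<in> Q e" if "e \<noteq> d" for e using \<tau>[of e] that by simp
    then show "(\<tau>(d := d), \<tau> d) \<in> {\<tau>. \<forall>e. \<tau> e \<in> (Q(d := {d})) e} \<times> X"
      using \<tau>[of d] by simp
  qed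
  finally show ?thesis by simp
qed

text \<open>
  Think of \<open>A \<tau>\<close> as the integral of the product of the \<open>e\<^bsub>\<tau> d\<^esub>\<close>, \<open>d \<in> D\<close>, with some fixed
  factors, where \<open>e\<^sub>j = dx\<^sub>j \<and> dy\<^sub>j\<close>.  The \<open>2\<close>-forms \<open>e\<^sub>j\<close> commute and have square \<open>0\<close>, and by assumption
  products with \<open>\<Sum>j\<in>D \<union> E. e\<^sub>j\<close> are negligible.  Modulo such products
  \<open>(card D)! \<Prod>\<^sub>d e\<^sub>d = (\<Sum>j\<in>D. e\<^sub>j)\<^bsup>card D\<^esup> = (- \<Sum>j\<in>E. e\<^sub>j)\<^bsup>card D\<^esup>\<close>, and the last power vanishes since it
  has more than \<open>card E\<close> factors.  In the proof the factors \<open>\<Sum>j\<in>D. e\<^sub>j\<close> are exchanged for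
  \<open>- \<Sum>j\<in>E. e\<^sub>j\<close> one at a time; \<open>B S\<close> has the factor \<open>\<Sum>j\<in>E. e\<^sub>j\<close> at the places in \<open>S\<close>, and the sign is
  immaterial for convergence to \<open>0\<close>.
\<close>

lemma lefschetz_limit:
  fixes A :: "'m \<Rightarrow> ('d::finite \<Rightarrow> 'd) \<Rightarrow> real"
  assumes disj: "D \<inter> E = {}" and card: "card E < card D"
    and rel: "\<And>\<tau> d. d \<in> D \<Longrightarrow> ((\<lambda>m. \<Sum>j\<in>D \<union> E. A m (\<tau>(d := j))) \<longlongrightarrow> 0) F"
    and col: "\<And>m \<tau> d d'. d \<in> D \<Longrightarrow> d' \<in> D \<Longrightarrow> d \<noteq> d' \<Longrightarrow> \<tau> d = \<tau> d' \<Longrightarrow> A m \<tau> = 0"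
    and sym: "\<And>m \<tau>. \<tau> permutes D \<Longrightarrow> A m \<tau> = A m id"
  shows "((\<lambda>m. A m id) \<longlongrightarrow> 0) F"
proof -
  define Q where "Q S d = (if d \<in> S then E else if d \<in> D then D else {d})" for S d
  define B where "B S m = (\<Sum>\<tau>\<in>{\<tau>. \<forall>e. \<tau> e \<in> Q S e}. A m \<tau>)" for S m
  have "(B (D - T) \<longlongrightarrow> 0) F" if "T \<subseteq> D" for T
    using finite[of T] that
  proof (induction rule: finite_induct)
    case empty
    have "A m \<tau> = 0" if "\<forall>e. \<tau> e \<in> Q D e" for m \<tau>
    proof -
      have "\<tau> d \<in> E" if "d \<in> D" for d
        using \<open>\<forall>e. \<tau> e \<in> Q D e\<close>[rule_format, of d] that by (simp add: Q_def)
      then have "\<tau> ` D \<subseteq> E" by blast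
      then have "\<not> inj_on \<tau> D"
        using card card_inj_on_le[of \<tau> D E] by auto
      then obtain d d' where "d \<in> D" "d' \<in> D" "d \<noteq> d'" "\<tau> d = \<tau> d'"
        by (auto simp: inj_on_def)
      then show ?thesis by (rule col)
    qed
    then have "B D = (\<lambda>_. 0)" by (auto simp: B_def fun_eq_iff)
    then show ?case by simp
  next
    case (insert d T)
    let ?S = "D - insert d T"
    have d: "d \<in> D" "d \<notin> ?S" and ins: "D - T = insert d ?S" using insert by auto
    have "Q ?S = (Q ?S)(d := D)" "Q (D - T) = (Q ?S)(d := E)"
      using d ins by (auto simp: Q_def fun_eq_iff)
    then have BS: "B ?S m = (\<Sum>\<tau>\<in>{\<tau>. \<forall>e. \<tau> e \<in> ((Q ?S)(d := D)) e}. A m \<tau>)"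
      and BT: "B (D - T) m = (\<Sum>\<tau>\<in>{\<tau>. \<forall>e. \<tau> e \<in> ((Q ?S)(d := E)) e}. A m \<tau>)" for m
      by (simp_all only: B_def)
    have "B ?S m + B (D - T) m
        = (\<Sum>\<tau>\<in>{\<tau>. \<forall>e. \<tau> e \<in> ((Q ?S)(d := {d})) e}. \<Sum>j\<in>D \<union> E. A m (\<tau>(d := j)))" for m
      unfolding BS BT sum_split_coordinate[where d = d and X = D] sum_split_coordinate[where d = d and X = E]
      by (simp only: sum.distrib[symmetric] sum.union_disjoint[OF finite finite disj])
    moreover have "((\<lambda>m. \<Sum>\<tau>\<in>{\<tau>. \<forall>e. \<tau> e \<in> ((Q ?S)(d := {d})) e}. \<Sum>j\<in>D \<union> E. A m (\<tau>(d := j)))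
        \<longlongrightarrow> (\<Sum>\<tau>\<in>{\<tau>. \<forall>e. \<tau> e \<in> ((Q ?S)(d := {d})) e}. 0)) F"
      by (rule tendsto_sum) (rule rel[OF d(1)])
    ultimately have "((\<lambda>m. B ?S m + B (D - T) m) \<longlongrightarrow> 0) F" by simp
    from tendsto_diff[OF this insert.IH] insert.prems show ?case by simp
  qed
  from this[of D] have "(B {} \<longlongrightarrow> 0) F" by simp
  moreover have "B {} m = fact (card D) * A m id" for m
  proof -
    have "{\<tau>. \<tau> permutes D} \<subseteq> {\<tau>. \<forall>e. \<tau> e \<in> Q {} e}"
    proof clarify
      fix \<tau> e assume "\<tau> permutes D"
      then show "\<tau> e \<in> Q {} e"
        using permutes_in_image[of \<tau> D e] permutes_not_in[of \<tau> D e] by (cases "e \<in> D") (simp_all add: Q_def)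
    qed
    moreover have "A m \<tau> = 0" if \<tau>: "\<forall>e. \<tau> e \<in> Q {} e" and np: "\<not> \<tau> permutes D" for \<tau>
    proof -
      have "\<tau> d \<in> D" if "d \<in> D" for d
        using \<tau>[rule_format, of d] that by (simp add: Q_def)
      then have "\<tau> ` D \<subseteq> D" by blast
      moreover have "\<tau> e = e" if "e \<notin> D" for e
        using \<tau>[rule_format, of e] that by (simp add: Q_def)
      ultimately have "inj_on \<tau> D \<Longrightarrow> \<tau> permutes D"
        by (intro bij_imp_permutes) (simp_all add: bij_betw_def endo_inj_surj)
      with np have "\<not> inj_on \<tau> D" by blast
      then obtain d d' where "d \<in> D" "d' \<in> D" "d \<noteq> d'" "\<tau> d = \<tau> d'"
        by (auto simp: inj_on_def)
      then show ?thesis by (rule col)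
    qed
    ultimately have "B {} m = (\<Sum>\<tau>\<in>{\<tau>. \<tau> permutes D}. A m \<tau>)"
      unfolding B_def by (intro sum.mono_neutral_right) auto
    also have "\<dots> = (\<Sum>\<tau>\<in>{\<tau>. \<tau> permutes D}. A m id)"
      by (intro sum.cong refl sym) simp
    finally show ?thesis by (simp add: card_permutations)
  qed
  then have "B {} = (\<lambda>m. fact (card D) * A m id)" by (rule ext)
  ultimately have "((\<lambda>m. fact (card D) * A m id) \<longlongrightarrow> 0) F" by simp
  from tendsto_mult_left[OF this, of "1 / fact (card D)"] show ?thesis by simp
qed

text \<open>
  Coordinates of \<open>\<real>\<^sup>2\<^sup>n\<^sup>+\<^sup>1\<close> are indexed by \<open>('n \<times> bool) option\<close>: \<open>None\<close> stands for \<open>t\<close>, \<open>Some (j, False)\<close> for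
  \<open>x\<^sub>j\<close> and \<open>Some (j, True)\<close> for \<open>y\<^sub>j\<close>.  Relabelling moves a pair \<open>x\<^sub>j, y\<^sub>j\<close> together.
\<close>

definition relabel :: "'n set \<Rightarrow> ('n \<Rightarrow> 'n) \<Rightarrow> ('n \<times> bool) option \<Rightarrow> ('n \<times> bool) option" where
  "relabel D \<tau> = map_option (\<lambda>(j, b). (if j \<in> D then \<tau> j else j, b))"

lemma relabel_simps [simp]:
  "relabel D \<tau> (Some (j, b)) = Some (if j \<in> D then \<tau> j else j, b)"
  "relabel D \<tau> None = None"
  by (simp_all add: relabel_def)

lemma relabel_id: "relabel D id c = c"
  by (cases c) auto

lemma relabel_relabel:
  assumes "\<And>j. \<sigma> j \<in> D \<longleftrightarrow> j \<in> D"
  shows "relabel D \<tau> (relabel D \<sigma> c) = relabel D (\<tau> \<circ> \<sigma>) c"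
  using assms by (cases c) auto

text \<open>
  There are \<open>n\<close> conjugate pairs and \<open>n + 1\<close> chosen coordinates, so the pairs chosen completely outnumber
  those not met at all by exactly one.  This is the count which makes \<open>n + 1\<close> the degree from which on
  the Lefschetz map is surjective.
\<close>

lemma card_full_pairs:
  fixes c :: "'k::finite \<Rightarrow> ('n::finite \<times> bool) option"
  assumes "inj c" and none: "None \<notin> range c" and card: "CARD('k) = CARD('n) + 1"
  shows "card {j. Some (j, False) \<in> range c \<and> Some (j, True) \<in> range c}
    = card {j. Some (j, False) \<notin> range c \<and> Some (j, True) \<notin> range c} + 1"
proof -
  define S where "S b = {j. Some (j, b) \<in> range c}" for b
  have "range c = (\<lambda>j. Some (j, False)) ` S False \<union> (\<lambda>j. Some (j, True)) ` S True"
  proof (intro equalityI subsetI)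
    fix y assume y: "y \<in> range c"
    with none obtain j b where "y = Some (j, b)" by (cases y) auto
    with y show "y \<in> (\<lambda>j. Some (j, False)) ` S False \<union> (\<lambda>j. Some (j, True)) ` S True"
      by (cases b) (auto simp: S_def)
  qed (auto simp: S_def)
  then have "card (range c) = card ((\<lambda>j. Some (j, False)) ` S False) + card ((\<lambda>j. Some (j, True)) ` S True)"
    by (simp only:) (rule card_Un_disjoint, auto)
  also have "\<dots> = card (S False) + card (S True)"
    by (simp add: card_image inj_on_def)
  also have "\<dots> = card (S False \<union> S True) + card (S False \<inter> S True)"
    by (rule card_Un_Int) auto
  finally have "CARD('n) + 1 = card (S False \<union> S True) + card (S False \<inter> S True)"
    using card card_image[OF \<open>inj c\<close>] by simp
  moreover have "card (S False \<union> S True) + card (- (S False \<union> S True)) = CARD('n)"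
    using card_Un_disjoint[of "S False \<union> S True" "- (S False \<union> S True)"]
    by (simp only: Compl_partition finite Compl_disjoint)
  ultimately have "card (S False \<inter> S True) = card (- (S False \<union> S True)) + 1" by simp
  moreover have "S False \<inter> S True = {j. Some (j, False) \<in> range c \<and> Some (j, True) \<in> range c}"
    "- (S False \<union> S True) = {j. Some (j, False) \<notin> range c \<and> Some (j, True) \<notin> range c}"
    by (auto simp: S_def)
  ultimately show ?thesis by simp
qed

section \<open>Almost horizontal sequences of maps\<close>

text \<open>
  The maps \<open>u m\<close> are nearly tangent to the horizontal distribution: \<open>\<theta> m\<close> is the pullback of the contact
  form \<open>dt + 2 \<Sum>\<^sub>j (x\<^sub>j dy\<^sub>j - y\<^sub>j dx\<^sub>j)\<close>, and its bound \<open>\<mu> m\<close> beats the \<open>n\<close>-th power of the bound \<open>\<Lambda> m\<close> on the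
  differentials.
\<close>

locale horizontal_sequence =
  fixes u :: "nat \<Rightarrow> real ^ 'k::{finite,wellorder} \<Rightarrow> real ^ ('n::finite \<times> bool) option"
    and Du :: "nat \<Rightarrow> ('n \<times> bool) option \<Rightarrow> real ^ 'k::{finite,wellorder} \<Rightarrow> real ^ 'k::{finite,wellorder}"
    and \<theta> :: "nat \<Rightarrow> real ^ 'k::{finite,wellorder} \<Rightarrow> real ^ 'k::{finite,wellorder}"
    and M :: real and \<Lambda> \<mu> :: "nat \<Rightarrow> real"
  assumes card_domain: "CARD('k) = CARD('n) + 1"
    and u_C1: "C1_grad (\<lambda>x. u m x $ c) (Du m c)"
    and u_bounded: "norm (u m x) \<le> M"
    and Du_bounded: "norm (Du m c x) \<le> \<Lambda> m"
    and \<theta>_eq: "\<theta> m x = Du m None x + 2 *\<^sub>R (\<Sum>j\<in>UNIV.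
          u m x $ Some (j, False) *\<^sub>R Du m (Some (j, True)) x
        - u m x $ Some (j, True) *\<^sub>R Du m (Some (j, False)) x)"
    and \<theta>_bounded: "norm (\<theta> m x) \<le> \<mu> m"
    and product_tends: "(\<lambda>m. \<mu> m * \<Lambda> m ^ CARD('n)) \<longlonglongrightarrow> 0"
begin

lemma u_cont: "continuous_on S (u m)"
  using continuous_on_vec_lambda[of S "\<lambda>c x. u m x $ c"] C1_grad_continuous[OF u_C1] by simp

lemma Du_cont: "continuous_on S (Du m c)"
  by (rule C1_grad_continuous_grad[OF u_C1])

lemma \<theta>_cont: "continuous_on S (\<theta> m)"
proof -
  have "\<theta> m = (\<lambda>x. Du m None x + 2 *\<^sub>R (\<Sum>j\<in>UNIV.
          u m x $ Some (j, False) *\<^sub>R Du m (Some (j, True)) x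
        - u m x $ Some (j, True) *\<^sub>R Du m (Some (j, False)) x))"
    using \<theta>_eq by blast
  then show ?thesis
    by (auto intro!: continuous_intros Du_cont C1_grad_continuous[OF u_C1])
qed

lemma bounded_along:
  fixes q :: "_ \<Rightarrow> 'b::real_normed_vector"
  assumes "continuous_on UNIV q"
  obtains A where "A \<ge> 0" "\<And>m x. norm (q (u m x)) \<le> A"
proof -
  have "compact (q ` cball 0 M)"
    by (intro compact_continuous_image continuous_on_subset[OF assms]) auto
  then obtain A where A: "\<And>y. y \<in> cball 0 M \<Longrightarrow> norm (q y) \<le> A"
    using compact_imp_bounded bounded_iff by (metis imageI)
  have "norm (q (u m x)) \<le> max 0 A" for m x
    using A[of "u m x"] u_bounded[of m x] by simp
  then show ?thesis using that[of "max 0 A"] by simp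
qed

text \<open>
  A determinant with the row \<open>\<theta>\<close> and \<open>n\<close> rows of size \<open>\<Lambda>\<close> is of size \<open>\<mu> \<Lambda>\<^sup>n\<close>.
\<close>

lemma small_row_integral:
  fixes r :: "nat \<Rightarrow> (real, 'k) vec \<Rightarrow> 'k \<Rightarrow> (real, 'k) vec"
  assumes r: "\<And>m i x. i \<noteq> k \<Longrightarrow> norm (r m x i) \<le> K * \<Lambda> m"
    and r0: "\<And>m x. norm (r m x k) \<le> \<mu> m"
    and rc: "\<And>m i. continuous_on UNIV (\<lambda>x. r m x i)"
    and a: "\<And>m x. \<bar>a m x\<bar> \<le> A" and ac: "\<And>m. continuous_on UNIV (a m)"
  shows "(\<lambda>m. integral (cube 2) (\<lambda>x. a m x * rdet (r m x))) \<longlonglongrightarrow> 0"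
proof -
  let ?C = "A * (fact CARD('k) * K ^ CARD('n)) * measure lborel (cube 2 :: (real, 'k) vec set)"
  have A0: "A \<ge> 0" using a[of 0 0] by linarith
  have b: "norm (integral (cube 2) (\<lambda>x. a m x * rdet (r m x))) \<le> ?C * (\<mu> m * \<Lambda> m ^ CARD('n))" for m
  proof -
    let ?B = "A * (fact CARD('k) * (\<mu> m * (K * \<Lambda> m) ^ CARD('n)))"
    have det: "\<bar>rdet (r m x)\<bar> \<le> fact CARD('k) * (\<mu> m * (K * \<Lambda> m) ^ CARD('n))" for x
    proof -
      have "\<bar>rdet (r m x)\<bar> \<le> fact CARD('k) * (\<Prod>i\<in>UNIV. if i = k then \<mu> m else K * \<Lambda> m)"
        by (rule rdet_bound[where b = "\<lambda>i. if i = k then \<mu> m else K * \<Lambda> m"]) (simp add: r r0)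
      also have "(\<Prod>i\<in>UNIV. if i = k then \<mu> m else K * \<Lambda> m) = \<mu> m * (\<Prod>i\<in>UNIV - {k}. K * \<Lambda> m)"
        by (subst prod.remove[of UNIV k]) auto
      also have "\<dots> = \<mu> m * (K * \<Lambda> m) ^ CARD('n)"
        by (simp add: card_domain)
      finally show ?thesis .
    qed
    have B: "norm (a m x * rdet (r m x)) \<le> ?B" for x
      using mult_mono[OF a det A0] by (simp add: abs_mult)
    have int: "(\<lambda>x. a m x * rdet (r m x)) integrable_on cube 2"
      by (intro integrable_on_cube continuous_on_mult ac continuous_on_rdet rc)
    have "norm (integral (cube 2) (\<lambda>x. a m x * rdet (r m x))) \<le> ?B * measure lborel (cube 2 :: (real, 'k) vec set)"
      unfolding cube_def
    proof (rule has_integral_bound[OF _ integrable_integral[OF int[unfolded cube_def]]])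
      show "0 \<le> ?B" using B[of 0] norm_ge_zero order_trans by blast
    qed (rule B)
    then show ?thesis by (simp add: power_mult_distrib mult.assoc mult.left_commute mult.commute)
  qed
  have "(\<lambda>m. ?C * (\<mu> m * \<Lambda> m ^ CARD('n))) \<longlonglongrightarrow> ?C * 0"
    by (intro tendsto_mult tendsto_const product_tends)
  then have t: "(\<lambda>m. ?C * (\<mu> m * \<Lambda> m ^ CARD('n))) \<longlonglongrightarrow> 0"
    by (simp only: mult_zero_right)
  show ?thesis
    by (rule Lim_null_comparison[OF always_eventually t]) (rule allI, rule b)
qed

text \<open>
  The vanishing condition says that the pulled back function is supported in the unit ball, which removes
  boundary terms from integrations by parts.
\<close>

definition test_function :: "(real ^ ('n \<times> bool) option \<Rightarrow> real) \<Rightarrow> bool" where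
  "test_function h \<longleftrightarrow> (\<exists>H. C1_grad h H) \<and>
     (\<forall>\<^sub>F m in sequentially. \<forall>x. norm x \<ge> 1 \<longrightarrow> h (u m x) = 0)"

lemma test_function_mult:
  assumes "test_function h" "\<exists>G. C1_grad g G"
  shows "test_function (\<lambda>y. h y * g y)"
proof -
  obtain H G where "C1_grad h H" "C1_grad g G" using assms by (auto simp: test_function_def)
  then have "\<exists>F. C1_grad (\<lambda>y. h y * g y) F" using C1_grad_mult by blast
  moreover have "\<forall>\<^sub>F m in sequentially. \<forall>x. norm x \<ge> 1 \<longrightarrow> h (u m x) = 0"
    using assms by (simp add: test_function_def)
  then have "\<forall>\<^sub>F m in sequentially. \<forall>x. norm x \<ge> 1 \<longrightarrow> h (u m x) * g (u m x) = 0"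
    by (rule eventually_mono) simp
  ultimately show ?thesis by (simp add: test_function_def)
qed

text \<open>
  The integral of the pullback of \<open>h dc\<^sub>1 \<and> \<dots> \<and> dc\<^sub>N\<close>, where the \<open>c\<^sub>i\<close> are coordinates.
\<close>

definition pairing :: "(real ^ ('n \<times> bool) option \<Rightarrow> real) \<Rightarrow> ('k \<Rightarrow> ('n \<times> bool) option) \<Rightarrow> nat \<Rightarrow> real"
  where "pairing h c m = integral (cube 2) (\<lambda>x. h (u m x) * rdet (\<lambda>i. Du m (c i) x))"

lemma test_function_cont:
  assumes "test_function h"
  shows "continuous_on S (\<lambda>x. h (u m x))"
proof -
  obtain H where "C1_grad h H" using assms by (auto simp: test_function_def)
  then show ?thesis
    by (intro continuous_on_compose2[OF C1_grad_continuous[of h H UNIV] u_cont]) auto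
qed

lemma pairing_integrable:
  "test_function h \<Longrightarrow> (\<lambda>x. h (u m x) * rdet (\<lambda>i. Du m (c i) x)) integrable_on cube 2"
  by (intro integrable_on_cube continuous_on_mult continuous_on_rdet Du_cont test_function_cont)

lemma pairing_not_inj: "\<not> inj c \<Longrightarrow> pairing h c m = 0"
proof -
  assume "\<not> inj c"
  then obtain i j where "i \<noteq> j" "c i = c j" by (auto simp: inj_on_def)
  then have "rdet (\<lambda>i. Du m (c i) x) = 0" for x
    by (intro rdet_equal_rows[of i j]) auto
  then show ?thesis by (simp add: pairing_def)
qed

lemma \<Lambda>_nonneg: "0 \<le> \<Lambda> m"
  using Du_bounded norm_ge_zero order_trans by blast

lemma row_replace:
  "(\<lambda>i. Du m ((c(i1 := p, i2 := q)) i) x) = (\<lambda>i. Du m (c i) x)(i1 := Du m p x, i2 := Du m q x)"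
  by auto

text \<open>
  With \<open>w = h \<circ> u\<close>, the forms \<open>d(w x\<^sub>j) \<and> dy\<^sub>j\<close>, \<open>d(w y\<^sub>j) \<and> dx\<^sub>j\<close> and \<open>dw \<and> dt\<close> have integral \<open>0\<close> against
  the remaining rows.  The combination \<open>2 \<Sum>\<^sub>j (d(w x\<^sub>j) \<and> dy\<^sub>j - d(w y\<^sub>j) \<and> dx\<^sub>j) + dw \<and> dt\<close> equals
  \<open>4 w \<Sum>\<^sub>j dx\<^sub>j \<and> dy\<^sub>j + dw \<and> \<theta>\<close>.
\<close>

lemma contraction_by_parts:
  assumes h: "C1_grad h H" and 0: "\<And>x. norm x \<ge> 1 \<Longrightarrow> h (u m x) = 0" and ne: "i1 \<noteq> i2"
    and W: "\<And>x. W x = (\<Sum>c\<in>UNIV. (H (u m x) $ c) *\<^sub>R Du m c x)"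
  shows "(\<Sum>j\<in>UNIV. pairing h (c(i1 := Some (j, False), i2 := Some (j, True))) m)
    = - (1/4) * integral (cube 2) (\<lambda>x. rdet ((\<lambda>i. Du m (c i) x)(i1 := W x, i2 := \<theta> m x)))"
proof -
  define r where "r x i = Du m (c i) x" for x i
  define w where "w x = h (u m x)" for x
  define X where "X j x = u m x $ Some (j, False)" for j x
  define Y where "Y j x = u m x $ Some (j, True)" for j x
  define dX where "dX j = Du m (Some (j, False))" for j
  define dY where "dY j = Du m (Some (j, True))" for j
  have W_eq: "W = (\<lambda>x. \<Sum>c\<in>UNIV. (H (u m x) $ c) *\<^sub>R Du m c x)" using W by blast
  have w: "C1_grad w W"
    using C1_grad_compose[OF h u_C1[of m]] unfolding w_def[abs_def] W_eq .
  have X: "C1_grad (X j) (dX j)" and Y: "C1_grad (Y j) (dY j)" for j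
    using u_C1 by (simp_all add: X_def[abs_def] Y_def[abs_def] dX_def dY_def)
  have null: "((\<lambda>x. rdet ((r x)(i1 := ga x, i2 := gb x))) has_integral 0) (cube 2)"
    if a: "C1_grad a ga" and b: "C1_grad b gb" and a0: "\<And>x. norm x \<ge> 1 \<Longrightarrow> a x = 0" for a ga b gb
  proof -
    let ?v = "(\<lambda>i x. u m x $ c i)(i1 := a, i2 := b)"
    let ?G = "(\<lambda>i. Du m (c i))(i1 := ga, i2 := gb)"
    have G: "C1_grad (?v i) (?G i)" for i
      using a b u_C1 by simp
    have "integral (cube 2) (\<lambda>x. rdet (\<lambda>i. ?G i x)) = 0"
      by (rule integral_det_gradients_eq_0[OF G, where k = i1 and R = 1]) (use ne a0 in auto)
    moreover have "(\<lambda>x. rdet (\<lambda>i. ?G i x)) integrable_on cube 2"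
      by (intro integrable_on_cube continuous_on_rdet C1_grad_continuous_grad[OF G])
    moreover have "(\<lambda>i. ?G i x) = (r x)(i1 := ga x, i2 := gb x)" for x
      by (auto simp: r_def)
    ultimately show ?thesis
      by (simp add: has_integral_iff)
  qed
  define dd where "dd x a b = rdet ((r x)(i1 := a, i2 := b))" for x a b
  have dd_add: "dd x (a + a') b = dd x a b + dd x a' b" and dd_scale: "dd x (s *\<^sub>R a) b = s * dd x a b"
    and dd_add': "dd x a (b + b') = dd x a b + dd x a b'" and dd_scale': "dd x a (s *\<^sub>R b) = s * dd x a b"
    and dd_diff': "dd x a (b - b') = dd x a b - dd x a b'"
    and dd_swap: "dd x b a = - dd x a b" for x a a' b b' s
    unfolding dd_def
    by (rule rdet_two_rows[OF ne] rdet_upd_add rdet_upd_scaleR rdet_upd_diff rdet_swap[OF ne])+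
  have dd_sum: "dd x a (sum f UNIV) = (\<Sum>j\<in>UNIV. dd x a (f j))" for x a and f :: "'n \<Rightarrow> _"
    unfolding dd_def by (rule rdet_upd_sum) simp
  have dd_cont: "continuous_on UNIV (\<lambda>x. dd x (a x) (b x))"
    if "continuous_on UNIV a" "continuous_on UNIV b" for a b
    unfolding dd_def
  proof (rule continuous_on_rdet)
    fix i show "continuous_on UNIV (\<lambda>x. ((r x)(i1 := a x, i2 := b x)) i)"
      using that Du_cont by (cases "i = i2"; cases "i = i1") (simp_all add: r_def)
  qed
  have E1: "((\<lambda>x. dd x (w x *\<^sub>R dX j x + X j x *\<^sub>R W x) (dY j x)) has_integral 0) (cube 2)" for j
    unfolding dd_def by (rule null[OF C1_grad_mult[OF w X] Y]) (simp add: w_def 0)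
  have E2: "((\<lambda>x. dd x (w x *\<^sub>R dY j x + Y j x *\<^sub>R W x) (dX j x)) has_integral 0) (cube 2)" for j
    unfolding dd_def by (rule null[OF C1_grad_mult[OF w Y] X]) (simp add: w_def 0)
  have E3: "((\<lambda>x. dd x (W x) (Du m None x)) has_integral 0) (cube 2)"
    unfolding dd_def by (rule null[OF w u_C1]) (simp add: w_def 0)
  have W_cont: "continuous_on UNIV W" by (rule C1_grad_continuous_grad[OF w])
  have int\<theta>: "((\<lambda>x. dd x (W x) (\<theta> m x)) has_integral integral (cube 2) (\<lambda>x. dd x (W x) (\<theta> m x))) (cube 2)"
    by (intro integrable_integral integrable_on_cube dd_cont W_cont \<theta>_cont)
  have pointwise: "4 * (\<Sum>j\<in>UNIV. w x * dd x (dX j x) (dY j x))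
      = 2 * (\<Sum>j\<in>UNIV. dd x (w x *\<^sub>R dX j x + X j x *\<^sub>R W x) (dY j x)
                    - dd x (w x *\<^sub>R dY j x + Y j x *\<^sub>R W x) (dX j x))
        + dd x (W x) (Du m None x) - dd x (W x) (\<theta> m x)" for x
  proof -
    have "dd x (W x) (\<theta> m x) = dd x (W x) (Du m None x)
        + 2 * (\<Sum>j\<in>UNIV. X j x * dd x (W x) (dY j x) - Y j x * dd x (W x) (dX j x))"
      by (simp only: \<theta>_eq dd_add' dd_scale' dd_sum dd_diff' X_def Y_def dX_def dY_def)
    moreover have "dd x (w x *\<^sub>R dX j x + X j x *\<^sub>R W x) (dY j x)
        - dd x (w x *\<^sub>R dY j x + Y j x *\<^sub>R W x) (dX j x)
        = 2 * (w x * dd x (dX j x) (dY j x))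
          + (X j x * dd x (W x) (dY j x) - Y j x * dd x (W x) (dX j x))" for j
      using dd_swap[of x "dY j x" "dX j x"] by (simp add: dd_add dd_scale)
    ultimately show ?thesis
      by (simp add: sum.distrib sum_distrib_left[symmetric])
  qed
  have "((\<lambda>x. 4 * (\<Sum>j\<in>UNIV. w x * dd x (dX j x) (dY j x))) has_integral
      2 * (\<Sum>j\<in>(UNIV :: 'n set). 0 - 0) + 0 - integral (cube 2) (\<lambda>x. dd x (W x) (\<theta> m x))) (cube 2)"
    unfolding pointwise
    by (intro has_integral_diff has_integral_add has_integral_mult_right has_integral_sum E1 E2 E3 int\<theta>) simp
  from integral_unique[OF this]
  have "integral (cube 2) (\<lambda>x. 4 * (\<Sum>j\<in>UNIV. w x * dd x (dX j x) (dY j x)))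
      = - integral (cube 2) (\<lambda>x. dd x (W x) (\<theta> m x))"
    by simp
  moreover have "(\<Sum>j\<in>UNIV. pairing h (c(i1 := Some (j, False), i2 := Some (j, True))) m)
      = integral (cube 2) (\<lambda>x. \<Sum>j\<in>UNIV. w x * dd x (dX j x) (dY j x))"
  proof -
    have "(\<lambda>x. w x * dd x (dX j x) (dY j x)) integrable_on cube 2" for j
      by (intro integrable_on_cube continuous_on_mult C1_grad_continuous[OF w] dd_cont
          C1_grad_continuous_grad[OF X] C1_grad_continuous_grad[OF Y])
    then have "integral (cube 2) (\<lambda>x. \<Sum>j\<in>UNIV. w x * dd x (dX j x) (dY j x))
        = (\<Sum>j\<in>UNIV. integral (cube 2) (\<lambda>x. w x * dd x (dX j x) (dY j x)))"
      by (intro integral_sum) simp_all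
    moreover have "pairing h (c(i1 := Some (j, False), i2 := Some (j, True))) m
        = integral (cube 2) (\<lambda>x. w x * dd x (dX j x) (dY j x))" for j
      unfolding pairing_def row_replace w_def dd_def dX_def dY_def r_def[abs_def] by (rule refl)
    ultimately show ?thesis by (simp only:)
  qed
  ultimately show ?thesis
    by (simp add: dd_def r_def[abs_def])
qed

text \<open>
  Up to a factor this is the integral of \<open>h d\<alpha> \<and> \<gamma>\<close>, where \<open>\<alpha>\<close> is the contact form.  By parts it becomes an
  integral with a row \<open>\<theta>\<close>; the row \<open>dw\<close> is a bounded combination of the differentials of the coordinates.
\<close>

lemma symplectic_contraction_tends_0:
  assumes h: "test_function h" and ne: "i1 \<noteq> i2"
  shows "(\<lambda>m. \<Sum>j\<in>UNIV. pairing h (c(i1 := Some (j, False), i2 := Some (j, True))) m) \<longlonglongrightarrow> 0"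
proof -
  obtain H where H: "C1_grad h H"
    and ev: "\<forall>\<^sub>F m in sequentially. \<forall>x. norm x \<ge> 1 \<longrightarrow> h (u m x) = 0"
    using h by (auto simp: test_function_def)
  define W where "W m x = (\<Sum>c\<in>UNIV. (H (u m x) $ c) *\<^sub>R Du m c x)" for m x
  obtain A where A: "A \<ge> 0" "\<And>m x. norm (H (u m x)) \<le> A"
    by (rule bounded_along[OF C1_grad_continuous_grad[OF H]]) (rule that)
  define K where "K = max 1 (real CARD(('n \<times> bool) option) * A)"
  have "norm (W m x) \<le> K * \<Lambda> m" for m x
  proof -
    have "norm (W m x) \<le> (\<Sum>c\<in>(UNIV :: ('n \<times> bool) option set). A * \<Lambda> m)"
      unfolding W_def
    proof (rule sum_norm_le)
      fix c
      have "\<bar>H (u m x) $ c\<bar> \<le> A" using A(2) component_le_norm_cart order_trans by blast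
      then have "\<bar>H (u m x) $ c\<bar> * norm (Du m c x) \<le> A * \<Lambda> m"
        by (intro mult_mono Du_bounded A) auto
      then show "norm ((H (u m x) $ c) *\<^sub>R Du m c x) \<le> A * \<Lambda> m" by simp
    qed
    also have "\<dots> = real CARD(('n \<times> bool) option) * A * \<Lambda> m" by (simp only: sum_constant mult.assoc)
    also have "\<dots> \<le> K * \<Lambda> m"
      unfolding K_def by (intro mult_right_mono \<Lambda>_nonneg) simp
    finally show ?thesis .
  qed
  moreover have "norm (Du m c x) \<le> K * \<Lambda> m" for m c x
    using Du_bounded[of m c x] mult_right_mono[OF max.cobounded1[of 1 "real CARD(('n \<times> bool) option) * A"] \<Lambda>_nonneg[of m]]
    by (simp add: K_def)
  moreover have W_cont: "continuous_on UNIV (W m)" for m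
    using C1_grad_continuous_grad[OF C1_grad_compose[OF H u_C1[of m]]] by (simp add: W_def[abs_def])
  moreover have "continuous_on UNIV (\<lambda>x. ((\<lambda>i. Du m (c i) x)(i1 := W m x, i2 := \<theta> m x)) i)" for m i
    by (cases "i = i2"; cases "i = i1") (simp_all add: W_cont \<theta>_cont Du_cont)
  ultimately have "(\<lambda>m. integral (cube 2) (\<lambda>x. 1 * rdet ((\<lambda>i. Du m (c i) x)(i1 := W m x, i2 := \<theta> m x))))
      \<longlonglongrightarrow> 0"
    by (intro small_row_integral[where k = i2 and K = K and A = 1])
      (auto simp del: fun_upd_apply, auto simp: \<theta>_bounded)
  from tendsto_mult_left[OF this, of "- (1/4)"]
  have "(\<lambda>m. - (1/4) * integral (cube 2) (\<lambda>x. rdet ((\<lambda>i. Du m (c i) x)(i1 := W m x, i2 := \<theta> m x)))) \<longlonglongrightarrow> 0"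
    by simp
  moreover have "\<forall>\<^sub>F m in sequentially.
      - (1/4) * integral (cube 2) (\<lambda>x. rdet ((\<lambda>i. Du m (c i) x)(i1 := W m x, i2 := \<theta> m x)))
      = (\<Sum>j\<in>UNIV. pairing h (c(i1 := Some (j, False), i2 := Some (j, True))) m)"
    using ev by (rule eventually_mono) (rule contraction_by_parts[OF H _ ne W_def, symmetric], blast)
  ultimately show ?thesis by (rule Lim_transform_eventually)
qed

lemma pairing_even_permutation:
  assumes "\<pi> permutes UNIV" "sign \<pi> = 1"
  shows "pairing h (\<lambda>i. c (\<pi> i)) m = pairing h c m"
  unfolding pairing_def using rdet_permute_rows[OF assms(1), of "\<lambda>i. Du m (c i) x" for x] assms(2)
  by simp

text \<open>
  Let \<open>D\<close> be the set of conjugate pairs that occur completely among the chosen coordinates and \<open>E\<close> the set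
  of those that do not occur.  Moving a pair of \<open>D\<close> onto a pair of which one coordinate occurs already gives
  two equal rows, so the contraction over all pairs is a sum over \<open>D \<union> E\<close> only, and the Lefschetz argument
  applies.
\<close>

lemma pairing_horizontal_tends_0:
  assumes h: "test_function h" and none: "None \<notin> range c"
  shows "pairing h c \<longlonglongrightarrow> 0"
proof (cases "inj c")
  case False
  then have "pairing h c = (\<lambda>_. 0)" using pairing_not_inj by blast
  then show ?thesis by simp
next
  case True
  define D where "D = {j. Some (j, False) \<in> range c \<and> Some (j, True) \<in> range c}"
  define E where "E = {j. Some (j, False) \<notin> range c \<and> Some (j, True) \<notin> range c}"
  define pos where "pos d b = inv c (Some (d, b))" for d b
  have c_pos: "c (pos d b) = Some (d, b)" if "d \<in> D" for d b
    using that unfolding pos_def D_def by (cases b) (auto simp: f_inv_into_f)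
  have pos_eq: "i = pos d b \<longleftrightarrow> c i = Some (d, b)" if "d \<in> D" for i d b
    using c_pos[OF that, of b] injD[OF True, of i "pos d b"] by (metis (no_types))
  have pos_inj: "pos d b = pos d' b' \<longleftrightarrow> d = d' \<and> b = b'" if "d \<in> D" "d' \<in> D" for d d' b b'
  proof
    assume "pos d b = pos d' b'"
    then have "c (pos d b) = c (pos d' b')" by (rule arg_cong)
    then show "d = d' \<and> b = b'" by (simp add: c_pos that)
  qed simp
  define A where "A m \<tau> = pairing h (\<lambda>i. relabel D \<tau> (c i)) m" for m \<tau>
  have "((\<lambda>m. A m id) \<longlonglongrightarrow> 0)"
  proof (rule lefschetz_limit[where D = D and E = E])
    show "D \<inter> E = {}" by (auto simp: D_def E_def)
    show "card E < card D"
      using card_full_pairs[OF True none card_domain] by (simp add: D_def E_def)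
  next
    fix \<tau> d assume d: "d \<in> D"
    define c' where "c' i = relabel D \<tau> (c i)" for i
    let ?c = "\<lambda>j. c'(pos d False := Some (j, False), pos d True := Some (j, True))"
    have eq: "(\<lambda>i. relabel D (\<tau>(d := j)) (c i)) = ?c j" for j
    proof
      fix i
      show "relabel D (\<tau>(d := j)) (c i) = ?c j i"
      proof (cases "\<exists>b. c i = Some (d, b)")
        case True
        then obtain b where b: "c i = Some (d, b)" by blast
        then have "i = pos d b" using pos_eq[OF d] by blast
        then show ?thesis using d b pos_inj[OF d d] by (cases b) auto
      next
        case False
        then have "i \<noteq> pos d False" "i \<noteq> pos d True" using pos_eq[OF d] by auto
        moreover have "relabel D (\<tau>(d := j)) (c i) = relabel D \<tau> (c i)"
          using False by (cases "c i") auto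
        ultimately show ?thesis by (simp add: c'_def)
      qed
    qed
    have "(\<Sum>j\<in>D \<union> E. A m (\<tau>(d := j))) = (\<Sum>j\<in>UNIV. pairing h (?c j) m)" for m
      unfolding A_def eq
    proof (rule sum.mono_neutral_left)
      show "\<forall>j\<in>UNIV - (D \<union> E). pairing h (?c j) m = 0"
      proof
        fix j assume j: "j \<in> UNIV - (D \<union> E)"
        then obtain b i where i: "c i = Some (j, b)" by (auto simp: D_def E_def) (metis)+
        have "i \<noteq> pos d b'" for b' using i j d c_pos[OF d, of b'] by auto
        moreover have "c' i = Some (j, b)" using i j by (simp add: c'_def)
        ultimately have "?c j i = ?c j (pos d b)" "i \<noteq> pos d b"
          using pos_inj[OF d d] by (cases b; simp)+
        then have "\<not> inj (?c j)" by (meson injD)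
        then show "pairing h (?c j) m = 0" by (rule pairing_not_inj)
      qed
    qed auto
    then show "(\<lambda>m. \<Sum>j\<in>D \<union> E. A m (\<tau>(d := j))) \<longlonglongrightarrow> 0"
      using symplectic_contraction_tends_0[OF h, of "pos d False" "pos d True" c'] pos_inj[OF d d] by simp
  next
    fix m and \<tau> :: "'n \<Rightarrow> 'n" and d d'
    assume d: "d \<in> D" "d' \<in> D" and ne: "d \<noteq> d'" and eq: "\<tau> d = \<tau> d'"
    have "relabel D \<tau> (c (pos d True)) = relabel D \<tau> (c (pos d' True))" "pos d True \<noteq> pos d' True"
      using d ne eq by (simp_all add: c_pos pos_inj)
    then have "\<not> inj (\<lambda>i. relabel D \<tau> (c i))" by (auto simp: inj_on_def)
    then show "A m \<tau> = 0" unfolding A_def by (rule pairing_not_inj)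
  next
    fix m \<tau> assume "\<tau> permutes D"
    with finite[of D] show "A m \<tau> = A m id"
    proof (induction rule: permutes_rev_induct)
      case id
      show ?case ..
    next
      case (swap a b p)
      let ?t = "Transposition.transpose a b"
      \<comment> \<open>Exchanging two conjugate pairs is a product of two transpositions of rows, so it preserves the
        determinant.\<close>
      define \<pi> where "\<pi> = Transposition.transpose (pos a False) (pos b False)
        \<circ> Transposition.transpose (pos a True) (pos b True)"
      have "\<pi> permutes UNIV"
        unfolding \<pi>_def by (intro permutes_compose permutes_swap_id) auto
      moreover have "sign \<pi> = 1"
        unfolding \<pi>_def using swap.hyps
        by (subst sign_compose) (simp_all add: permutation_swap_id sign_swap_id pos_inj)
      moreover have "relabel D (p \<circ> ?t) (c i) = relabel D p (c (\<pi> i))" for i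
      proof -
        have "relabel D ?t (c i) = c (\<pi> i)"
        proof (cases "c i")
          case None
          then show ?thesis using none by (metis rangeI)
        next
          case (Some q)
          obtain j b' where q: "q = (j, b')" by (cases q)
          consider "j = a" | "j = b" | "j \<noteq> a" "j \<noteq> b" by blast
          then show ?thesis
          proof cases
            case 1
            then have "i = pos a b'" using pos_eq[of a] swap.hyps Some q by auto
            then have "\<pi> i = pos b b'"
              using swap.hyps by (cases b') (auto simp: \<pi>_def Transposition.transpose_def pos_inj)
            then show ?thesis using 1 swap.hyps Some q by (simp add: c_pos)
          next
            case 2
            then have "i = pos b b'" using pos_eq[of b] swap.hyps Some q by auto
            then have "\<pi> i = pos a b'"
              using swap.hyps by (cases b') (auto simp: \<pi>_def Transposition.transpose_def pos_inj)
            then show ?thesis using 2 swap.hyps Some q by (simp add: c_pos)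
          next
            case 3
            then have "i \<noteq> pos a b''" "i \<noteq> pos b b''" for b''
              using pos_eq[of a i b''] pos_eq[of b i b''] swap.hyps Some q by auto
            then have "\<pi> i = i" by (simp add: \<pi>_def Transposition.transpose_def)
            then show ?thesis using 3 Some q by (simp add: Transposition.transpose_def)
          qed
        qed
        then have "relabel D p (c (\<pi> i)) = relabel D p (relabel D ?t (c i))" by simp
        also have "\<dots> = relabel D (p \<circ> ?t) (c i)"
          by (rule relabel_relabel) (use swap.hyps in \<open>auto simp: Transposition.transpose_def\<close>)
        finally show ?thesis by simp
      qed
      ultimately have "A m (p \<circ> ?t) = A m p"
        unfolding A_def using pairing_even_permutation[of \<pi> h "\<lambda>i. relabel D p (c i)"] by simp
      then show ?case using swap.IH by (rule trans)
    qed
  qed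
  then show ?thesis by (simp add: A_def relabel_id)
qed

text \<open>
  A row \<open>dt\<close> is \<open>\<theta> - 2 \<Sum>\<^sub>j (x\<^sub>j dy\<^sub>j - y\<^sub>j dx\<^sub>j)\<close>.  The term with \<open>\<theta>\<close> is small, and the others have
  horizontal rows only, with the coefficients \<open>x\<^sub>j\<close> and \<open>y\<^sub>j\<close> absorbed into the test function.
\<close>

lemma pairing_tends_0:
  assumes h: "test_function h"
  shows "pairing h c \<longlonglongrightarrow> 0"
proof (cases "inj c \<and> None \<in> range c")
  case False
  then show ?thesis
  proof (cases "inj c")
    case True
    with False show ?thesis by (intro pairing_horizontal_tends_0 h) blast
  next
    case False
    then have "pairing h c = (\<lambda>_. 0)" using pairing_not_inj by blast
    then show ?thesis by simp
  qed
next
  case True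
  then have inj: "inj c" and "None \<in> range c" by auto
  then obtain k where "None = c k" by blast
  then have k: "c k = None" by (rule sym)
  have none: "None \<notin> range (c(k := Some q))" for q
  proof
    assume "None \<in> range (c(k := Some q))"
    then obtain i where "None = (c(k := Some q)) i" by (rule rangeE)
    then have i: "(c(k := Some q)) i = None" by (rule sym)
    then have "i \<noteq> k" by auto
    with i have "c i = c k" by (simp add: k)
    with \<open>i \<noteq> k\<close> show False using injD[OF inj] by blast
  qed
  let ?X = "\<lambda>j. Some (j, False)" and ?Y = "\<lambda>j. Some (j, True)"
  define hc where "hc q y = h y * y $ q" for q y
  have hc: "test_function (hc q)" for q
    unfolding hc_def[abs_def] using C1_grad_nth by (intro test_function_mult h) blast
  define I where "I m = integral (cube 2) (\<lambda>x. h (u m x) * rdet ((\<lambda>i. Du m (c i) x)(k := \<theta> m x)))" for m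
  obtain H where H: "C1_grad h H" using h by (auto simp: test_function_def)
  obtain A where A: "A \<ge> 0" "\<And>m x. norm (h (u m x)) \<le> A"
    by (rule bounded_along[OF C1_grad_continuous[OF H]]) (rule that)
  have rows_cont: "continuous_on UNIV (\<lambda>x. ((\<lambda>i. Du m (c i) x)(k := \<theta> m x)) i)" for m i
    by (cases "i = k") (simp_all add: \<theta>_cont Du_cont)
  have I: "I \<longlonglongrightarrow> 0"
    unfolding I_def
    by (rule small_row_integral[where k = k and K = 1 and A = A])
      (use A Du_bounded \<theta>_bounded rows_cont test_function_cont[OF h] in \<open>simp_all del: fun_upd_apply, simp_all\<close>)
  have eq: "pairing h c m = I m - 2 * (\<Sum>j\<in>UNIV. pairing (hc (?X j)) (c(k := ?Y j)) m
      - pairing (hc (?Y j)) (c(k := ?X j)) m)" for m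
  proof -
    have row: "(\<lambda>i. Du m ((c(k := q)) i) x) = (\<lambda>i. Du m (c i) x)(k := Du m q x)" for q x
      by auto
    define d where "d x a = rdet ((\<lambda>i. Du m (c i) x)(k := a))" for x a
    have d_add: "d x (a + b) = d x a + d x b" and d_diff: "d x (a - b) = d x a - d x b"
      and d_scale: "d x (s *\<^sub>R a) = s * d x a" for x a b s
      unfolding d_def by (rule rdet_upd_add rdet_upd_diff rdet_upd_scaleR)+
    have d_sum: "d x (sum f UNIV) = (\<Sum>j\<in>UNIV. d x (f j))" for x and f :: "'n \<Rightarrow> _"
      unfolding d_def by (rule rdet_upd_sum) simp
    have p: "pairing (hc q) (c(k := q')) m = integral (cube 2) (\<lambda>x. h (u m x) * (u m x $ q * d x (Du m q' x)))"
      for q q'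
      by (simp only: pairing_def row d_def hc_def mult.assoc)
    have int: "(\<lambda>x. h (u m x) * (u m x $ q * d x (Du m q' x))) integrable_on cube 2" for q q'
      using pairing_integrable[OF hc, of q m "c(k := q')"] by (simp only: row d_def hc_def mult.assoc)
    have "pairing h c m = integral (cube 2) (\<lambda>x. h (u m x) * d x (Du m None x))"
      using k by (simp only: pairing_def d_def row[symmetric]) (simp add: fun_upd_idem)
    also have "\<dots> = integral (cube 2) (\<lambda>x. h (u m x) * d x (\<theta> m x) - 2 * (\<Sum>j\<in>UNIV.
        h (u m x) * (u m x $ ?X j * d x (Du m (?Y j) x)) - h (u m x) * (u m x $ ?Y j * d x (Du m (?X j) x))))"
    proof (rule integral_cong)
      fix x
      have "d x (\<theta> m x) = d x (Du m None x) + 2 * (\<Sum>j\<in>UNIV.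
          u m x $ ?X j * d x (Du m (?Y j) x) - u m x $ ?Y j * d x (Du m (?X j) x))"
        by (simp only: \<theta>_eq d_add d_scale d_sum d_diff)
      then show "h (u m x) * d x (Du m None x) = h (u m x) * d x (\<theta> m x) - 2 * (\<Sum>j\<in>UNIV.
        h (u m x) * (u m x $ ?X j * d x (Du m (?Y j) x)) - h (u m x) * (u m x $ ?Y j * d x (Du m (?X j) x)))"
        by (simp add: algebra_simps sum_distrib_left)
    qed
    also have "\<dots> = I m - 2 * (\<Sum>j\<in>UNIV. pairing (hc (?X j)) (c(k := ?Y j)) m
      - pairing (hc (?Y j)) (c(k := ?X j)) m)"
    proof -
      have "((\<lambda>x. h (u m x) * d x (\<theta> m x)) has_integral I m) (cube 2)"
        unfolding I_def d_def
        by (intro integrable_integral integrable_on_cube continuous_on_mult continuous_on_rdet rows_cont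
            test_function_cont h)
      then show ?thesis
        unfolding p
        by (intro integral_unique has_integral_diff has_integral_mult_right has_integral_sum
            integrable_integral int) simp_all
    qed
    finally show ?thesis .
  qed
  have "(\<lambda>m. I m - 2 * (\<Sum>j\<in>UNIV. pairing (hc (?X j)) (c(k := ?Y j)) m
      - pairing (hc (?Y j)) (c(k := ?X j)) m)) \<longlonglongrightarrow> 0 - 2 * (\<Sum>j\<in>(UNIV :: 'n set). 0 - 0)"
    by (intro tendsto_diff tendsto_mult tendsto_const tendsto_sum pairing_horizontal_tends_0 hc none I)
  then have "(\<lambda>m. pairing h c m) \<longlonglongrightarrow> 0"
    unfolding eq by simp
  then show ?thesis .
qed

lemma pullback_tends_0:
  assumes h: "test_function h" and G: "\<And>i c. \<exists>G'. C1_grad (\<lambda>y. G i y $ c) G'"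
  shows "(\<lambda>m. integral (cube 2) (\<lambda>x. h (u m x) *
      rdet (\<lambda>i. \<Sum>c\<in>UNIV. (G i (u m x) $ c) *\<^sub>R Du m c x))) \<longlonglongrightarrow> 0"
proof -
  define hf where "hf f y = h y * (\<Prod>i\<in>UNIV. G i y $ f i)" for f y
  have hf: "test_function (hf f)" for f
    unfolding hf_def[abs_def] by (intro test_function_mult h C1_grad_prod finite G)
  have int: "(\<lambda>x. h (u m x) * ((\<Prod>i\<in>UNIV. G i (u m x) $ f i) * rdet (\<lambda>i. Du m (f i) x)))
      integrable_on cube 2" for f m
    using pairing_integrable[OF hf[of f], of m f] by (simp only: hf_def mult.assoc)
  have "integral (cube 2) (\<lambda>x. h (u m x) * rdet (\<lambda>i. \<Sum>c\<in>UNIV. (G i (u m x) $ c) *\<^sub>R Du m c x))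
      = (\<Sum>f\<in>UNIV. pairing (hf f) f m)" for m
    unfolding rdet_expand pairing_def
    by (simp only: hf_def mult.assoc sum_distrib_left) (rule integral_sum, simp_all add: int)
  moreover have "(\<lambda>m. \<Sum>f\<in>UNIV. pairing (hf f) f m) \<longlonglongrightarrow> (\<Sum>f\<in>(UNIV :: ('k \<Rightarrow> ('n \<times> bool) option) set). 0)"
    by (intro tendsto_sum pairing_tends_0 hf)
  ultimately show ?thesis by simp
qed

end

section \<open>Coordinates on the Heisenberg group\<close>

text \<open>
  The smallness of the Hoelder constant on small scales, free of suprema and limits.
\<close>

lemma holder_plus_modulus:
  assumes f: "f \<in> holder_plus_on \<alpha> S" and e: "e > 0"
  obtains t where "t > 0" "t \<le> 1"
    "\<And>x y. x \<in> S \<Longrightarrow> y \<in> S \<Longrightarrow> norm (x - y) \<le> t \<Longrightarrow> dist (f x) (f y) \<le> e * norm (x - y) powr \<alpha>"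
proof -
  let ?T = "\<lambda>t. {(x, y). x \<in> S \<and> y \<in> S \<and> 0 < norm (x - y) \<and> norm (x - y) \<le> t}"
  let ?q = "\<lambda>(x, y). ennreal (dist (f x) (f y) / norm (x - y) powr \<alpha>)"
  have "((\<lambda>t. SUP p\<in>?T t. ?q p) \<longlongrightarrow> 0) (at_right 0)"
    using f by (simp add: holder_plus_on_def)
  then have "\<forall>\<^sub>F t in at_right 0. (SUP p\<in>?T t. ?q p) < ennreal e"
    by (rule order_tendstoD) (use e in simp)
  then obtain b where b: "b > 0" "\<And>t. 0 < t \<Longrightarrow> t < b \<Longrightarrow> (SUP p\<in>?T t. ?q p) < ennreal e"
    unfolding eventually_at_right_field by auto
  define t where "t = min (b / 2) 1"
  have t: "0 < t" "t < b" "t \<le> 1" using b(1) by (auto simp: t_def)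
  show ?thesis
  proof (rule that[OF t(1,3)])
    fix x y assume xy: "x \<in> S" "y \<in> S" "norm (x - y) \<le> t"
    show "dist (f x) (f y) \<le> e * norm (x - y) powr \<alpha>"
    proof (cases "x = y")
      case False
      then have pos: "norm (x - y) powr \<alpha> > 0" by simp
      have "?q (x, y) \<le> (SUP p\<in>?T t. ?q p)"
        by (rule SUP_upper) (use xy False in auto)
      also have "\<dots> < ennreal e" by (rule b(2)[OF t(1,2)])
      finally have "dist (f x) (f y) / norm (x - y) powr \<alpha> < e"
        by (simp add: ennreal_less_iff)
      with pos show ?thesis by (simp add: pos_divide_less_eq)
    qed simp
  qed
qed

definition coords :: "'n::finite heis \<Rightarrow> real ^ ('n \<times> bool) option" where
  "coords p = (\<chi> c. case c of None \<Rightarrow> tcoord p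
     | Some (j, b) \<Rightarrow> if b then ycoord p $ j else xcoord p $ j)"

lemma coords_nth [simp]:
  "coords p $ None = tcoord p"
  "coords p $ Some (j, False) = xcoord p $ j"
  "coords p $ Some (j, True) = ycoord p $ j"
  by (simp_all add: coords_def)

lemma inj_coords: "inj coords"
proof (rule injI)
  fix p q :: "'a heis" assume "coords p = coords q"
  then have "coords p $ c = coords q $ c" for c by simp
  from this[of None] this[of "Some (j, False)" for j] this[of "Some (j, True)" for j]
  show "p = q" by (intro heis.expand) (auto simp: vec_eq_iff)
qed

lemma koranyi_norm_ge:
  "norm (xcoord p, ycoord p) \<le> koranyi_norm p" "\<bar>tcoord p\<bar> \<le> koranyi_norm p ^ 2"
proof -
  show "norm (xcoord p, ycoord p) \<le> koranyi_norm p"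
  proof (rule power2_le_imp_le[OF _ koranyi_norm_nonneg])
    show "(norm (xcoord p, ycoord p))\<^sup>2 \<le> (koranyi_norm p)\<^sup>2"
      using complex_Re_le_cmod[of "Complex ((norm (xcoord p, ycoord p))\<^sup>2) (tcoord p)"]
      by (simp add: koranyi_norm_sq)
  qed
  show "\<bar>tcoord p\<bar> \<le> koranyi_norm p ^ 2"
    using abs_Im_le_cmod[of "Complex ((norm (xcoord p, ycoord p))\<^sup>2) (tcoord p)"]
    by (simp add: koranyi_norm_sq)
qed

lemma coords_horizontal_dist_le: "\<bar>coords p $ Some (j, b) - coords q $ Some (j, b)\<bar> \<le> dist p q"
proof -
  let ?r = "heis_mult (heis_inv q) p"
  have r: "xcoord ?r = xcoord p - xcoord q" "ycoord ?r = ycoord p - ycoord q"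
    by (simp_all add: heis_mult_def heis_inv_def)
  have "norm (xcoord p - xcoord q) \<le> norm (xcoord ?r, ycoord ?r)"
    "norm (ycoord p - ycoord q) \<le> norm (xcoord ?r, ycoord ?r)"
    unfolding r by (metis fst_conv norm_fst_le) (metis snd_conv norm_snd_le)
  then have "norm (xcoord p - xcoord q) \<le> dist p q" "norm (ycoord p - ycoord q) \<le> dist p q"
    using koranyi_norm_ge(1)[of ?r] unfolding dist_heis_def by linarith+
  then show ?thesis
    using component_le_norm_cart[of "xcoord p - xcoord q" j] component_le_norm_cart[of "ycoord p - ycoord q" j]
    by (cases b) auto
qed

text \<open>
  The left side is the vertical coordinate of \<open>q\<^sup>-\<^sup>1 * p\<close>, which the Koranyi norm controls to second order.
\<close>

lemma coords_contact_dist_le: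
  "\<bar>coords p $ None - coords q $ None + 2 * (\<Sum>j\<in>UNIV.
      coords q $ Some (j, False) * (coords p $ Some (j, True) - coords q $ Some (j, True))
    - coords q $ Some (j, True) * (coords p $ Some (j, False) - coords q $ Some (j, False)))\<bar>
   \<le> (dist p q)\<^sup>2"
proof -
  have "coords p $ None - coords q $ None + 2 * (\<Sum>j\<in>UNIV.
      coords q $ Some (j, False) * (coords p $ Some (j, True) - coords q $ Some (j, True))
    - coords q $ Some (j, True) * (coords p $ Some (j, False) - coords q $ Some (j, False)))
    = tcoord (heis_mult (heis_inv q) p)"
    by (simp add: heis_mult_def heis_inv_def algebra_simps)
  then show ?thesis using koranyi_norm_ge(2) unfolding dist_heis_def by metis
qed

lemma continuous_on_coords: "continuous_on UNIV coords"
  unfolding continuous_on_def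
proof
  fix q :: "'n::finite heis"
  have "((\<lambda>p. dist p q) \<longlongrightarrow> dist q q) (at q)"
    by (intro tendsto_intros)
  then have d: "((\<lambda>p. dist p q) \<longlongrightarrow> 0) (at q)" by simp
  have hor: "((\<lambda>p. coords p $ Some (j, b)) \<longlongrightarrow> coords q $ Some (j, b)) (at q)" for j b
    by (rule LIM_zero_cancel, rule Lim_null_comparison[OF always_eventually d])
      (simp add: coords_horizontal_dist_le)
  let ?s = "\<lambda>p. 2 * (\<Sum>j\<in>UNIV. coords q $ Some (j, False) * (coords p $ Some (j, True) - coords q $ Some (j, True))
    - coords q $ Some (j, True) * (coords p $ Some (j, False) - coords q $ Some (j, False)))"
  have "((\<lambda>p. coords p $ None - coords q $ None + ?s p) \<longlongrightarrow> 0) (at q)"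
  proof (rule Lim_null_comparison[OF always_eventually])
    show "((\<lambda>p. (dist p q)\<^sup>2) \<longlongrightarrow> 0) (at q)" using tendsto_power[OF d, of 2] by simp
  qed (simp only: coords_contact_dist_le real_norm_def, simp)
  moreover have "(?s \<longlongrightarrow> 2 * (\<Sum>j\<in>(UNIV :: 'n set). coords q $ Some (j, False) * (coords q $ Some (j, True) - coords q $ Some (j, True))
    - coords q $ Some (j, True) * (coords q $ Some (j, False) - coords q $ Some (j, False)))) (at q)"
    by (intro tendsto_intros hor)
  ultimately have "((\<lambda>p. (coords p $ None - coords q $ None + ?s p) - ?s p) \<longlongrightarrow> 0 - 0) (at q)"
    by (intro tendsto_diff) simp_all
  then have "((\<lambda>p. coords p $ None - coords q $ None) \<longlongrightarrow> 0) (at q)" by simp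
  then have vert: "((\<lambda>p. coords p $ None) \<longlongrightarrow> coords q $ None) (at q)" by (rule LIM_zero_cancel)
  show "(coords \<longlongrightarrow> coords q) (at q)"
  proof (rule vec_tendstoI)
    fix c show "((\<lambda>p. coords p $ c) \<longlongrightarrow> coords q $ c) (at q)"
      using hor vert by (cases c) auto
  qed
qed

text \<open>
  For \<open>|y - x| \<le> \<epsilon>\<close> the horizontal coordinates of \<open>F\<close> vary by at most \<open>\<kappa>\<close>, and so does \<open>t\<close> up to a constant
  factor.  The value of \<open>\<theta>\<close> at \<open>x\<close> is the gradient at \<open>x\<close> of the mollification of
  \<open>q = t + 2 \<Sum>\<^sub>j (a\<^sub>j y\<^sub>j - b\<^sub>j x\<^sub>j)\<close>, where \<open>a\<^sub>j, b\<^sub>j\<close> are the constants \<open>x\<^sub>j, y\<^sub>j\<close> of the mollified map at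
  \<open>x\<close>.  If \<open>a\<^sub>j, b\<^sub>j\<close> were the coordinates of \<open>F x\<close> itself, \<open>q y - q x\<close> would be the vertical coordinate of
  \<open>F(x)\<^sup>-\<^sup>1 * F(y)\<close>, hence at most \<open>\<kappa>\<^sup>2\<close>; the error is a sum of products of two quantities \<open>O(\<kappa>)\<close>.  So
  \<open>\<theta>\<close> is \<open>O(\<kappa>\<^sup>2 / \<epsilon>)\<close>.
\<close>

lemma mollified_horizontal_sequence:
  fixes F :: "real ^ 'k::{finite,wellorder} \<Rightarrow> 'n::finite heis"
    and \<epsilon> :: "nat \<Rightarrow> real"
  defines "v \<equiv> \<lambda>x. coords (F x)"
  defines "\<alpha> \<equiv> (real CARD('n) + 1) / (real CARD('n) + 2)"
  defines "\<kappa> \<equiv> \<lambda>m. \<epsilon> m powr \<alpha> / Suc m"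
  defines "u \<equiv> \<lambda>m x. \<chi> c. mollify (\<epsilon> m) (\<lambda>y. v y $ c) x"
  defines "Du \<equiv> \<lambda>m c. mollify_grad (\<epsilon> m) (\<lambda>y. v y $ c)"
  assumes card: "CARD('k) = CARD('n) + 1"
    and \<epsilon>: "\<And>m. \<epsilon> m > 0" "\<And>m. \<epsilon> m \<le> 1"
    and F: "\<And>m x y. norm (x - y) \<le> \<epsilon> m \<Longrightarrow> dist (F x) (F y) \<le> \<kappa> m"
    and v_cont: "continuous_on UNIV v" and v_bounded: "\<And>x. norm (v x) \<le> B"
  shows "\<exists>\<theta> M \<Lambda> \<mu>. horizontal_sequence u Du \<theta> M \<Lambda> \<mu>"
    and "\<exists>L. \<forall>m x. norm (u m x - v x) \<le> L / Suc m"
proof -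
  let ?X = "\<lambda>j. Some (j, False)" and ?Y = "\<lambda>j. Some (j, True)"
  let ?n = "real CARD('n)" and ?N = "real CARD(('n \<times> bool) option)"
  define L where "L = 1 + 4 * ?n * B"
  have B0: "B \<ge> 0" using v_bounded norm_ge_zero order_trans by blast
  have L1: "L \<ge> 1" using B0 by (simp add: L_def)
  have \<kappa>0: "\<kappa> m \<ge> 0" and \<kappa>le: "\<kappa> m \<le> 1 / Suc m" and \<kappa>1: "\<kappa> m \<le> 1" for m
  proof -
    show "\<kappa> m \<ge> 0" by (simp add: \<kappa>_def)
    have "\<epsilon> m powr \<alpha> \<le> 1 powr \<alpha>"
      using \<epsilon>[of m] by (intro powr_mono2) (auto simp: \<alpha>_def)
    then show "\<kappa> m \<le> 1 / Suc m" by (simp add: \<kappa>_def divide_right_mono)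
    also have "\<dots> \<le> 1" by simp
    finally show "\<kappa> m \<le> 1" .
  qed
  have vc: "continuous_on UNIV (\<lambda>y. v y $ c)" for c by (intro continuous_intros v_cont)
  have v_le: "\<bar>v x $ c\<bar> \<le> B" for x c using component_le_norm_cart v_bounded order_trans by blast
  have hor: "\<bar>v y $ Some (j, b) - v x $ Some (j, b)\<bar> \<le> \<kappa> m" if "norm (y - x) \<le> \<epsilon> m" for x y j b m
    using coords_horizontal_dist_le[of "F y" j b "F x"] F[OF that] by (simp add: v_def)
  have contact: "\<bar>v y $ None - v x $ None + 2 * (\<Sum>j\<in>UNIV. v x $ ?X j * (v y $ ?Y j - v x $ ?Y j)
      - v x $ ?Y j * (v y $ ?X j - v x $ ?X j))\<bar> \<le> (\<kappa> m)\<^sup>2" if "norm (y - x) \<le> \<epsilon> m" for x y m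
    using coords_contact_dist_le[of "F y" "F x"] power_mono[OF F[OF that], of 2] unfolding v_def
    by (meson order_trans zero_le_dist)
  have sum_le: "\<bar>2 * (\<Sum>j\<in>UNIV. a j * (v y $ ?Y j - v x $ ?Y j) - b j * (v y $ ?X j - v x $ ?X j))\<bar>
      \<le> 4 * ?n * (C * \<kappa> m)"
    if xy: "norm (y - x) \<le> \<epsilon> m" and C: "\<And>j. \<bar>a j\<bar> \<le> C" "\<And>j. \<bar>b j\<bar> \<le> C" for x y m C and a b :: "'n \<Rightarrow> real"
  proof -
    have C0: "C \<ge> 0" using C(1)[of undefined] by linarith
    have t: "\<bar>a j * (v y $ ?Y j - v x $ ?Y j) - b j * (v y $ ?X j - v x $ ?X j)\<bar> \<le> 2 * (C * \<kappa> m)" for j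
    proof -
      have "\<bar>a j * (v y $ ?Y j - v x $ ?Y j)\<bar> \<le> C * \<kappa> m" "\<bar>b j * (v y $ ?X j - v x $ ?X j)\<bar> \<le> C * \<kappa> m"
        unfolding abs_mult by (intro mult_mono C hor xy C0; simp)+
      then show ?thesis by linarith
    qed
    have "\<bar>\<Sum>j\<in>UNIV. a j * (v y $ ?Y j - v x $ ?Y j) - b j * (v y $ ?X j - v x $ ?X j)\<bar> \<le> ?n * (2 * (C * \<kappa> m))"
      using sum_norm_le[of UNIV "\<lambda>j. a j * (v y $ ?Y j - v x $ ?Y j) - b j * (v y $ ?X j - v x $ ?X j)"
          "\<lambda>_. 2 * (C * \<kappa> m)"] t by simp
    then show ?thesis by simp
  qed
  have osc: "\<bar>v y $ c - v x $ c\<bar> \<le> L * \<kappa> m" if xy: "norm (y - x) \<le> \<epsilon> m" for x y c m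
  proof (cases c)
    case None
    have "\<bar>2 * (\<Sum>j\<in>UNIV. v x $ ?X j * (v y $ ?Y j - v x $ ?Y j) - v x $ ?Y j * (v y $ ?X j - v x $ ?X j))\<bar>
      \<le> 4 * ?n * (B * \<kappa> m)" by (rule sum_le[OF xy v_le v_le])
    moreover have "(\<kappa> m)\<^sup>2 \<le> \<kappa> m" using mult_left_le[OF \<kappa>1 \<kappa>0, of m] by (simp add: power2_eq_square)
    ultimately have "\<bar>v y $ None - v x $ None\<bar> \<le> \<kappa> m + 4 * ?n * (B * \<kappa> m)"
      using contact[OF xy] by linarith
    then show ?thesis by (simp add: None L_def algebra_simps)
  next
    case (Some p)
    then obtain j b where "c = Some (j, b)" by (cases p) auto
    then have "\<bar>v y $ c - v x $ c\<bar> \<le> \<kappa> m" using hor[OF xy] by simp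
    also have "\<dots> \<le> L * \<kappa> m" using mult_right_mono[OF L1 \<kappa>0, of m] by simp
    finally show ?thesis .
  qed
  have u_C1: "C1_grad (\<lambda>x. u m x $ c) (Du m c)" for m c
    using C1_grad_mollify[OF vc \<epsilon>(1)] by (simp add: u_def Du_def)
  have u_near: "\<bar>u m x $ c - v x $ c\<bar> \<le> L * \<kappa> m" for m x c
    using mollify_dist_le[OF vc \<epsilon>(1) osc] by (simp add: u_def)
  have u_near_norm: "norm (u m x - v x) \<le> ?N * (L * \<kappa> m)" for m x
  proof -
    have "norm (u m x - v x) \<le> (\<Sum>c\<in>UNIV. \<bar>(u m x - v x) $ c\<bar>)" by (rule norm_le_l1_cart)
    also have "\<dots> \<le> (\<Sum>c\<in>(UNIV :: ('n \<times> bool) option set). L * \<kappa> m)"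
      by (rule sum_mono) (simp add: u_near)
    finally show ?thesis by simp
  qed
  have "norm (u m x - v x) \<le> (?N * L) / Suc m" for m x
  proof -
    have "?N * (L * \<kappa> m) \<le> ?N * (L * (1 / Suc m))"
      using L1 by (intro mult_left_mono \<kappa>le) auto
    with u_near_norm[of m x] show ?thesis by simp
  qed
  then show "\<exists>L. \<forall>m x. norm (u m x - v x) \<le> L / Suc m" by blast
  let ?C = "mollify_bound TYPE((real, 'k) vec)"
  define \<theta> where "\<theta> m x = Du m None x + 2 *\<^sub>R (\<Sum>j\<in>UNIV.
          u m x $ Some (j, False) *\<^sub>R Du m (Some (j, True)) x
        - u m x $ Some (j, True) *\<^sub>R Du m (Some (j, False)) x)" for m x
  define L' where "L' = 1 + 4 * ?n * L"
  define \<Lambda> where "\<Lambda> m = ?C * (L * \<kappa> m) / \<epsilon> m" for m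
  define \<mu> where "\<mu> m = ?C * (L' * (\<kappa> m)\<^sup>2) / \<epsilon> m" for m
  have \<theta>_bound: "norm (\<theta> m x) \<le> \<mu> m" for m x
  proof -
    let ?a = "\<lambda>j. u m x $ ?X j" and ?b = "\<lambda>j. u m x $ ?Y j"
    define q where "q y = v y $ None + 2 * (\<Sum>j\<in>UNIV. ?a j * v y $ ?Y j + (- ?b j) * v y $ ?X j)" for y
    have qc: "continuous_on UNIV q" unfolding q_def[abs_def] by (intro continuous_intros vc)
    have "mollify_grad (\<epsilon> m) q x = Du m None x
        + mollify_grad (\<epsilon> m) (\<lambda>y. 2 * (\<Sum>j\<in>UNIV. ?a j * v y $ ?Y j + (- ?b j) * v y $ ?X j)) x"
      unfolding q_def[abs_def] Du_def by (rule mollify_grad_add) (intro continuous_intros vc)+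
    also have "mollify_grad (\<epsilon> m) (\<lambda>y. 2 * (\<Sum>j\<in>UNIV. ?a j * v y $ ?Y j + (- ?b j) * v y $ ?X j)) x
        = 2 *\<^sub>R (\<Sum>j\<in>UNIV. mollify_grad (\<epsilon> m) (\<lambda>y. ?a j * v y $ ?Y j + (- ?b j) * v y $ ?X j) x)"
      unfolding mollify_grad_cmult
      by (rule arg_cong[of _ _ "scaleR 2"], rule mollify_grad_sum) (auto intro!: continuous_intros vc \<epsilon>)
    also have "(\<Sum>j\<in>UNIV. mollify_grad (\<epsilon> m) (\<lambda>y. ?a j * v y $ ?Y j + (- ?b j) * v y $ ?X j) x)
        = (\<Sum>j\<in>UNIV. ?a j *\<^sub>R Du m (?Y j) x - ?b j *\<^sub>R Du m (?X j) x)"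
    proof (rule sum.cong)
      fix j
      have "mollify_grad (\<epsilon> m) (\<lambda>y. ?a j * v y $ ?Y j + (- ?b j) * v y $ ?X j) x
          = mollify_grad (\<epsilon> m) (\<lambda>y. ?a j * v y $ ?Y j) x + mollify_grad (\<epsilon> m) (\<lambda>y. (- ?b j) * v y $ ?X j) x"
        by (rule mollify_grad_add) (intro continuous_intros vc)+
      then show "mollify_grad (\<epsilon> m) (\<lambda>y. ?a j * v y $ ?Y j + (- ?b j) * v y $ ?X j) x
          = ?a j *\<^sub>R Du m (?Y j) x - ?b j *\<^sub>R Du m (?X j) x"
        unfolding mollify_grad_cmult by (simp add: Du_def)
    qed simp
    finally have \<theta>q: "\<theta> m x = mollify_grad (\<epsilon> m) q x" by (simp add: \<theta>_def)
    have "norm (mollify_grad (\<epsilon> m) q x) \<le> ?C * (L' * (\<kappa> m)\<^sup>2) / \<epsilon> m"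
    proof (rule norm_mollify_grad_le[OF qc \<epsilon>(1)])
      fix y assume xy: "norm (y - x) \<le> \<epsilon> m"
      have "q y - q x = v y $ None - v x $ None
          + 2 * (\<Sum>j\<in>UNIV. ?a j * (v y $ ?Y j - v x $ ?Y j) - ?b j * (v y $ ?X j - v x $ ?X j))"
        by (simp add: q_def algebra_simps sum.distrib sum_subtractf)
      also have "\<dots> = (v y $ None - v x $ None
            + 2 * (\<Sum>j\<in>UNIV. v x $ ?X j * (v y $ ?Y j - v x $ ?Y j) - v x $ ?Y j * (v y $ ?X j - v x $ ?X j)))
          + 2 * (\<Sum>j\<in>UNIV. (?a j - v x $ ?X j) * (v y $ ?Y j - v x $ ?Y j)
              - (?b j - v x $ ?Y j) * (v y $ ?X j - v x $ ?X j))"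
        by (simp add: algebra_simps sum.distrib sum_subtractf)
      finally have diff: "q y - q x = \<dots>" .
      have "\<bar>2 * (\<Sum>j\<in>UNIV. (?a j - v x $ ?X j) * (v y $ ?Y j - v x $ ?Y j)
              - (?b j - v x $ ?Y j) * (v y $ ?X j - v x $ ?X j))\<bar> \<le> 4 * ?n * ((L * \<kappa> m) * \<kappa> m)"
        by (rule sum_le[OF xy u_near u_near])
      then have "\<bar>q y - q x\<bar> \<le> (\<kappa> m)\<^sup>2 + 4 * ?n * ((L * \<kappa> m) * \<kappa> m)"
        using contact[OF xy] unfolding diff by linarith
      then show "\<bar>q y - q x\<bar> \<le> L' * (\<kappa> m)\<^sup>2"
        by (simp add: L'_def power2_eq_square algebra_simps)
    qed
    then show ?thesis by (simp add: \<theta>q \<mu>_def)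
  qed
  have prod: "\<mu> m * \<Lambda> m ^ CARD('n) = (?C * L' * (?C * L) ^ CARD('n)) * (1 / Suc m) ^ (CARD('n) + 2)" for m
  proof -
    have "(\<epsilon> m powr \<alpha>) ^ (CARD('n) + 2) = \<epsilon> m powr (\<alpha> * real (CARD('n) + 2))"
      using powr_realpow[of "\<epsilon> m powr \<alpha>" "CARD('n) + 2"] \<epsilon>(1)[of m] by (simp only: powr_powr powr_gt_zero)
    also have "\<alpha> * real (CARD('n) + 2) = real (CARD('n) + 1)"
    proof -
      have "?n + 2 \<noteq> 0" by linarith
      then have "(?n + 1) / (?n + 2) * (?n + 2) = ?n + 1"
        by (simp only: times_divide_eq_left nonzero_mult_div_cancel_right not_False_eq_True)
      then show ?thesis by (simp only: \<alpha>_def of_nat_add of_nat_numeral of_nat_1)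
    qed
    also have "\<epsilon> m powr real (CARD('n) + 1) = \<epsilon> m ^ (CARD('n) + 1)"
      using \<epsilon>(1)[of m] by (rule powr_realpow)
    finally have k: "\<kappa> m ^ (CARD('n) + 2) = \<epsilon> m ^ (CARD('n) + 1) * (1 / Suc m) ^ (CARD('n) + 2)"
      unfolding \<kappa>_def power_divide by simp
    have "\<mu> m * \<Lambda> m ^ CARD('n)
        = (?C * L' * (?C * L) ^ CARD('n)) * (\<kappa> m ^ (CARD('n) + 2) / \<epsilon> m ^ (CARD('n) + 1))"
      by (simp add: \<mu>_def \<Lambda>_def power_divide power_mult_distrib power_add power2_eq_square)
    also have "\<kappa> m ^ (CARD('n) + 2) / \<epsilon> m ^ (CARD('n) + 1) = (1 / Suc m) ^ (CARD('n) + 2)"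
      unfolding k using \<epsilon>(1)[of m] by simp
    finally show ?thesis .
  qed
  have "(\<lambda>m. 1 / real (Suc m)) \<longlonglongrightarrow> 0"
    using LIMSEQ_inverse_real_of_nat by (simp add: inverse_eq_divide)
  then have "(\<lambda>m. (?C * L' * (?C * L) ^ CARD('n)) * (1 / real (Suc m)) ^ (CARD('n) + 2))
      \<longlonglongrightarrow> (?C * L' * (?C * L) ^ CARD('n)) * 0 ^ (CARD('n) + 2)"
    by (intro tendsto_mult tendsto_const tendsto_power)
  then have tends: "(\<lambda>m. \<mu> m * \<Lambda> m ^ CARD('n)) \<longlonglongrightarrow> 0" unfolding prod by simp
  have "horizontal_sequence u Du \<theta> (B + ?N * L) \<Lambda> \<mu>"
  proof (unfold_locales)
    show "CARD('k) = CARD('n) + 1" by (rule card)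
    show "C1_grad (\<lambda>x. u m x $ c) (Du m c)" for m c by (rule u_C1)
    show "norm (u m x) \<le> B + ?N * L" for m x
    proof -
      have "norm (u m x) \<le> norm (v x) + norm (u m x - v x)" by (rule norm_triangle_sub)
      moreover have "?N * (L * \<kappa> m) \<le> ?N * (L * 1)" using L1 by (intro mult_left_mono \<kappa>1) auto
      ultimately show ?thesis using v_bounded[of x] u_near_norm[of m x] by linarith
    qed
    show "norm (Du m c x) \<le> \<Lambda> m" for m c x
      using norm_mollify_grad_le[OF vc \<epsilon>(1) osc] by (simp add: Du_def \<Lambda>_def)
    show "norm (\<theta> m x) \<le> \<mu> m" for m x by (rule \<theta>_bound)
    show "(\<lambda>m. \<mu> m * \<Lambda> m ^ CARD('n)) \<longlonglongrightarrow> 0" by (rule tends)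
  qed (simp add: \<theta>_def)
  then show "\<exists>\<theta> M \<Lambda> \<mu>. horizontal_sequence u Du \<theta> M \<Lambda> \<mu>" by blast
qed

section \<open>The ball of dimension n + 1\<close>

text \<open>
  Being \<open>1\<close>-Lipschitz, the projection extends a map of the ball to the whole space with the same modulus of
  continuity, and it maps the complement of the ball to the sphere.
\<close>

definition ball_proj :: "'a::euclidean_space \<Rightarrow> 'a" where
  "ball_proj = closest_point (cball 0 1)"

lemma ball_proj_in: "ball_proj x \<in> cball 0 1"
  unfolding ball_proj_def by (rule closest_point_in_set) auto

lemma ball_proj_self: "x \<in> cball 0 1 \<Longrightarrow> ball_proj x = x"
  unfolding ball_proj_def by (rule closest_point_self)

lemma ball_proj_dist: "norm (ball_proj x - ball_proj y) \<le> norm (x - y)"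
  using closest_point_lipschitz[of "cball (0::'a::euclidean_space) 1" x y]
  by (simp add: ball_proj_def dist_norm)

lemma ball_proj_outside:
  assumes "norm x \<ge> 1"
  shows "ball_proj x = x /\<^sub>R norm x"
proof -
  have n: "norm x \<noteq> 0" using assms by linarith
  then have "(norm x - 1) * inverse (norm x) = 1 - inverse (norm x)"
    by (simp only: left_diff_distrib right_inverse not_False_eq_True mult_1)
  then have "x - x /\<^sub>R norm x = (norm x - 1) *\<^sub>R (x /\<^sub>R norm x)"
    by (simp add: scaleR_diff_left)
  moreover have unit: "norm (x /\<^sub>R norm x) = 1" using n by simp
  ultimately have "dist x (x /\<^sub>R norm x) = norm x - 1"
    using assms by (simp only: dist_norm norm_scaleR[of "norm x - 1"]) simp
  also have "\<dots> \<le> dist x z" if "norm z \<le> 1" for z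
    using norm_triangle_ineq2[of x z] that by (simp add: dist_norm)
  finally show ?thesis
    unfolding ball_proj_def using assms
    by (intro closest_point_unique[symmetric]) (auto simp: unit simp del: norm_scaleR)
qed

text \<open>
  The scales \<open>\<epsilon> m\<close> are chosen so that the oscillation is at most \<open>\<epsilon>\<^sup>a / (m + 1)\<close>, with
  \<open>a = (n + 1) / (n + 2)\<close>.  The form \<open>\<omega> = h dg\<^sub>1 \<and> \<dots> \<and> dg\<^sub>N\<close> then has pullbacks whose integrals tend to
  \<open>0\<close> by one lemma and are eventually equal to a positive constant by another.
\<close>

lemma no_sphere_embedding_extends:
  fixes f :: "real ^ 'k::{finite,wellorder} \<Rightarrow> 'n::finite heis"
  assumes card: "CARD('k) = CARD('n) + 1"
    and f: "f \<in> holder_plus_on ((real CARD('n) + 1) / (real CARD('n) + 2)) (cball 0 1)"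
    and inj: "inj_on f (sphere 0 1)"
  shows False
proof -
  define \<alpha> where "\<alpha> = (real CARD('n) + 1) / (real CARD('n) + 2)"
  have \<alpha>0: "\<alpha> > 0" by (simp add: \<alpha>_def)
  define F where "F x = f (ball_proj x)" for x
  define v where "v x = coords (F x)" for x
  have "\<exists>t. t > 0 \<and> t \<le> 1 \<and> (\<forall>x\<in>cball 0 1. \<forall>y\<in>cball 0 1. norm (x - y) \<le> t \<longrightarrow>
      dist (f x) (f y) \<le> (1 / Suc m) * norm (x - y) powr \<alpha>)" for m
    by (rule holder_plus_modulus[OF f, of "1 / Suc m"]) (auto simp: \<alpha>_def)
  then obtain \<epsilon> where \<epsilon>: "\<And>m. \<epsilon> m > 0" "\<And>m. \<epsilon> m \<le> 1" and f_mod: "\<And>m x y. x \<in> cball 0 1 \<Longrightarrow> y \<in> cball 0 1 \<Longrightarrow>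
      norm (x - y) \<le> \<epsilon> m \<Longrightarrow> dist (f x) (f y) \<le> (1 / Suc m) * norm (x - y) powr \<alpha>"
    by metis
  have F: "dist (F x) (F y) \<le> \<epsilon> m powr \<alpha> / Suc m" if "norm (x - y) \<le> \<epsilon> m" for m x y
  proof -
    have le: "norm (ball_proj x - ball_proj y) \<le> \<epsilon> m" using ball_proj_dist that by (rule order_trans)
    have "dist (F x) (F y) \<le> (1 / Suc m) * norm (ball_proj x - ball_proj y) powr \<alpha>"
      unfolding F_def by (rule f_mod[OF ball_proj_in ball_proj_in le])
    also have "\<dots> \<le> (1 / Suc m) * \<epsilon> m powr \<alpha>"
      using le \<alpha>0 by (intro mult_left_mono powr_mono2) auto
    finally show ?thesis by simp
  qed
  have "continuous_on UNIV F"
    unfolding continuous_on_iff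
  proof (intro ballI allI impI)
    fix x and e :: real assume "e > 0"
    then obtain m where m: "inverse (real (Suc m)) < e" using reals_Archimedean by blast
    have "dist (F y) (F x) < e" if "dist y x < \<epsilon> m" for y
    proof -
      have "dist (F y) (F x) \<le> \<epsilon> m powr \<alpha> / Suc m" using that by (intro F) (simp add: dist_norm)
      also have "\<dots> \<le> 1 powr \<alpha> / Suc m"
        using \<epsilon>[of m] \<alpha>0 by (intro divide_right_mono powr_mono2) auto
      also have "\<dots> < e" using m by (simp add: inverse_eq_divide)
      finally show ?thesis .
    qed
    then show "\<exists>d>0. \<forall>x'\<in>UNIV. dist x' x < d \<longrightarrow> dist (F x') (F x) < e" using \<epsilon>(1) by blast
  qed
  then have v_cont: "continuous_on UNIV v"
    unfolding v_def[abs_def] by (rule continuous_on_compose2[OF continuous_on_coords]) simp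
  have v_proj: "v (ball_proj x) = v x" for x
    by (simp add: v_def F_def ball_proj_self[OF ball_proj_in])
  obtain B where B: "\<And>x. norm (v x) \<le> B"
  proof -
    have "compact (v ` cball 0 1)"
      by (intro compact_continuous_image continuous_on_subset[OF v_cont]) auto
    then obtain B where "\<And>x. x \<in> cball 0 1 \<Longrightarrow> norm (v x) \<le> B"
      using compact_imp_bounded bounded_iff by (metis imageI)
    then have "norm (v x) \<le> B" for x using ball_proj_in[of x] v_proj[of x] by metis
    then show ?thesis by (rule that)
  qed
  define u where "u m x = (\<chi> c. mollify (\<epsilon> m) (\<lambda>y. v y $ c) x)" for m x
  define Du where "Du m c = mollify_grad (\<epsilon> m) (\<lambda>y. v y $ c)" for m c
  note seq = mollified_horizontal_sequence[of \<epsilon> F B, OF card \<epsilon> F[unfolded \<alpha>_def] v_cont[unfolded v_def[abs_def]]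
      B[unfolded v_def], folded v_def u_def Du_def]
  obtain \<theta> M \<Lambda> \<mu> where hs: "horizontal_sequence u Du \<theta> M \<Lambda> \<mu>"
    using seq(1) unfolding u_def[abs_def] Du_def[abs_def] by blast
  obtain L where L: "\<And>m x. norm (u m x - v x) \<le> L / Suc m"
    using seq(2) unfolding u_def[abs_def] by blast
  interpret horizontal_sequence u Du \<theta> M \<Lambda> \<mu> by (rule hs)

  have v_inj: "inj_on v (sphere 0 1)"
  proof (rule inj_onI)
    fix x y :: "(real, 'k) vec"
    assume xy: "x \<in> sphere 0 1" "y \<in> sphere 0 1" "v x = v y"
    then have "F x = F y" unfolding v_def by (simp add: inj_coords[THEN injD])
    then show "x = y" using inj xy by (auto simp: F_def ball_proj_self inj_on_def)
  qed
  define w where "w = inv_into (sphere 0 1) v"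
  have w: "\<forall>x\<in>sphere 0 1. w (v x) = x" unfolding w_def using inv_into_f_f[OF v_inj] by blast
  have "continuous_on (v ` sphere 0 1) w"
    by (rule continuous_on_inv[OF continuous_on_subset[OF v_cont] compact_sphere w]) simp
  moreover have "compact (v ` sphere 0 1)"
    by (intro compact_continuous_image continuous_on_subset[OF v_cont] compact_sphere) simp
  ultimately obtain g where g: "polynomial_function g" "\<forall>y\<in>v ` sphere 0 1. norm (w y - g y) < 1/8"
    using Stone_Weierstrass_polynomial_function[of "v ` sphere 0 1" w "1/8"] by auto
  have g_poly: "real_polynomial_function (\<lambda>y. g y $ i)" for i
    using g(1) bounded_linear_vec_nth[of i] unfolding polynomial_function_def o_def by blast
  then have "\<exists>P. C1_grad (\<lambda>y. g y $ i) P \<and> (\<forall>c. real_polynomial_function (\<lambda>y. P y $ c))" for i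
    by (rule polynomial_C1_grad)
  then obtain G where G: "\<And>i. C1_grad (\<lambda>y. g y $ i) (G i)"
    and G_poly: "\<And>i c. real_polynomial_function (\<lambda>y. G i y $ c)" by metis
  have G': "\<exists>G'. C1_grad (\<lambda>y. G i y $ c) G'" for i c using polynomial_C1_grad[OF G_poly] by blast

  have near: "\<forall>\<^sub>F m in sequentially. \<forall>x. norm x \<ge> 1 \<longrightarrow> norm (g (u m x) - x /\<^sub>R norm x) \<le> 1/4"
  proof -
    \<comment> \<open>This ball contains all values of \<open>v\<close> and of the maps \<open>u m\<close>.\<close>
    have "continuous_on (cball 0 (B + \<bar>L\<bar>)) g"
      using continuous_polymonial_function[OF g(1)] by (simp add: continuous_at_imp_continuous_on)
    then have "uniformly_continuous_on (cball 0 (B + \<bar>L\<bar>)) g"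
      by (rule compact_uniformly_continuous) simp
    then obtain \<delta> where \<delta>: "\<delta> > 0" "\<And>y z. y \<in> cball 0 (B + \<bar>L\<bar>) \<Longrightarrow> z \<in> cball 0 (B + \<bar>L\<bar>) \<Longrightarrow>
        dist z y < \<delta> \<Longrightarrow> dist (g z) (g y) < 1/8"
      unfolding uniformly_continuous_on_def by (metis zero_less_divide_1_iff zero_less_numeral)
    have "(\<lambda>m. L * inverse (real (Suc m))) \<longlonglongrightarrow> L * 0"
      by (intro tendsto_mult tendsto_const LIMSEQ_inverse_real_of_nat)
    then have "(\<lambda>m. L / Suc m) \<longlonglongrightarrow> 0" by (simp add: divide_inverse)
    then have "\<forall>\<^sub>F m in sequentially. L / Suc m < \<delta>" using \<delta>(1) by (rule order_tendstoD(2))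
    then show ?thesis
    proof (rule eventually_mono, intro allI impI)
      fix m and x :: "(real, 'k) vec" assume m: "L / Suc m < \<delta>" and x: "norm x \<ge> 1"
      have "norm x \<noteq> 0" using x by linarith
      then have sph: "ball_proj x \<in> sphere 0 1" by (simp add: ball_proj_outside[OF x])
      have "L / Suc m \<le> \<bar>L\<bar> / 1" by (rule frac_le) auto
      then have "norm (u m x) \<le> B + \<bar>L\<bar>"
        using norm_triangle_sub[of "u m x" "v x"] L[of m x] B[of x] by linarith
      moreover have "norm (v x) \<le> B + \<bar>L\<bar>" using B[of x] by linarith
      moreover have "dist (u m x) (v x) < \<delta>" using L[of m x] m by (simp add: dist_norm)
      ultimately have "dist (g (u m x)) (g (v x)) < 1/8" by (intro \<delta>(2)) simp_all
      moreover have "dist (g (v x)) (ball_proj x) < 1/8"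
      proof -
        have "w (v (ball_proj x)) = ball_proj x" using w sph by blast
        then have "norm (ball_proj x - g (v (ball_proj x))) < 1/8" using g(2) sph by (metis imageI)
        then show ?thesis by (simp add: v_proj dist_norm norm_minus_commute)
      qed
      ultimately have "dist (g (u m x)) (ball_proj x) < 1/8 + 1/8"
        using dist_triangle[of "g (u m x)" "ball_proj x" "g (v x)"] by linarith
      then show "norm (g (u m x) - x /\<^sub>R norm x) \<le> 1/4" by (simp add: dist_norm ball_proj_outside[OF x])
    qed
  qed

  obtain \<Psi> :: "real ^ 'k::_ \<Rightarrow> real" and D D' k where \<Psi>: "C1_grad \<Psi> D" "C1_grad (\<lambda>y. D y $ k) D'"
    "\<And>y. norm y \<ge> 1/2 \<Longrightarrow> D y $ k = 0" "integral (cube 2) (\<lambda>y. D y $ k) > 0"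
    by (rule potential_of_bump) (rule that)
  define h where "h y = D (g y) $ k" for y
  have "test_function h"
    unfolding test_function_def
  proof
    show "\<exists>H. C1_grad h H" unfolding h_def[abs_def] using C1_grad_compose[OF \<Psi>(2) G] by blast
    show "\<forall>\<^sub>F m in sequentially. \<forall>x. norm x \<ge> 1 \<longrightarrow> h (u m x) = 0"
      using near
    proof (rule eventually_mono, intro allI impI)
      fix m and x :: "(real, 'k) vec"
      assume "\<forall>x. norm x \<ge> 1 \<longrightarrow> norm (g (u m x) - x /\<^sub>R norm x) \<le> 1/4" and x: "norm x \<ge> 1"
      then have "norm (g (u m x) - x /\<^sub>R norm x) \<le> 1/4" by blast
      moreover have "norm x \<noteq> 0" using x by linarith
      then have "norm (x /\<^sub>R norm x) = 1" by simp
      ultimately have "norm (g (u m x)) \<ge> 1/2"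
        using norm_triangle_sub[of "x /\<^sub>R norm x" "g (u m x)"] norm_minus_commute[of "g (u m x)" "x /\<^sub>R norm x"]
        by linarith
      then show "h (u m x) = 0" unfolding h_def by (rule \<Psi>(3))
    qed
  qed
  from pullback_tends_0[of h G, OF this G']
  have "(\<lambda>m. integral (cube 2) (\<lambda>x. h (u m x) * rdet (\<lambda>i. \<Sum>c\<in>UNIV. (G i (u m x) $ c) *\<^sub>R Du m c x))) \<longlonglongrightarrow> 0" .
  moreover have "\<forall>\<^sub>F m in sequentially.
      integral (cube 2) (\<lambda>x. h (u m x) * rdet (\<lambda>i. \<Sum>c\<in>UNIV. (G i (u m x) $ c) *\<^sub>R Du m c x))
      = integral (cube 2) (\<lambda>y. D y $ k)"
    using near
  proof (rule eventually_mono)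
    fix m assume "\<forall>x. norm x \<ge> 1 \<longrightarrow> norm (g (u m x) - x /\<^sub>R norm x) \<le> 1/4"
    then show "integral (cube 2) (\<lambda>x. h (u m x) * rdet (\<lambda>i. \<Sum>c\<in>UNIV. (G i (u m x) $ c) *\<^sub>R Du m c x))
      = integral (cube 2) (\<lambda>y. D y $ k)"
      unfolding h_def
      by (intro integral_degree_one_near_sphere[OF C1_grad_compose[OF G u_C1] _ \<Psi>(1,3)]) blast
  qed
  ultimately have "(\<lambda>m::nat. integral (cube 2) (\<lambda>y. D y $ k)) \<longlonglongrightarrow> 0"
    by (rule Lim_transform_eventually)
  then have "integral (cube 2) (\<lambda>y. D y $ k) = 0"
    by (simp add: LIMSEQ_const_iff)
  with \<Psi>(4) show False by simp
qed

section \<open>Balls of larger dimension\<close>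

text \<open>
  An index type with \<open>n + 1\<close> elements.  It is realised by numbers because the change of variables formula,
  and with it everything about determinants of gradients, asks for a well-ordered index type.
\<close>

typedef (overloaded) 'n idx = "{..CARD('n::finite)}"
  by auto

lemma card_idx: "CARD('n::finite idx) = CARD('n) + 1"
  by (simp add: type_definition.card[OF type_definition_idx])

instance idx :: (finite) finite
proof
  show "finite (UNIV :: 'a idx set)"
    using card_idx[where 'n = 'a] by (intro card_ge_0_finite) simp
qed

instantiation idx :: (finite) wellorder
begin

definition less_eq_idx :: "'a idx \<Rightarrow> 'a idx \<Rightarrow> bool" where
  "x \<le> y \<longleftrightarrow> Rep_idx x \<le> Rep_idx y"

definition less_idx :: "'a idx \<Rightarrow> 'a idx \<Rightarrow> bool" where
  "x < y \<longleftrightarrow> Rep_idx x < Rep_idx y"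

instance
proof
  fix P :: "'a idx \<Rightarrow> bool" and a
  assume step: "\<And>x. (\<And>y. y < x \<Longrightarrow> P y) \<Longrightarrow> P x"
  show "P a"
    by (induction a rule: measure_induct_rule[of Rep_idx]) (auto intro: step simp: less_idx_def)
qed (auto simp: less_eq_idx_def less_idx_def Rep_idx_inject)

end

lemma holder_plus_on_compose_isometry:
  assumes f: "f \<in> holder_plus_on \<alpha> T" and iso: "\<And>x y. norm (E x - E y) = norm (x - y)" and E: "E ` S \<subseteq> T"
  shows "(\<lambda>x. f (E x)) \<in> holder_plus_on \<alpha> S"
proof -
  have lim: "((\<lambda>t. SUP (x, y)\<in>{(x, y). x \<in> T \<and> y \<in> T \<and> 0 < norm (x - y) \<and> norm (x - y) \<le> t}.
      ennreal (dist (f x) (f y) / norm (x - y) powr \<alpha>)) \<longlongrightarrow> 0) (at_right 0)"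
    using f by (simp add: holder_plus_on_def)
  have le: "(SUP (x, y)\<in>{(x, y). x \<in> S \<and> y \<in> S \<and> 0 < norm (x - y) \<and> norm (x - y) \<le> t}.
      ennreal (dist (f (E x)) (f (E y)) / norm (x - y) powr \<alpha>))
    \<le> (SUP (x, y)\<in>{(x, y). x \<in> T \<and> y \<in> T \<and> 0 < norm (x - y) \<and> norm (x - y) \<le> t}.
      ennreal (dist (f x) (f y) / norm (x - y) powr \<alpha>))" for t
  proof (rule SUP_mono)
    fix p assume "p \<in> {(x, y). x \<in> S \<and> y \<in> S \<and> 0 < norm (x - y) \<and> norm (x - y) \<le> t}"
    then obtain x y where p: "p = (x, y)" and xy: "x \<in> S" "y \<in> S" "0 < norm (x - y)" "norm (x - y) \<le> t"
      by blast
    show "\<exists>q\<in>{(x, y). x \<in> T \<and> y \<in> T \<and> 0 < norm (x - y) \<and> norm (x - y) \<le> t}.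
        (case p of (x, y) \<Rightarrow> ennreal (dist (f (E x)) (f (E y)) / norm (x - y) powr \<alpha>))
        \<le> (case q of (x, y) \<Rightarrow> ennreal (dist (f x) (f y) / norm (x - y) powr \<alpha>))"
      by (rule bexI[of _ "(E x, E y)"]) (use p xy E iso[of x y] in auto)
  qed
  show ?thesis
    unfolding holder_plus_on_def mem_Collect_eq
    by (rule tendsto_sandwich[OF _ always_eventually tendsto_const lim]) (simp, rule allI, rule le)
qed

theorem corollary1p3:
  assumes "CARD('m::finite) \<ge> CARD('n::finite) + 1"
  shows "\<not> (\<exists>f :: real ^ 'm \<Rightarrow> 'n heis.
           f \<in> holder_plus_on ((real CARD('n) + 1) / (real CARD('n) + 2)) (cball 0 1) \<and>
           (\<exists>g. homeomorphism (sphere 0 1) (f ` sphere 0 1) f g))"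
proof
  assume "\<exists>f :: real ^ 'm \<Rightarrow> 'n heis.
      f \<in> holder_plus_on ((real CARD('n) + 1) / (real CARD('n) + 2)) (cball 0 1) \<and>
      (\<exists>g. homeomorphism (sphere 0 1) (f ` sphere 0 1) f g)"
  then obtain f :: "real ^ 'm \<Rightarrow> 'n heis" and g
    where f: "f \<in> holder_plus_on ((real CARD('n) + 1) / (real CARD('n) + 2)) (cball 0 1)"
      and hom: "homeomorphism (sphere 0 1) (f ` sphere 0 1) f g" by blast
  have f_inj: "inj_on f (sphere 0 1)"
    using hom unfolding homeomorphism_def by (metis inj_on_inverseI)
  obtain \<iota> :: "'n idx \<Rightarrow> 'm" where \<iota>: "inj \<iota>"
    using card_le_inj[of "UNIV :: 'n idx set" "UNIV :: 'm set"] assms by (auto simp: card_idx)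
  define E :: "real ^ 'n idx \<Rightarrow> real ^ 'm"
    where "E x = (\<chi> i. if i \<in> range \<iota> then x $ inv \<iota> i else 0)" for x
  have E_diff: "E x - E y = E (x - y)" for x y
    by (simp add: E_def vec_eq_iff)
  have E_norm: "norm (E x) = norm x" for x
  proof -
    have "(\<Sum>i\<in>UNIV. (E x $ i)\<^sup>2) = (\<Sum>i\<in>range \<iota>. (x $ inv \<iota> i)\<^sup>2)"
      by (rule sum.mono_neutral_cong_right) (auto simp: E_def)
    also have "\<dots> = (\<Sum>j\<in>UNIV. (x $ j)\<^sup>2)"
      by (subst sum.reindex[OF \<iota>]) (simp add: inv_f_f[OF \<iota>])
    finally show ?thesis by (simp add: norm_vec_def L2_set_def)
  qed
  have iso: "norm (E x - E y) = norm (x - y)" for x y by (simp add: E_diff E_norm)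
  show False
  proof (rule no_sphere_embedding_extends)
    show "CARD('n idx) = CARD('n) + 1" by (rule card_idx)
    show "(\<lambda>x. f (E x)) \<in> holder_plus_on ((real CARD('n) + 1) / (real CARD('n) + 2)) (cball 0 1)"
      by (rule holder_plus_on_compose_isometry[OF f iso]) (auto simp: E_norm)
    show "inj_on (\<lambda>x. f (E x)) (sphere 0 1)"
    proof (rule inj_onI)
      fix x y assume xy: "x \<in> sphere 0 1" "y \<in> sphere 0 1" "f (E x) = f (E y)"
      then have "E x = E y" by (intro inj_onD[OF f_inj]) (auto simp: E_norm)
      then show "x = y" using iso[of x y] by simp
    qed
  qed
qed

end
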